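(* Let $X_1,X_2,\ldots$ be independent with common continuous distribution, let $0<q<1$, and let $n(q)$ be independent of $X_1,X_2,\ldots$ with $\mathbb{P}(n(q)\ge n)=q^n$ for $n=0,1,2,\ldots$. Then the point process of lengths and increments of faces of the concave majorant of $S^{[0,n(q)]}$ is a Poisson point process on $\{1,2,\ldots\}\times\mathbb{R}$ with intensity $j^{-1}q^j\,\mathbb{P}(S_j\in dx)$ for $j=1,2,\ldots$, $x\in\mathbb{R}$. Moreover, let $T_i=\sum_{l=1}^iN_{n(q),l}$, $0\le i\le F_{n(q)}$, be the consecutive times at which $S^{[0,n(q)]}$ meets its concave majorant, so that $T_0=0$ and $T_{F_{n(q)}}=n(q)$. Then the sequence of path segments $$\{(S_{T_i+k}-S_{T_i},\ 0\le k\le N_{n(q),i+1}),\ i=0,\ldots,F_{n(q)}-1\}$$ is a list of the points of a Poisson point process in the space of finite random walk segments $$\{(s_1,\ldots,s_j)\text{ for some }j=1,2,\ldots\}$$ whose intensity measure on paths of length $j$ is $q^jj^{-1}$ times the conditional distribution of $(S_1,\ldots,S_j)$ given that $S_k<(k/j)S_j$ for all $1\le k\le j-1$.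
   Context: $S_0=0$, $S_j=\sum_{i=1}^jX_i$, $S^{[0,n(q)]}=\{(j,S_j):0\le j\le n(q)\}$. The concave majorant of $S^{[0,m]}$ is the least concave function $C$ on $[0,m]$ with $C(j)\ge S_j$ for $0\le j\le m$. The times $0<N_{n(q),1}<N_{n(q),1}+N_{n(q),2}<\cdots<N_{n(q),1}+\cdots+N_{n(q),F_{n(q)}}=n(q)$ are the successive positive integer times at which $S^{[0,n(q)]}$ meets its concave majorant; almost surely $F_{n(q)}$ is the number of faces (maximal linear pieces) of the concave majorant ($F_0=0$), and $N_{n(q),i}$ is the length of the $i$th face. The increment of the $i$th face is $S_{T_i}-S_{T_{i-1}}$. A path segment $(s_0,s_1,\ldots,s_j)$ with $s_0=0$ is identified with $(s_1,\ldots,s_j)$ and has length $j$. "Continuous distribution" means a distribution without atoms. *)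

theory Defs
  imports "HOL-Probability.Probability"
begin

text \<open>
  A point process is a random measure \<open>N \<omega>\<close> with values in the natural numbers and infinity; the
  multiset of points listed by \<open>p\<close> over an index set \<open>I\<close> is \<open>distr (count_space I) E p\<close>, that is,
  the sum over \<open>i\<close> in \<open>I\<close> of the Dirac measures at \<open>p i\<close>.
  The Poisson weights are written out because \<^const>\<open>poisson_pmf\<close> is only specified for positive
  rates; for rate 0 the formula gives the point mass at 0.
\<close>

definition poisson_point_process ::
    "'a measure \<Rightarrow> ('a \<Rightarrow> 'b measure) \<Rightarrow> 'b measure \<Rightarrow> bool" where
  "poisson_point_process M N \<mu> \<longleftrightarrow>
     (\<forall>\<omega>\<in>space M. sets (N \<omega>) = sets \<mu> \<and>
        (\<forall>A\<in>sets \<mu>. emeasure (N \<omega>) A \<in> insert \<infinity> (range of_nat))) \<and>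
     (\<forall>A\<in>sets \<mu>. (\<lambda>\<omega>. emeasure (N \<omega>) A) \<in> borel_measurable M) \<and>
     (\<forall>A\<in>sets \<mu>. emeasure \<mu> A < \<infinity> \<longrightarrow>
        (\<forall>k::nat. measure M {\<omega>\<in>space M. emeasure (N \<omega>) A = of_nat k} =
           measure \<mu> A ^ k / fact k * exp (- measure \<mu> A))) \<and>
     (\<forall>A\<in>sets \<mu>. emeasure \<mu> A = \<infinity> \<longrightarrow> (AE \<omega> in M. emeasure (N \<omega>) A = \<infinity>)) \<and>
     (\<forall>(m::nat) A. (\<forall>i<m. A i \<in> sets \<mu>) \<and> disjoint_family_on A {..<m} \<longrightarrow>
        prob_space.indep_vars M (\<lambda>_. borel) (\<lambda>i \<omega>. emeasure (N \<omega>) (A i)) {..<m})"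

definition is_concave_majorant :: "(nat \<Rightarrow> real) \<Rightarrow> nat \<Rightarrow> (real \<Rightarrow> real) \<Rightarrow> bool" where
  "is_concave_majorant s m C \<longleftrightarrow>
     concave_on {0..real m} C \<and> (\<forall>j\<le>m. s j \<le> C (real j)) \<and>
     (\<forall>D. concave_on {0..real m} D \<and> (\<forall>j\<le>m. s j \<le> D (real j)) \<longrightarrow>
        (\<forall>x\<in>{0..real m}. C x \<le> D x))"

text \<open>Only the values on \<open>{0..real m}\<close> are determined (and meaningful).\<close>

definition concave_majorant :: "(nat \<Rightarrow> real) \<Rightarrow> nat \<Rightarrow> real \<Rightarrow> real" where
  "concave_majorant s m = (SOME C. is_concave_majorant s m C)"

lemma is_concave_majorant_concave_majorant: "is_concave_majorant s m (concave_majorant s m)"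
proof -
  define P where "P D \<longleftrightarrow> concave_on {0..real m} D \<and> (\<forall>j\<le>m. s j \<le> D (real j))" for D
  define C where "C x = Inf ((\<lambda>D. D x) ` {D. P D})" for x
  define b where "b = Max (s ` {..m})"
  have "P (\<lambda>_. b)"
    by (auto simp: P_def b_def concave_on_const)
  then have ne: "(\<lambda>D. D x) ` {D. P D} \<noteq> {}" for x :: real
    by blast
  have low: "min (s 0) (s m) \<le> D x" if D: "P D" and x: "x \<in> {0..real m}" for D x
  proof (cases "m = 0")
    case True
    then show ?thesis using D x by (auto simp: P_def)
  next
    case False
    define t where "t = x / real m"
    have t: "0 \<le> t" "t \<le> 1" "x = t * real m"
      using False x by (auto simp: t_def)
    have "(1 - t) * D 0 + t * D (real m) \<le> D x"
      using concave_onD[of "{0..real m}" D t 0 "real m"] D t by (auto simp: P_def)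
    moreover have "s 0 \<le> D 0" "s m \<le> D (real m)"
      using D unfolding P_def by force+
    moreover have "(1 - t) * min (s 0) (s m) + t * min (s 0) (s m) \<le> (1 - t) * D 0 + t * D (real m)"
      using t calculation by (intro add_mono mult_left_mono) auto
    ultimately show ?thesis
      by (simp add: algebra_simps)
  qed
  have le: "C x \<le> D x" if "P D" "x \<in> {0..real m}" for D x
    unfolding C_def using that low by (intro cInf_lower bdd_belowI) auto
  have ge: "y \<le> C x" if "\<And>D. P D \<Longrightarrow> y \<le> D x" for x y
    unfolding C_def using that by (intro cInf_greatest ne) auto
  have "concave_on {0..real m} C"
    unfolding concave_on_iff
  proof (intro conjI ballI allI impI)
    fix x y u v :: real
    assume xy: "x \<in> {0..real m}" "y \<in> {0..real m}" and uv: "0 \<le> u" "0 \<le> v" "u + v = 1"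
    show "u * C x + v * C y \<le> C (u *\<^sub>R x + v *\<^sub>R y)"
    proof (rule ge)
      fix D assume D: "P D"
      have "u * C x + v * C y \<le> u * D x + v * D y"
        using le[OF D] xy uv by (intro add_mono mult_left_mono) auto
      also have "\<dots> \<le> D (u *\<^sub>R x + v *\<^sub>R y)"
        using D xy uv unfolding P_def concave_on_iff by blast
      finally show "u * C x + v * C y \<le> D (u *\<^sub>R x + v *\<^sub>R y)" .
    qed
  qed simp
  moreover have "s j \<le> C (real j)" if "j \<le> m" for j
    using that by (intro ge) (auto simp: P_def)
  ultimately have "is_concave_majorant s m C"
    using le unfolding is_concave_majorant_def P_def by blast
  then show ?thesis
    unfolding concave_majorant_def by (rule someI[of "is_concave_majorant s m"])
qed

text \<open>
  Faces are delimited by the successive times at which the path meets its concave majorant. If the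
  path meets the interior of a linear piece, that piece is split; for walks with continuous
  increments this has probability 0.
\<close>

definition contact_times :: "(nat \<Rightarrow> real) \<Rightarrow> nat \<Rightarrow> nat set" where
  "contact_times s m = {k. k \<le> m \<and> concave_majorant s m (real k) = s k}"

definition num_faces :: "(nat \<Rightarrow> real) \<Rightarrow> nat \<Rightarrow> nat" where
  "num_faces s m = card (contact_times s m - {0})"

text \<open>\<open>face_length s m i\<close> is meant for \<open>1 \<le> i \<le> num_faces s m\<close>.\<close>

definition face_length :: "(nat \<Rightarrow> real) \<Rightarrow> nat \<Rightarrow> nat \<Rightarrow> nat" where
  "face_length s m i =
     (let ts = 0 # sorted_list_of_set (contact_times s m - {0}) in ts ! i - ts ! (i - 1))"

definition face_time :: "(nat \<Rightarrow> real) \<Rightarrow> nat \<Rightarrow> nat \<Rightarrow> nat" where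
  "face_time s m i = (\<Sum>l=1..i. face_length s m l)"

definition face_increment :: "(nat \<Rightarrow> real) \<Rightarrow> nat \<Rightarrow> nat \<Rightarrow> real" where
  "face_increment s m i = s (face_time s m i) - s (face_time s m (i - 1))"

text \<open>
  A path segment starting at 0 is the list of its remaining values; the segment below has index
  \<open>i < num_faces s m\<close> and lies over the face number \<open>i + 1\<close>.
\<close>

definition face_segment :: "(nat \<Rightarrow> real) \<Rightarrow> nat \<Rightarrow> nat \<Rightarrow> real list" where
  "face_segment s m i =
     map (\<lambda>k. s (face_time s m i + k) - s (face_time s m i)) [1..<Suc (face_length s m (i + 1))]"

definition face_space :: "(nat \<times> real) measure" where
  "face_space = count_space {1..} \<Otimes>\<^sub>M borel"

text \<open>The disjoint union over \<open>j \<ge> 1\<close> of \<open>j\<close>-dimensional real space with its Borel sets.\<close>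

definition segment_space :: "real list measure" where
  "segment_space = sigma {xs. xs \<noteq> []}
     {{xs. length xs = j \<and> (\<forall>i<j. xs ! i \<in> B i)} | j B. 1 \<le> j \<and> (\<forall>i<j. B i \<in> sets borel)}"

definition face_process :: "(nat \<Rightarrow> real) \<Rightarrow> nat \<Rightarrow> (nat \<times> real) measure" where
  "face_process s m = distr (count_space {1..num_faces s m}) face_space
     (\<lambda>i. (face_length s m i, face_increment s m i))"

definition segment_process :: "(nat \<Rightarrow> real) \<Rightarrow> nat \<Rightarrow> real list measure" where
  "segment_process s m = distr (count_space {..<num_faces s m}) segment_space (face_segment s m)"

definition walk :: "(nat \<Rightarrow> 'a \<Rightarrow> real) \<Rightarrow> 'a \<Rightarrow> nat \<Rightarrow> real" where
  "walk X \<omega> j = (\<Sum>i=1..j. X i \<omega>)"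

definition length_intensity :: "real \<Rightarrow> nat measure" where
  "length_intensity q = density (count_space {1..}) (\<lambda>j. ennreal (q ^ j / real j))"

text \<open>
  Binding a measure on lengths \<open>j\<close> with a kernel \<open>K\<close> gives the measure
  \<open>A \<mapsto> (\<Sum>j\<ge>1. q ^ j / j * K j A)\<close>; here \<open>K j\<close> is carried by the points of length \<open>j\<close>.
\<close>

definition face_intensity :: "'a measure \<Rightarrow> (nat \<Rightarrow> 'a \<Rightarrow> real) \<Rightarrow> real \<Rightarrow> (nat \<times> real) measure" where
  "face_intensity M X q =
     bind (length_intensity q) (\<lambda>j. distr M face_space (\<lambda>\<omega>. (j, walk X \<omega> j)))"

definition below_chord :: "'a measure \<Rightarrow> (nat \<Rightarrow> 'a \<Rightarrow> real) \<Rightarrow> nat \<Rightarrow> 'a set" where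
  "below_chord M X j =
     {\<omega>\<in>space M. \<forall>k. 1 \<le> k \<and> k \<le> j - 1 \<longrightarrow> walk X \<omega> k < real k / real j * walk X \<omega> j}"

definition segment_intensity :: "'a measure \<Rightarrow> (nat \<Rightarrow> 'a \<Rightarrow> real) \<Rightarrow> real \<Rightarrow> real list measure" where
  "segment_intensity M X q =
     bind (length_intensity q)
       (\<lambda>j. distr (uniform_measure M (below_chord M X j)) segment_space
              (\<lambda>\<omega>. map (walk X \<omega>) [1..<Suc j]))"

end

theory Submission
  imports Defs
begin

text \<open>
  Cut a path at its contact times. A prescribed finite set of times, containing both end points, is
  the set of contact times if and only if the segments cut off by it stay strictly below their
  chords and the slopes of these chords decrease (\<open>contact_times_imp_concave\<close>,
  \<open>concave_imp_contact_times\<close>). So a description of the faces amounts to a condition on each single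
  segment and one condition, on the order of the slopes, that links them.

  For the random walk, the segments between fixed times are independent and each has the law of an
  initial segment of the same length. The weight \<open>(1 - q) q\<^sup>k\<close> of the event \<open>n = k\<close> factorises over the
  segments as well, up to the constant \<open>1 - q\<close>. Let \<open>\<nu>\<close> be the measure on segments which on length \<open>j\<close>
  is \<open>q\<^sup>j\<close> times the law of \<open>(S\<^sub>1, \<dots>, S\<^sub>j)\<close> restricted to the paths strictly below their chord. Summing
  over all lengths, the sequence of the segments over the faces, on the event that there are \<open>f\<close> of
  them, has density \<open>1 - q\<close> with respect to the restriction of the power \<open>\<nu>\<^sup>f\<close> to the tuples with
  decreasing slopes (\<open>law_of_faces\<close>).

  The slopes have no atoms under \<open>\<nu>\<close>, so almost every tuple has exactly one rearrangement with
  decreasing slopes. For quantities that do not depend on the order of the segments, such as the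
  numbers of segments in given sets, the restriction therefore only divides \<open>\<nu>\<^sup>f\<close> by \<open>f!\<close>
  (\<open>emeasure_decreasing_tuples\<close>). What results is the law of a Poisson process with intensity \<open>\<nu>\<close>,
  provided that \<open>1 - q\<close> is the normalising constant \<open>exp (- \<nu> total)\<close>
  (\<open>poisson_point_process_listing\<close>).

  Both this normalisation and the identification of \<open>\<nu>\<close> come from the cyclic lemma: among the \<open>j\<close>
  cyclic rotations of the first \<open>j\<close> steps exactly one gives a path strictly below its chord, almost
  surely, and no rotation changes \<open>S\<^sub>j\<close>. Hence staying below the chord has probability \<open>1/j\<close> and is
  independent of \<open>S\<^sub>j\<close> (\<open>cyclic_lemma\<close>). So \<open>q\<^sup>j\<close> times the restricted law is \<open>q\<^sup>j/j\<close> times the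
  conditional law, the total mass of \<open>\<nu>\<close> is \<open>\<Sum>j\<ge>1. q\<^sup>j/j = - ln (1 - q)\<close>, and the image of \<open>\<nu>\<close> under
  length and final value has the intensity claimed for the lengths and increments of the faces.
\<close>

section \<open>Contact times of a path with its concave majorant\<close>

text \<open>
  Every chord from the left to a contact time is at least as steep as every chord from it to the
  right, and finitely many slopes can be separated by a number. Working with these slopes rather
  than with a one-sided derivative of the majorant covers the two end points, where the majorant
  alone does not provide a finite slope.
\<close>

lemma contact_times_iff_support_line:
  "k \<in> contact_times s m \<longleftrightarrow> k \<le> m \<and> (\<exists>a. \<forall>j\<le>m. s j \<le> s k + a * (real j - real k))"
proof -
  define C where "C = concave_majorant s m"
  have C: "is_concave_majorant s m C"
    unfolding C_def by (rule is_concave_majorant_concave_majorant)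
  then have conc: "concave_on {0..real m} C" and ge: "\<And>j. j \<le> m \<Longrightarrow> s j \<le> C (real j)"
    by (auto simp: is_concave_majorant_def)
  {
    assume "k \<in> contact_times s m"
    then have km: "k \<le> m" and Ck: "C (real k) = s k"
      by (auto simp: contact_times_def C_def)
    have sep: "(s j - s k) * (real k - real i) \<le> (s k - s i) * (real j - real k)"
      if "i < k" "k < j" "j \<le> m" for i j
    proof -
      define t where "t = (real k - real i) / (real j - real i)"
      have t: "0 \<le> t" "t \<le> 1" and t1: "t * (real j - real i) = real k - real i"
        using that by (auto simp: t_def)
      have eq: "(1 - t) *\<^sub>R real i + t *\<^sub>R real j = real k"
        using t1 by (simp add: algebra_simps)
      have "(1 - t) * s i + t * s j \<le> (1 - t) * C (real i) + t * C (real j)"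
        using t ge[of i] ge[of j] that by (intro add_mono mult_left_mono) auto
      also have "\<dots> \<le> C (real k)"
        using concave_onD[OF conc, of t "real i" "real j"] t that eq by auto
      finally have "(1 - t) * s i + t * s j \<le> s k"
        using Ck by simp
      then have "((1 - t) * s i + t * s j) * (real j - real i) \<le> s k * (real j - real i)"
        using that by (intro mult_right_mono) auto
      also have "((1 - t) * s i + t * s j) * (real j - real i)
          = s i * (real j - real i) + (s j - s i) * (t * (real j - real i))"
        by (simp add: algebra_simps)
      finally show ?thesis
        unfolding t1 by (simp add: algebra_simps)
    qed
    define L where "L = (\<lambda>j. (s j - s k) / (real j - real k)) ` {k<..m}"
    define U where "U = (\<lambda>i. (s k - s i) / (real k - real i)) ` {..<k}"
    have LU: "x \<le> y" if "x \<in> L" "y \<in> U" for x y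
    proof -
      obtain i j where ij: "i < k" "k < j" "j \<le> m" "x = (s j - s k) / (real j - real k)"
          "y = (s k - s i) / (real k - real i)"
        using \<open>x \<in> L\<close> \<open>y \<in> U\<close> by (auto simp: L_def U_def)
      then show ?thesis
        using sep[of i j] by (simp add: pos_divide_le_eq pos_le_divide_eq)
    qed
    have fin: "finite L" "finite U"
      by (auto simp: L_def U_def)
    obtain a where a: "\<forall>x\<in>L. x \<le> a" "\<forall>y\<in>U. a \<le> y"
    proof (cases "L = {}")
      case True
      show ?thesis
      proof (cases "U = {}")
        case True
        then show ?thesis using \<open>L = {}\<close> that[of 0] by auto
      next
        case False
        then show ?thesis using \<open>L = {}\<close> that[of "Min U"] fin by auto
      qed
    next
      case False
      then show ?thesis using that[of "Max L"] fin LU by auto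
    qed
    have "s j \<le> s k + a * (real j - real k)" if "j \<le> m" for j
    proof -
      consider "j = k" | "j < k" | "k < j" by linarith
      then show ?thesis
      proof cases
        case 2
        then have "a \<le> (s k - s j) / (real k - real j)"
          using a(2) by (auto simp: U_def)
        then show ?thesis using 2 by (simp add: field_simps)
      next
        case 3
        then have "(s j - s k) / (real j - real k) \<le> a"
          using a(1) that by (auto simp: L_def)
        then show ?thesis using 3 by (simp add: field_simps)
      qed simp
    qed
    then have "k \<le> m \<and> (\<exists>a. \<forall>j\<le>m. s j \<le> s k + a * (real j - real k))"
      using km by auto
  }
  moreover have "k \<in> contact_times s m"
    if km: "k \<le> m" and a: "\<forall>j\<le>m. s j \<le> s k + a * (real j - real k)" for a
  proof -
    define D where "D x = s k + a * (x - real k)" for x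
    have "concave_on {0..real m} D"
      unfolding concave_on_iff
    proof (intro conjI ballI allI impI)
      fix x y u v :: real assume "u + v = 1"
      then have u: "u = 1 - v" by simp
      show "u * D x + v * D y \<le> D (u *\<^sub>R x + v *\<^sub>R y)"
        unfolding u by (simp add: D_def algebra_simps)
    qed simp
    moreover have "\<forall>j\<le>m. s j \<le> D (real j)"
      using a by (simp add: D_def)
    moreover have "real k \<in> {0..real m}"
      using km by simp
    ultimately have "C (real k) \<le> D (real k)"
      using C unfolding is_concave_majorant_def by blast
    then show ?thesis
      using ge[of k] km by (auto simp: contact_times_def C_def D_def)
  qed
  ultimately show ?thesis by blast
qed

lemma finite_contact_times: "finite (contact_times s m)"
  by (rule finite_subset[of _ "{..m}"]) (auto simp: contact_times_def)

text \<open>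
  A sufficiently steep line through an end point dominates the whole path.
\<close>

lemma endpoints_in_contact_times: "0 \<in> contact_times s m" "m \<in> contact_times s m"
proof -
  define b where "b = (\<Sum>j\<le>m. \<bar>s j - s 0\<bar> + \<bar>s j - s m\<bar>)"
  have b: "\<bar>s j - s 0\<bar> \<le> b" "\<bar>s j - s m\<bar> \<le> b" if "j \<le> m" for j
    using member_le_sum[of j "{..m}" "\<lambda>j. \<bar>s j - s 0\<bar> + \<bar>s j - s m\<bar>"] that
    by (auto simp: b_def)
  have b0: "0 \<le> b" using b[of 0] by simp
  have "s j \<le> s 0 + b * (real j - real 0)" if "j \<le> m" for j
  proof (cases "j = 0")
    case False
    then have "b * 1 \<le> b * real j" using b0 by (intro mult_left_mono) auto
    then show ?thesis using b[OF that] by auto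
  qed simp
  then show "0 \<in> contact_times s m"
    by (auto simp: contact_times_iff_support_line intro!: exI[of _ b])
  have "s j \<le> s m + (- b) * (real j - real m)" if "j \<le> m" for j
  proof (cases "j = m")
    case False
    then have "b * 1 \<le> b * (real m - real j)" using b0 that by (intro mult_left_mono) auto
    then show ?thesis using b[OF that] by (auto simp: algebra_simps)
  qed simp
  then show "m \<in> contact_times s m"
    by (auto simp: contact_times_iff_support_line intro!: exI[of _ "- b"])
qed

text \<open>
  The contact times of a path with face lengths \<open>l 0, l 1, \<dots>\<close> are the partial sums of \<open>l\<close>.
\<close>

definition partial_sum :: "(nat \<Rightarrow> nat) \<Rightarrow> nat \<Rightarrow> nat" where
  "partial_sum l i = (\<Sum>r<i. l r)"

lemma partial_sum_0 [simp]: "partial_sum l 0 = 0"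
  and partial_sum_Suc [simp]: "partial_sum l (Suc i) = partial_sum l i + l i"
  by (auto simp: partial_sum_def)

lemma partial_sum_mono: "i \<le> j \<Longrightarrow> partial_sum l i \<le> partial_sum l j"
  by (auto simp: partial_sum_def intro: sum_mono2)

lemma partial_sum_strict_mono:
  assumes "\<And>i. i < f \<Longrightarrow> 0 < l i"
  shows "strict_mono_on {..f} (partial_sum l)"
proof (rule strict_mono_onI)
  fix i j assume "i \<in> {..f}" "j \<in> {..f}" "i < j"
  then have "partial_sum l i < partial_sum l (Suc i)" "partial_sum l (Suc i) \<le> partial_sum l j"
    using assms[of i] by (auto intro!: partial_sum_mono simp del: partial_sum_Suc) simp
  then show "partial_sum l i < partial_sum l j" by simp
qed

lemma between_partial_sums:
  "k < partial_sum l f \<Longrightarrow> \<exists>i<f. partial_sum l i \<le> k \<and> k < partial_sum l (Suc i)"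
proof (induction f)
  case (Suc f)
  then show ?case
    by (cases "k < partial_sum l f") (use less_Suc_eq in \<open>auto simp: not_less\<close>)
qed simp

lemma
  assumes l: "\<And>i. i < f \<Longrightarrow> 0 < l i"
    and c: "contact_times s m = partial_sum l ` {..f}"
  shows num_faces_eq: "num_faces s m = f"
    and face_length_eq: "i < f \<Longrightarrow> face_length s m (Suc i) = l i"
    and face_time_eq: "i \<le> f \<Longrightarrow> face_time s m i = partial_sum l i"
proof -
  have sm: "strict_mono_on {..f} (partial_sum l)"
    using l by (rule partial_sum_strict_mono)
  then have inj: "inj_on (partial_sum l) {..f}"
    by (rule strict_mono_on_imp_inj_on)
  have "partial_sum l i = 0 \<longleftrightarrow> i = 0" if "i \<le> f" for i
    using inj_onD[OF inj, of i 0] that by auto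
  then have c0: "contact_times s m - {0} = partial_sum l ` {1..f}"
    by (force simp: c)
  then show "num_faces s m = f"
    unfolding num_faces_def using inj_on_subset[OF inj, of "{1..f}"] by (simp add: card_image)
  have "sorted_list_of_set (contact_times s m - {0}) = map (partial_sum l) [1..<Suc f]"
  proof (rule sorted_distinct_set_unique)
    have "sorted_wrt (<) (map (partial_sum l) [1..<Suc f])"
      unfolding sorted_wrt_map
      by (rule sorted_wrt_mono_rel[OF _ sorted_wrt_upt]) (auto intro: strict_mono_onD[OF sm])
    then show "sorted (map (partial_sum l) [1..<Suc f])" "distinct (map (partial_sum l) [1..<Suc f])"
      by (simp_all add: strict_sorted_iff)
  qed (use finite_contact_times in \<open>auto simp: c0\<close>)
  then have ts: "0 # sorted_list_of_set (contact_times s m - {0}) = map (partial_sum l) [0..<Suc f]"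
    by (simp add: upt_conv_Cons del: upt_Suc)
  show fl: "face_length s m (Suc i) = l i" if "i < f" for i
    unfolding face_length_def Let_def ts using that by (simp del: upt_Suc)
  show "face_time s m i = partial_sum l i" if "i \<le> f"
    using that
  proof (induction i)
    case (Suc i)
    then show ?case using fl[of i] by (auto simp: face_time_def)
  qed (simp add: face_time_def)
qed

lemma
  fixes s :: "nat \<Rightarrow> real" and m :: nat
  defines "l \<equiv> \<lambda>i. face_length s m (Suc i)" and "f \<equiv> num_faces s m"
  shows contact_times_eq_partial_sums: "contact_times s m = partial_sum l ` {..f}"
    and face_length_pos: "i < f \<Longrightarrow> 0 < face_length s m (Suc i)"
    and partial_sum_face_length: "partial_sum l f = m"
proof -
  define A where "A = contact_times s m - {0}"
  have fA: "finite A" using finite_contact_times by (auto simp: A_def)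
  define xs where "xs = sorted_list_of_set A"
  define ts where "ts = 0 # xs"
  have len: "length ts = Suc f"
    using fA by (simp add: ts_def xs_def f_def num_faces_def A_def)
  have sts: "sorted_wrt (<) ts"
    using strict_sorted_list_of_set[of A] fA by (auto simp: ts_def xs_def A_def intro: neq0_conv[THEN iffD1])
  have set: "set ts = contact_times s m"
    using fA endpoints_in_contact_times(1)[of s m] by (auto simp: ts_def xs_def A_def)
  have li: "l i = ts ! Suc i - ts ! i" for i
    by (simp add: l_def face_length_def Let_def ts_def xs_def A_def)
  have lt: "ts ! i < ts ! j" if "i < j" "j \<le> f" for i j
    using sorted_wrt_nth_less[OF sts, of i j] that len by simp
  have ps: "partial_sum l i = ts ! i" if "i \<le> f" for i
    using that
  proof (induction i)
    case (Suc i)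
    then show ?case using lt[of i "Suc i"] by (auto simp: li)
  qed (simp add: ts_def)
  have "set ts = (\<lambda>i. ts ! i) ` {..f}"
    using len by (auto simp: set_conv_nth image_iff less_Suc_eq_le) 
  then show c: "contact_times s m = partial_sum l ` {..f}"
    using ps set by auto
  show "0 < face_length s m (Suc i)" if "i < f" for i
    using lt[of i "Suc i"] that li[of i] by (simp add: l_def)
  have "m \<in> partial_sum l ` {..f}"
    using endpoints_in_contact_times(2)[of m s] c by simp
  moreover have "partial_sum l f \<in> contact_times s m"
    using c by auto
  then have "partial_sum l f \<le> m" by (auto simp: contact_times_def)
  ultimately show "partial_sum l f = m"
    using partial_sum_mono[of _ f l] by force
qed

definition segment :: "(nat \<Rightarrow> real) \<Rightarrow> nat \<Rightarrow> nat \<Rightarrow> real list" where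
  "segment s t j = map (\<lambda>k. s (t + k) - s t) [1..<Suc j]"

definition slope :: "real list \<Rightarrow> real" where
  "slope xs = last xs / real (length xs)"

text \<open>
  The value of a segment at time \<open>k\<close> is the entry with index \<open>k - 1\<close>.
\<close>

definition strictly_below_chord :: "real list \<Rightarrow> bool" where
  "strictly_below_chord xs \<longleftrightarrow>
     (\<forall>k. 1 \<le> k \<and> k < length xs \<longrightarrow> xs ! (k - 1) < real k * slope xs)"

lemma length_segment [simp]: "length (segment s t j) = j"
  by (simp add: segment_def)

lemma nth_segment: "1 \<le> k \<Longrightarrow> k \<le> j \<Longrightarrow> segment s t j ! (k - 1) = s (t + k) - s t"
  by (simp add: segment_def del: upt_Suc)

lemma last_segment: "0 < j \<Longrightarrow> last (segment s t j) = s (t + j) - s t"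
  by (cases j) (auto simp: segment_def)

lemma slope_segment: "0 < j \<Longrightarrow> slope (segment s t j) * real j = s (t + j) - s t"
  by (simp add: slope_def last_segment)

lemma strictly_below_chord_segment:
  "strictly_below_chord (segment s t j) \<longleftrightarrow>
     (\<forall>k. 1 \<le> k \<and> k < j \<longrightarrow> s (t + k) < s t + real k * slope (segment s t j))"
proof -
  have "segment s t j ! (k - 1) < c \<longleftrightarrow> s (t + k) < s t + c" if "1 \<le> k" "k < j" for k c
    using that nth_segment[of k j s t] by auto
  then show ?thesis
    unfolding strictly_below_chord_def length_segment by blast
qed

lemma face_segment_eq:
  assumes l: "\<And>i. i < f \<Longrightarrow> 0 < l i"
    and c: "contact_times s m = partial_sum l ` {..f}" and "i < f"
  shows "face_segment s m i = segment s (partial_sum l i) (l i)"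
  using face_length_eq[OF l c, of i] face_time_eq[OF l c, of i] assms(3)
  by (simp add: face_segment_def segment_def)

text \<open>
  The slopes decrease because a supporting line at a common end point separates the two adjacent
  chords. If a segment reached its chord, the line parallel to the chord through the highest
  point of the segment above it would support the whole path, which would make this point a
  contact between two consecutive ones.
\<close>

lemma contact_times_imp_concave:
  assumes l: "\<And>i. i < f \<Longrightarrow> 0 < l i" and m: "m = partial_sum l f"
    and c: "contact_times s m = partial_sum l ` {..f}"
  defines "e \<equiv> \<lambda>i. segment s (partial_sum l i) (l i)"
  shows "i < f \<Longrightarrow> strictly_below_chord (e i)"
    and "i < f \<Longrightarrow> j < f \<Longrightarrow> i \<le> j \<Longrightarrow> slope (e j) \<le> slope (e i)"
proof -
  let ?t = "partial_sum l"
  have sl: "s (?t (Suc i)) = s (?t i) + slope (e i) * (real (?t (Suc i)) - real (?t i))" if "i < f" for i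
    using slope_segment[OF l[OF that], of s "?t i"] by (simp add: e_def)
  have tm: "?t i \<le> m" if "i \<le> f" for i
    unfolding m using that by (rule partial_sum_mono)
  have line: "\<exists>a. \<forall>j\<le>m. s j \<le> s (?t i) + a * (real j - real (?t i))" if "i \<le> f" for i
  proof -
    have "?t i \<in> contact_times s m" using c that by auto
    then show ?thesis by (simp add: contact_times_iff_support_line)
  qed
  \<comment> \<open>A supporting line at a contact time lies between the two adjacent chords.\<close>
  have slope_le: "a \<le> slope (e i)"
    if "i < f" and a: "\<forall>j\<le>m. s j \<le> s (?t (Suc i)) + a * (real j - real (?t (Suc i)))" for a i
  proof -
    have "s (?t i) \<le> s (?t (Suc i)) + a * (real (?t i) - real (?t (Suc i)))"
      using a tm[of i] that by auto
    then have "a * real (l i) \<le> slope (e i) * real (l i)"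
      using sl[OF that(1)] by (simp add: algebra_simps)
    then show ?thesis using l[OF that(1)] by simp
  qed
  have slope_ge: "slope (e i) \<le> a"
    if "i < f" and a: "\<forall>j\<le>m. s j \<le> s (?t i) + a * (real j - real (?t i))" for a i
  proof -
    have "s (?t (Suc i)) \<le> s (?t i) + a * (real (?t (Suc i)) - real (?t i))"
      using a tm[of "Suc i"] that by (auto simp del: partial_sum_Suc)
    then have "slope (e i) * real (l i) \<le> a * real (l i)"
      using sl[OF that(1)] by (simp add: algebra_simps)
    then show ?thesis using l[OF that(1)] by simp
  qed
  show "slope (e j) \<le> slope (e i)" if "i < f" "j < f" "i \<le> j" for i j
    using that(3,2)
  proof (induction j rule: dec_induct)
    case (step n)
    then obtain a where "\<forall>j\<le>m. s j \<le> s (?t (Suc n)) + a * (real j - real (?t (Suc n)))"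
      using line[of "Suc n"] by auto
    then have "slope (e (Suc n)) \<le> slope (e n)"
      using slope_le[of n a] slope_ge[of "Suc n" a] step by fastforce
    then show ?case using step by auto
  qed simp
  show "strictly_below_chord (e i)" if i: "i < f"
  proof (rule ccontr)
    \<comment> \<open>The height above the chord; its maximum over the segment would be a further contact.\<close>
    define h where "h j = s j - s (?t i) - slope (e i) * (real j - real (?t i))" for j
    let ?G = "{?t i<..<?t (Suc i)}"
    assume "\<not> ?thesis"
    then obtain k where "1 \<le> k" "k < l i" "\<not> s (?t i + k) < s (?t i) + real k * slope (e i)"
      by (auto simp: e_def strictly_below_chord_segment)
    then have k: "?t i + k \<in> ?G" "0 \<le> h (?t i + k)" by (auto simp: h_def algebra_simps)
    define H where "H = Max (h ` ?G)"
    have "h ` ?G \<noteq> {}" using k(1) by blast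
    then have "H \<in> h ` ?G" unfolding H_def by (intro Max_in) simp_all
    then obtain k' where k': "k' \<in> ?G" "h k' = H" by auto
    have Hmax: "h j \<le> H" if "j \<in> ?G" for j
      unfolding H_def using that by (intro Max_ge imageI) simp_all
    have H0: "0 \<le> H" using Hmax[OF k(1)] k(2) by linarith
    obtain a where a: "\<forall>j\<le>m. s j \<le> s (?t i) + a * (real j - real (?t i))"
      using line[of i] i by auto
    obtain b where b: "\<forall>j\<le>m. s j \<le> s (?t (Suc i)) + b * (real j - real (?t (Suc i)))"
      using line[of "Suc i"] i by (auto simp del: partial_sum_Suc)
    have "h j \<le> H" if jm: "j \<le> m" for j
    proof -
      consider "j \<le> ?t i" | "j \<in> ?G" | "?t (Suc i) \<le> j"
        by (metis greaterThanLessThan_iff not_le)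
      then show ?thesis
      proof cases
        case 1
        have "a * (real j - real (?t i)) \<le> slope (e i) * (real j - real (?t i))"
          using slope_ge[OF i a] 1 by (intro mult_right_mono_neg) auto
        then have "h j \<le> 0" using a jm by (fastforce simp: h_def)
        then show ?thesis using H0 by simp
      next
        case 3
        have "b * (real j - real (?t (Suc i))) \<le> slope (e i) * (real j - real (?t (Suc i)))"
          using slope_le[OF i b] 3 by (intro mult_right_mono) auto
        moreover have "s j \<le> s (?t (Suc i)) + b * (real j - real (?t (Suc i)))"
          using b jm by blast
        ultimately have "h j \<le> 0" using sl[OF i] by (simp add: h_def algebra_simps)
        then show ?thesis using H0 by simp
      qed (rule Hmax)
    qed
    then have "s j \<le> s k' + slope (e i) * (real j - real k')" if "j \<le> m" for j
      using k'(2) that by (fastforce simp: h_def algebra_simps)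
    moreover have "k' \<le> m" using k' tm[of "Suc i"] i by auto
    ultimately have "k' \<in> contact_times s m"
      by (auto simp: contact_times_iff_support_line)
    then have "k' \<in> ?t ` {..f}"
      using c by simp
    then obtain r where r: "r \<le> f" "k' = ?t r" by auto
    then have "i < r" "r < Suc i"
      using k'(1) partial_sum_mono[of r i l] partial_sum_mono[of "Suc i" r l] 
      by (auto simp: not_less[symmetric] simp del: partial_sum_Suc)
    then show False by simp
  qed
qed

text \<open>
  With decreasing slopes, each chord extends to a line above all vertices and hence above the
  whole path, so that it supports the path at its two end points. A supporting line through an
  inner point of a segment would push this point up to the chord.
\<close>

lemma concave_imp_contact_times:
  fixes s :: "nat \<Rightarrow> real"
  assumes l: "\<And>i. i < f \<Longrightarrow> 0 < l i" and m: "m = partial_sum l f"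
  defines "e \<equiv> \<lambda>i. segment s (partial_sum l i) (l i)"
  assumes below: "\<And>i. i < f \<Longrightarrow> strictly_below_chord (e i)"
    and dec: "\<And>i j. j < f \<Longrightarrow> i \<le> j \<Longrightarrow> slope (e j) \<le> slope (e i)"
  shows "contact_times s m = partial_sum l ` {..f}"
proof (cases "f = 0")
  case True
  then show ?thesis
    using endpoints_in_contact_times(1)[of s m] m by (auto simp: contact_times_def)
next
  case False
  let ?t = "partial_sum l"
  have sl: "s (?t (Suc i)) = s (?t i) + slope (e i) * (real (?t (Suc i)) - real (?t i))" if "i < f" for i
    using slope_segment[OF l[OF that], of s "?t i"] by (simp add: e_def)
  have inside: "s j < s (?t r) + slope (e r) * (real j - real (?t r))"
    if r: "r < f" "?t r < j" "j < ?t (Suc r)" for r j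
  proof -
    have "j = ?t r + (j - ?t r)" "1 \<le> j - ?t r" "j - ?t r < l r" 
      using r by auto
    then show ?thesis
      using below[OF r(1)] r(2) unfolding e_def strictly_below_chord_segment
      by (metis add_diff_cancel_left' mult.commute of_nat_add)
  qed
  have vertex: "s (?t j) \<le> s (?t i) + slope (e i) * (real (?t j) - real (?t i))"
    if "i < f" "j \<le> f" for i j
  proof (cases "i \<le> j")
    case True
    then show ?thesis using that(2)
    proof (induction j rule: dec_induct)
      case (step n)
      have "s (?t (Suc n)) \<le> s (?t n) + slope (e i) * (real (?t (Suc n)) - real (?t n))"
        using dec[of n i] step sl[of n] by (auto intro!: mult_right_mono)
      then show ?case using step by (simp add: algebra_simps)
    qed simp
  next
    case False
    then have "j \<le> i" by simp
    then show ?thesis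
    proof (induction j rule: inc_induct)
      case (step n)
      have "slope (e i) * (real (?t (Suc n)) - real (?t n)) \<le> slope (e n) * (real (?t (Suc n)) - real (?t n))"
        using dec[of i n] step that by (auto intro!: mult_right_mono)
      then have "s (?t n) \<le> s (?t (Suc n)) + slope (e i) * (real (?t n) - real (?t (Suc n)))"
        using sl[of n] step that by (simp add: algebra_simps)
      then show ?case using step by (simp add: algebra_simps)
    qed simp
  qed
  have line: "s j \<le> s (?t i) + slope (e i) * (real j - real (?t i))" if i: "i < f" and jm: "j \<le> m" for i j
  proof (cases "j = m")
    case True
    then show ?thesis using vertex[of i f] m i by simp
  next
    case False
    then obtain r where r: "r < f" "?t r \<le> j" "j < ?t (Suc r)"
      using between_partial_sums[of j l f] jm m by (metis le_neq_implies_less)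
    let ?x = "real j - real (?t r)" and ?L = "real (l r)"
    have "s j \<le> s (?t r) + slope (e r) * ?x"
    proof (cases "j = ?t r")
      case False
      then show ?thesis using inside[of r j] r by simp
    qed simp
    then have 1: "s j * ?L \<le> (s (?t r) + slope (e r) * ?x) * ?L"
      by (intro mult_right_mono) auto
    have v: "s (?t r) \<le> s (?t i) + slope (e i) * (real (?t r) - real (?t i))"
      "s (?t (Suc r)) \<le> s (?t i) + slope (e i) * (real (?t (Suc r)) - real (?t i))"
      using vertex[of i r] vertex[of i "Suc r"] r i by auto
    have x: "0 \<le> ?x" "0 \<le> ?L - ?x" using r by auto
    have "(s (?t r) + slope (e r) * ?x) * ?L = s (?t r) * (?L - ?x) + s (?t (Suc r)) * ?x"
      using sl[OF r(1)] by (simp add: algebra_simps)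
    also have "\<dots> \<le> (s (?t i) + slope (e i) * (real (?t r) - real (?t i))) * (?L - ?x)
        + (s (?t i) + slope (e i) * (real (?t (Suc r)) - real (?t i))) * ?x"
      using v x by (intro add_mono mult_right_mono)
    also have "\<dots> = (s (?t i) + slope (e i) * (real j - real (?t i))) * ?L"
      by (simp add: algebra_simps)
    finally have "s j * ?L \<le> (s (?t i) + slope (e i) * (real j - real (?t i))) * ?L"
      using 1 by linarith
    then show ?thesis using l[OF r(1)] by simp
  qed
  show ?thesis
  proof (intro equalityI subsetI)
    fix k assume "k \<in> ?t ` {..f}"
    then obtain r where r: "r \<le> f" "k = ?t r" by auto
    have km: "k \<le> m" using r m partial_sum_mono[of r f l] by simp
    show "k \<in> contact_times s m"
    proof (cases "r < f")
      case True
      then show ?thesis using line[of r] r km by (auto simp: contact_times_iff_support_line)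
    next
      case False
      then have "k = m" using r m by simp
      then show ?thesis using endpoints_in_contact_times by simp
    qed
  next
    fix k assume k: "k \<in> contact_times s m"
    then obtain a where km: "k \<le> m" and a: "\<And>j. j \<le> m \<Longrightarrow> s j \<le> s k + a * (real j - real k)"
      by (auto simp: contact_times_iff_support_line)
    show "k \<in> ?t ` {..f}"
    proof (rule ccontr)
      assume n: "k \<notin> ?t ` {..f}"
      then have "k < m" using km m by (cases "k = m") auto
      then obtain r where r: "r < f" "?t r \<le> k" "k < ?t (Suc r)"
        using between_partial_sums[of k l f] m by blast
      have "k \<noteq> ?t r" using n r by auto
      then have b: "s k < s (?t r) + slope (e r) * (real k - real (?t r))"
        using inside[of r k] r by simp
      have tm: "?t r \<le> m" "?t (Suc r) \<le> m"
        unfolding m using r by (auto intro!: partial_sum_mono simp del: partial_sum_Suc)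
      let ?x = "real k - real (?t r)" and ?y = "real (?t (Suc r)) - real k"
      have xy: "0 < ?x" "0 < ?y" using r \<open>k \<noteq> ?t r\<close> by auto
      have 1: "s (?t r) \<le> s k - a * ?x" using a[OF tm(1)] by (simp add: algebra_simps)
      have 2: "s (?t r) + slope (e r) * (?x + ?y) \<le> s k + a * ?y"
        using a[OF tm(2)] sl[OF r(1)] by (simp add: algebra_simps)
      from 1 b have "a * ?x < slope (e r) * ?x" by simp
      moreover from 2 b have "slope (e r) * ?y < a * ?y" by (simp add: algebra_simps)
      ultimately show False using xy by simp
    qed
  qed
qed

section \<open>Cyclic rotations of a path\<close>

definition walk_of :: "(nat \<Rightarrow> real) \<Rightarrow> nat \<Rightarrow> real" where
  "walk_of x k = (\<Sum>i=1..k. x i)"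

lemma walk_of_0 [simp]: "walk_of x 0 = 0"
  and walk_of_Suc [simp]: "walk_of x (Suc k) = walk_of x k + x (Suc k)"
  by (auto simp: walk_of_def)

lemma walk_eq_walk_of: "walk X \<omega> = walk_of (\<lambda>i. X i \<omega>)"
  by (auto simp: walk_def walk_of_def)

lemma walk_of_cong: "(\<And>i. 1 \<le> i \<Longrightarrow> i \<le> k \<Longrightarrow> x i = y i) \<Longrightarrow> walk_of x k = walk_of y k"
  unfolding walk_of_def by (intro sum.cong) auto

lemma walk_of_add: "walk_of x (t + k) - walk_of x t = walk_of (\<lambda>i. x (t + i)) k"
  by (induction k) auto

lemma segment_walk_of_shift: "segment (walk_of x) t j = segment (walk_of (\<lambda>i. x (t + i))) 0 j"
  by (simp add: segment_def walk_of_add)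

text \<open>
  Steps are numbered from 1. The indices beyond \<open>j\<close> are kept, so that the rotation of the first \<open>j\<close>
  steps is a reindexing of the whole sequence.
\<close>

definition rotate_index :: "nat \<Rightarrow> nat \<Rightarrow> nat \<Rightarrow> nat" where
  "rotate_index j r i = (if i \<le> j then Suc ((i - 1 + r) mod j) else i)"

lemma rotate_index_pos: "1 \<le> i \<Longrightarrow> 1 \<le> rotate_index j r i"
  by (auto simp: rotate_index_def)

lemma inj_on_rotate_index: 
  assumes "1 \<le> j"
  shows "inj_on (rotate_index j r) {1..}"
proof (rule inj_onI)
  fix a b assume ab: "a \<in> {1..}" "b \<in> {1..}" "rotate_index j r a = rotate_index j r b"
  have le: "rotate_index j r i \<le> j \<longleftrightarrow> i \<le> j" if "i \<in> {1..}" for i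
    using assms that by (auto simp: rotate_index_def Suc_le_eq)
  show "a = b"
  proof (cases "a \<le> j")
    case True
    then have "b \<le> j" using le ab by metis
    then have "(a - 1 + r) mod j = (b - 1 + r) mod j"
      using True ab by (simp add: rotate_index_def)
    then have "j dvd (a - b)" "j dvd (b - a)"
      using mod_eq_dvd_iff_nat[of "b - 1 + r" "a - 1 + r" j] mod_eq_dvd_iff_nat[of "a - 1 + r" "b - 1 + r" j]
        ab by (cases "a \<le> b"; simp)+
    moreover have "a - b < j" "b - a < j"
      using True \<open>b \<le> j\<close> ab by auto
    ultimately show ?thesis
      by (metis diff_is_0_eq dvd_imp_le le_antisym neq0_conv not_le)
  next
    case False
    then show ?thesis using le ab by (metis rotate_index_def)
  qed
qed

definition excess :: "(nat \<Rightarrow> real) \<Rightarrow> nat \<Rightarrow> nat \<Rightarrow> real" where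
  "excess x j k = walk_of x k - real k / real j * walk_of x j"

text \<open>
  Rotating the steps by \<open>r\<close> moves the origin of the excess over the chord, which is periodic with
  period \<open>j\<close>, to the time \<open>r\<close>.
\<close>

lemma excess_rotate:
  assumes "1 \<le> j" "r < j" "k \<le> j"
  shows "walk_of (\<lambda>i. x (rotate_index j r i)) k = excess x j ((r + k) mod j) - excess x j r + real k / real j * walk_of x j"
  using assms(3)
proof (induction k)
  case 0
  then show ?case using assms by simp
next
  case (Suc k)
  let ?m = "(r + k) mod j"
  have rot: "rotate_index j r (Suc k) = Suc ?m"
    using Suc.prems by (simp add: rotate_index_def add.commute)
  have step: "excess x j (Suc ?m) = excess x j ?m + x (Suc ?m) - walk_of x j / real j"
    by (simp add: excess_def add_divide_distrib algebra_simps)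
  have "excess x j ((r + Suc k) mod j) = excess x j (Suc ?m)"
  proof (cases "Suc ?m = j")
    case True
    then have "(r + Suc k) mod j = 0" by (simp add: mod_Suc)
    then show ?thesis unfolding True using assms(1) by (simp add: excess_def)
  qed (simp add: mod_Suc)
  then show ?case
    using Suc rot step by (simp add: add_divide_distrib algebra_simps)
qed

lemma walk_of_rotate:
  assumes "1 \<le> j" "r < j"
  shows "walk_of (\<lambda>i. x (rotate_index j r i)) j = walk_of x j"
  using excess_rotate[OF assms order_refl, of x] assms by simp

lemma strictly_below_chord_walk_of:
  assumes "1 \<le> j"
  shows "strictly_below_chord (segment (walk_of x) 0 j) \<longleftrightarrow> (\<forall>k. 1 \<le> k \<and> k < j \<longrightarrow> walk_of x k < real k / real j * walk_of x j)"
proof -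
  have "slope (segment (walk_of x) 0 j) = walk_of x j / real j"
    using assms slope_segment[of j "walk_of x" 0] by (simp add: field_simps)
  then show ?thesis by (simp add: strictly_below_chord_segment)
qed

text \<open>
  The rotated path is below its chord precisely if \<open>r\<close> is the only time at which the excess
  attains its maximum; hence at most one rotation has this property.
\<close>

lemma strictly_below_chord_rotate:
  assumes "1 \<le> j" "r < j"
  shows "strictly_below_chord (segment (walk_of (\<lambda>i. x (rotate_index j r i))) 0 j) \<longleftrightarrow>
    (\<forall>m<j. m \<noteq> r \<longrightarrow> excess x j m < excess x j r)"
proof -
  have "strictly_below_chord (segment (walk_of (\<lambda>i. x (rotate_index j r i))) 0 j) \<longleftrightarrow>
      (\<forall>k. 1 \<le> k \<and> k < j \<longrightarrow> excess x j ((r + k) mod j) < excess x j r)"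
    unfolding strictly_below_chord_walk_of[OF assms(1)] walk_of_rotate[OF assms]
    using excess_rotate[OF assms, of _ x] by auto
  also have "\<dots> \<longleftrightarrow> (\<forall>m<j. m \<noteq> r \<longrightarrow> excess x j m < excess x j r)"
  proof (intro iffI allI impI)
    fix m assume *: "\<forall>k. 1 \<le> k \<and> k < j \<longrightarrow> excess x j ((r + k) mod j) < excess x j r"
      and m: "m < j" "m \<noteq> r"
    \<comment> \<open>the number of cyclic steps from \<open>r\<close> to \<open>m\<close>\<close>
    define k where "k = (if r < m then m - r else j - (r - m))"
    have "1 \<le> k" "k < j" using m assms by (auto simp: k_def)
    moreover have "(r + k) mod j = m"
      using m assms by (auto simp: k_def)
    ultimately show "excess x j m < excess x j r" using * by metis
  next
    fix k assume *: "\<forall>m<j. m \<noteq> r \<longrightarrow> excess x j m < excess x j r" and k: "1 \<le> k \<and> k < j"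
    have "(r + k) mod j \<noteq> r"
    proof (cases "r + k < j")
      case False
      then have "(r + k) mod j = r + k - j" using k assms by (subst mod_if) (auto simp: mod_if)
      then show ?thesis using k False by auto
    qed (use k in auto)
    then show "excess x j ((r + k) mod j) < excess x j r" using * assms by auto
  qed
  finally show ?thesis .
qed

section \<open>The space of path segments\<close>

lemma space_segment_space: "space segment_space = {xs. xs \<noteq> []}"
  unfolding segment_space_def by (rule space_measure_of) auto

lemma segment_cylinder_in_sets:
  assumes "1 \<le> j" "\<And>i. i < j \<Longrightarrow> B i \<in> sets borel"
  shows "{xs. length xs = j \<and> (\<forall>i<j. xs ! i \<in> B i)} \<in> sets segment_space"
proof -
  let ?G = "{{xs. length xs = j \<and> (\<forall>i<j. xs ! i \<in> B i)} | j B. 1 \<le> j \<and> (\<forall>i<j. B i \<in> sets (borel :: real measure))}"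
  have "{xs. length xs = j \<and> (\<forall>i<j. xs ! i \<in> B i)} \<in> ?G"
    using assms by blast
  moreover have "?G \<subseteq> Pow {xs. xs \<noteq> []}" by auto
  ultimately show ?thesis unfolding segment_space_def by (simp add: sigma_sets.Basic)
qed

lemma measurable_segment_spaceI:
  assumes j: "1 \<le> j" and len: "\<And>\<omega>. \<omega> \<in> space M \<Longrightarrow> length (f \<omega>) = j"
    and nth: "\<And>i. i < j \<Longrightarrow> (\<lambda>\<omega>. f \<omega> ! i) \<in> borel_measurable M"
  shows "f \<in> measurable M segment_space"
  unfolding segment_space_def
proof (rule measurable_measure_of)
  show "f \<in> space M \<rightarrow> {xs. xs \<noteq> []}" using len j by fastforce
  fix A assume "A \<in> {{xs. length xs = j \<and> (\<forall>i<j. xs ! i \<in> B i)} | j B. 1 \<le> j \<and> (\<forall>i<j. B i \<in> sets (borel :: real measure))}"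
  then obtain j' B where A: "A = {xs. length xs = j' \<and> (\<forall>i<j'. xs ! i \<in> B i)}"
    and B: "\<And>i. i < j' \<Longrightarrow> B i \<in> sets borel" by auto
  show "f -` A \<inter> space M \<in> sets M"
  proof (cases "j = j'")
    case True
    have "{\<omega> \<in> space M. \<forall>i\<in>{..<j}. f \<omega> ! i \<in> B i} \<in> sets M"
      using nth B True by (intro sets.sets_Collect_finite_All) (auto intro: measurable_sets_Collect)
    also have "{\<omega> \<in> space M. \<forall>i\<in>{..<j}. f \<omega> ! i \<in> B i} = f -` A \<inter> space M"
      using len True by (auto simp: A)
    finally show ?thesis .
  next
    case False
    then have "f -` A \<inter> space M = {}" using len by (auto simp: A)
    then show ?thesis by simp
  qed
qed auto

lemma measurable_length_segment_space [measurable]: "length \<in> measurable segment_space (count_space UNIV)"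
proof (rule measurable_count_space_eq2_countable[THEN iffD2, rotated], intro conjI ballI)
  fix j :: nat
  show "length -` {j} \<inter> space segment_space \<in> sets segment_space"
  proof (cases "j = 0")
    case False
    then have "length -` {j} \<inter> space segment_space = {xs. length xs = j \<and> (\<forall>i<j. xs ! i \<in> UNIV)}"
      by (auto simp: space_segment_space)
    also have "\<dots> \<in> sets segment_space"
      using False by (intro segment_cylinder_in_sets) auto
    finally show ?thesis .
  next
    case True
    then have "length -` {j} \<inter> space segment_space = {}" by (auto simp: space_segment_space)
    then show ?thesis by simp
  qed
qed auto

lemma measurable_nth_of_length:
  assumes "i < j"
  shows "(\<lambda>xs. if length xs = j then xs ! i else 0) \<in> borel_measurable segment_space"
proof (rule measurableI)
  fix A :: "real set" assume A: "A \<in> sets borel"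
  let ?C = "{xs. length xs = j \<and> (\<forall>k<j. xs ! k \<in> (if k = i then A else UNIV))}"
  have "?C \<in> sets segment_space"
    using assms A by (intro segment_cylinder_in_sets) auto
  moreover have "{xs \<in> space segment_space. length xs \<noteq> j} \<in> sets segment_space"
    by measurable
  moreover have "(\<lambda>xs. if length xs = j then xs ! i else 0) -` A \<inter> space segment_space
      = ?C \<union> (if 0 \<in> A then {xs \<in> space segment_space. length xs \<noteq> j} else {})"
    using assms by (auto simp: space_segment_space split: if_splits)
  ultimately show "(\<lambda>xs. if length xs = j then xs ! i else 0) -` A \<inter> space segment_space \<in> sets segment_space"
    by auto
qed simp

lemma measurable_last [measurable]: "last \<in> borel_measurable segment_space"
proof -
  define h :: "nat \<Rightarrow> real list \<Rightarrow> real"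
    where "h j xs = (if 0 < j then if length xs = j then xs ! (j - 1) else 0 else 0)" for j xs
  have "h j \<in> borel_measurable segment_space" for j
    using measurable_nth_of_length[of "j - 1" j] unfolding h_def by (cases "0 < j") auto
  then have "(\<lambda>xs. h (length xs) xs) \<in> borel_measurable segment_space"
    by (rule measurable_compose_countable[OF _ measurable_length_segment_space])
  then show ?thesis
    by (rule measurable_cong[THEN iffD1, rotated]) (auto simp: h_def last_conv_nth space_segment_space)
qed

lemma measurable_slope [measurable]: "slope \<in> borel_measurable segment_space"
  unfolding slope_def by measurable

lemma measurable_strictly_below_chord [measurable]: "Measurable.pred segment_space strictly_below_chord"
proof -
  define h :: "nat \<Rightarrow> real list \<Rightarrow> bool"
    where "h j xs \<longleftrightarrow> (\<forall>k\<in>{1..<j}. (if length xs = j then xs ! (k - 1) else 0) < real k * slope xs)" for j xs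
  have "Measurable.pred segment_space (h j)" for j
    unfolding h_def
  proof (intro pred_intros_finite)
    fix k assume "k \<in> {1..<j}"
    then have [measurable]: "(\<lambda>xs. if length xs = j then xs ! (k - 1) else 0) \<in> borel_measurable segment_space"
      by (intro measurable_nth_of_length) auto
    show "Measurable.pred segment_space (\<lambda>xs. (if length xs = j then xs ! (k - 1) else 0) < real k * slope xs)"
      by (rule borel_measurable_pred_less) measurable
  qed simp
  then have "Measurable.pred segment_space (\<lambda>xs. h (length xs) xs)"
    by (rule measurable_compose_countable[OF _ measurable_length_segment_space])
  then show ?thesis
    by (rule measurable_cong[THEN iffD1, rotated]) (auto simp: h_def strictly_below_chord_def)
qed

definition face_of_segment :: "real list \<Rightarrow> nat \<times> real" where
  "face_of_segment xs = (length xs, last xs)"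

lemma measurable_face_of_segment [measurable]: "face_of_segment \<in> measurable segment_space face_space"
proof -
  have "length -` {j} \<inter> space segment_space \<in> sets segment_space" for j
    using measurable_length_segment_space by (rule measurable_sets) simp
  then have [measurable]: "length \<in> measurable segment_space (count_space {1..})"
    by (subst measurable_count_space_eq2_countable) (auto simp: space_segment_space Suc_le_eq)
  show ?thesis
    unfolding face_of_segment_def face_space_def by measurable
qed

lemma face_of_segment_segment: "0 < j \<Longrightarrow> face_of_segment (segment s t j) = (j, s (t + j) - s t)"
  by (simp add: face_of_segment_def last_segment)

lemma segment_in_space: "0 < j \<Longrightarrow> segment s t j \<in> space segment_space"
  by (auto simp: space_segment_space simp flip: length_greater_0_conv)

section \<open>Tuples in decreasing order\<close>

definition decreasing_tuples :: "('b \<Rightarrow> real) \<Rightarrow> nat \<Rightarrow> (nat \<Rightarrow> 'b) set" where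
  "decreasing_tuples g f = {x. \<forall>i j. i \<le> j \<and> j < f \<longrightarrow> g (x j) \<le> g (x i)}"

lemma ex1_decreasing_permutation:
  fixes v :: "nat \<Rightarrow> real"
  assumes inj: "inj_on v {..<f}"
  shows "\<exists>!\<pi>. \<pi> permutes {..<f} \<and> (\<forall>i j. i \<le> j \<and> j < f \<longrightarrow> v (\<pi> j) \<le> v (\<pi> i))"
proof (rule ex_ex1I)
  define xs where "xs = sort_key (\<lambda>i. - v i) [0..<f]"
  have "mset xs = mset [0..<f]" by (simp add: xs_def)
  then obtain \<pi> where \<pi>: "\<pi> permutes {..<length [0..<f]}" "permute_list \<pi> [0..<f] = xs"
    by (rule mset_eq_permutation)
  have nth: "xs ! i = \<pi> i" if "i < f" for i
    using permute_list_nth[OF \<pi>(1), of i] \<pi> that permutes_in_image[OF \<pi>(1), of i] by simp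
  have "sorted (map (\<lambda>i. - v i) xs)" "length xs = f" by (simp_all add: xs_def)
  then have "v (\<pi> j) \<le> v (\<pi> i)" if "i \<le> j" "j < f" for i j
    using sorted_nth_mono[of "map (\<lambda>i. - v i) xs" i j] that nth by simp
  with \<pi>(1) show "\<exists>\<pi>. \<pi> permutes {..<f} \<and> (\<forall>i j. i \<le> j \<and> j < f \<longrightarrow> v (\<pi> j) \<le> v (\<pi> i))"
    by auto
next
  let ?l = "\<lambda>\<pi>. map (\<lambda>i. - v (\<pi> i)) [0..<f]"
  have l: "sorted (?l \<pi>) \<and> distinct (?l \<pi>) \<and> set (?l \<pi>) = (\<lambda>i. - v i) ` {..<f}"
    if \<pi>: "\<pi> permutes {..<f} \<and> (\<forall>i j. i \<le> j \<and> j < f \<longrightarrow> v (\<pi> j) \<le> v (\<pi> i))" for \<pi>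
  proof (intro conjI)
    show "sorted (?l \<pi>)" using \<pi> by (auto simp: sorted_iff_nth_mono)
    have "inj_on (v \<circ> \<pi>) {..<f}"
      using \<pi> inj by (intro comp_inj_on) (auto simp: permutes_image permutes_inj_on)
    then show "distinct (?l \<pi>)"
      by (auto simp: distinct_map inj_on_def)
    have "set (?l \<pi>) = (\<lambda>i. - v i) ` \<pi> ` {..<f}" by auto
    then show "set (?l \<pi>) = (\<lambda>i. - v i) ` {..<f}" using \<pi> by (simp add: permutes_image)
  qed
  fix \<pi> \<sigma>
  assume \<pi>: "\<pi> permutes {..<f} \<and> (\<forall>i j. i \<le> j \<and> j < f \<longrightarrow> v (\<pi> j) \<le> v (\<pi> i))"
    and \<sigma>: "\<sigma> permutes {..<f} \<and> (\<forall>i j. i \<le> j \<and> j < f \<longrightarrow> v (\<sigma> j) \<le> v (\<sigma> i))"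
  have "?l \<pi> = ?l \<sigma>"
    using l[OF \<pi>] l[OF \<sigma>] by (intro sorted_distinct_set_unique) auto
  then have "v (\<pi> i) = v (\<sigma> i)" if "i < f" for i
    using that by (auto simp: map_eq_conv)
  moreover have "\<pi> i < f" "\<sigma> i < f" if "i < f" for i
    using that \<pi> \<sigma> by (auto simp: permutes_in_image dest: permutes_in_image[of _ _ i])
  ultimately have "\<pi> i = \<sigma> i" if "i < f" for i
    using inj_onD[OF inj, of "\<pi> i" "\<sigma> i"] that by auto
  then show "\<pi> = \<sigma>"
    using \<pi> \<sigma> by (metis ext lessThan_iff permutes_not_in)
qed

context finite_measure
begin

lemma product_sigma_finite_const: "product_sigma_finite (\<lambda>_. M)"
  by (simp add: product_sigma_finite_def sigma_finite_measure_axioms)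

lemma distr_permute_PiM:
  assumes \<pi>: "\<pi> permutes {..<f::nat}"
  shows "distr (Pi\<^sub>M {..<f} (\<lambda>_. M)) (Pi\<^sub>M {..<f} (\<lambda>_. M)) (\<lambda>x. \<lambda>i\<in>{..<f}. x (\<pi> i)) = Pi\<^sub>M {..<f} (\<lambda>_. M)"
    (is "distr ?P ?P ?h = _")
proof -
  interpret product_sigma_finite "\<lambda>_::nat. M" by (rule product_sigma_finite_const)
  have \<pi>i: "\<pi> i < f" "inv \<pi> i < f" if "i < f" for i
    using permutes_in_image[OF \<pi>, of i] permutes_in_image[OF permutes_inv[OF \<pi>], of i] that by auto
  have h[measurable]: "?h \<in> measurable ?P ?P"
    using \<pi>i by (intro measurable_restrict measurable_component_singleton) auto
  show ?thesis
  proof (rule PiM_eqI)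
    fix A assume A: "\<And>i. i \<in> {..<f} \<Longrightarrow> A i \<in> sets M"
    have "?h -` Pi\<^sub>E {..<f} A \<inter> space ?P = Pi\<^sub>E {..<f} (\<lambda>i. A (inv \<pi> i))"
    proof (intro equalityI subsetI)
      fix x assume x: "x \<in> ?h -` Pi\<^sub>E {..<f} A \<inter> space ?P"
      have "x i \<in> A (inv \<pi> i)" if "i < f" for i
      proof -
        have "?h x (inv \<pi> i) \<in> A (inv \<pi> i)" using x \<pi>i[OF that] by auto
        then show ?thesis using \<pi>i[OF that] permutes_inverses(1)[OF \<pi>] by simp
      qed
      then show "x \<in> Pi\<^sub>E {..<f} (\<lambda>i. A (inv \<pi> i))"
        using x by (auto simp: space_PiM PiE_iff)
    next
      fix x assume x: "x \<in> Pi\<^sub>E {..<f} (\<lambda>i. A (inv \<pi> i))"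
      have "x (\<pi> i) \<in> A i" if "i < f" for i
        using PiE_mem[OF x, of "\<pi> i"] \<pi>i[OF that] permutes_inverses(2)[OF \<pi>] by simp
      moreover have "x i \<in> space M" if "i < f" for i
        using PiE_mem[OF x, of i] that \<pi>i[OF that] A sets.sets_into_space by blast
      ultimately show "x \<in> ?h -` Pi\<^sub>E {..<f} A \<inter> space ?P"
        using x by (auto simp: space_PiM PiE_iff)
    qed
    then have "emeasure (distr ?P ?P ?h) (Pi\<^sub>E {..<f} A) = emeasure ?P (Pi\<^sub>E {..<f} (\<lambda>i. A (inv \<pi> i)))"
      using A by (subst emeasure_distr) (auto intro!: sets_PiM_I_finite)
    also have "\<dots> = (\<Prod>i<f. emeasure M (A (inv \<pi> i)))"
      using A \<pi>i by (subst emeasure_PiM) auto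
    also have "\<dots> = (\<Prod>i<f. emeasure M (A i))"
      using prod.permute[OF permutes_inv[OF \<pi>], of "\<lambda>i. emeasure M (A i)"] by (simp add: comp_def)
    finally show "emeasure (distr ?P ?P ?h) (Pi\<^sub>E {..<f} A) = (\<Prod>i<f. emeasure M (A i))" .
  qed auto
qed

text \<open>
  For two given coordinates, integrate over one of them first: a tie means that it hits the value
  of the other one, which is an atomless event.
\<close>

lemma AE_PiM_inj_on:
  fixes g :: "'a \<Rightarrow> real" and f :: nat
  assumes g[measurable]: "g \<in> borel_measurable M"
    and atomless: "\<And>c. emeasure M {y \<in> space M. g y = c} = 0"
  shows "AE x in Pi\<^sub>M {..<f} (\<lambda>_. M). inj_on (\<lambda>i. g (x i)) {..<f}"
proof -
  interpret product_sigma_finite "\<lambda>_::nat. M" by (rule product_sigma_finite_const)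
  have ae: "AE x in Pi\<^sub>M {..<f} (\<lambda>_. M). g (x i) \<noteq> g (x j)" if ij: "i < f" "j < f" "i \<noteq> j" for i j
  proof -
    have f: "{..<f} = insert i ({..<f} - {i})" using ij by auto
    let ?P = "Pi\<^sub>M (insert i ({..<f} - {i})) (\<lambda>_. M)"
    let ?B = "{x \<in> space ?P. g (x i) = g (x j)}"
    have [measurable]: "(\<lambda>x. x i) \<in> measurable ?P M" "(\<lambda>x. x j) \<in> measurable ?P M"
      using ij by (auto intro!: measurable_component_singleton)
    have B: "?B \<in> sets ?P" by measurable
    have "emeasure ?P ?B = (\<integral>\<^sup>+x. indicator ?B x \<partial>?P)"
      using B by simp
    also have "\<dots> = (\<integral>\<^sup>+x. (\<integral>\<^sup>+y. indicator ?B (x(i := y)) \<partial>M) \<partial>Pi\<^sub>M ({..<f} - {i}) (\<lambda>_. M))"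
      using B by (intro product_nn_integral_insert) auto
    also have "\<dots> = (\<integral>\<^sup>+x. 0 \<partial>Pi\<^sub>M ({..<f} - {i}) (\<lambda>_. M))"
    proof (rule nn_integral_cong)
      fix x assume x: "x \<in> space (Pi\<^sub>M ({..<f} - {i}) (\<lambda>_. M))"
      have "(\<integral>\<^sup>+y. indicator ?B (x(i := y)) \<partial>M) \<le> (\<integral>\<^sup>+y. indicator {y \<in> space M. g y = g (x j)} y \<partial>M)"
        using ij by (intro nn_integral_mono) (auto simp: indicator_def)
      also have "\<dots> = 0" using atomless by simp
      finally show "(\<integral>\<^sup>+y. indicator ?B (x(i := y)) \<partial>M) = 0" by simp
    qed
    finally have "emeasure ?P ?B = 0" by simp
    then show ?thesis
      unfolding f[symmetric] using B f by (intro AE_I'[of ?B]) (auto simp: null_sets_def)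
  qed
  have "AE x in Pi\<^sub>M {..<f} (\<lambda>_. M). \<forall>i\<in>{..<f}. \<forall>j\<in>{..<f}. i \<noteq> j \<longrightarrow> g (x i) \<noteq> g (x j)"
    using ae by (intro AE_finite_allI finite_lessThan) (auto simp: AE_conj_iff)
  then show ?thesis
    by eventually_elim (auto simp: inj_on_def)
qed

lemma sets_decreasing_tuples:
  fixes g :: "'a \<Rightarrow> real" and f :: nat
  assumes g[measurable]: "g \<in> borel_measurable M" and C: "C \<in> sets (Pi\<^sub>M {..<f} (\<lambda>_. M))"
  shows "C \<inter> decreasing_tuples g f \<in> sets (Pi\<^sub>M {..<f} (\<lambda>_. M))"
proof -
  let ?P = "Pi\<^sub>M {..<f} (\<lambda>_. M)"
  have [measurable]: "(\<lambda>x. g (x i)) \<in> borel_measurable ?P" if "i < f" for i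
    using that by (intro measurable_compose[OF _ g] measurable_component_singleton) auto
  have "{x \<in> space ?P. \<forall>j\<in>{..<f}. \<forall>i\<in>{..j}. g (x j) \<le> g (x i)} \<in> sets ?P"
    by (intro sets.sets_Collect_finite_All borel_measurable_le) auto
  then have "C \<inter> {x \<in> space ?P. \<forall>j\<in>{..<f}. \<forall>i\<in>{..j}. g (x j) \<le> g (x i)} \<in> sets ?P"
    using C by simp
  also have "C \<inter> {x \<in> space ?P. \<forall>j\<in>{..<f}. \<forall>i\<in>{..j}. g (x j) \<le> g (x i)} = C \<inter> decreasing_tuples g f"
    using sets.sets_into_space[OF C] by (auto simp: decreasing_tuples_def)
  finally show ?thesis .
qed

text \<open>
  Almost every tuple has exactly one rearrangement in decreasing order, and each of the \<open>f!\<close>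
  rearrangements preserves the power of the measure. So every one of them contributes the same
  share of a symmetric set.
\<close>

lemma emeasure_decreasing_tuples:
  fixes g :: "'a \<Rightarrow> real" and f :: nat
  defines "P \<equiv> Pi\<^sub>M {..<f} (\<lambda>_. M)"
  assumes g[measurable]: "g \<in> borel_measurable M"
    and atomless: "\<And>c. emeasure M {y \<in> space M. g y = c} = 0"
    and C: "C \<in> sets P"
    and sym: "\<And>\<pi> x. \<pi> permutes {..<f} \<Longrightarrow> x \<in> space P \<Longrightarrow> (\<lambda>i\<in>{..<f}. x (\<pi> i)) \<in> C \<longleftrightarrow> x \<in> C"
  shows "emeasure P C = fact f * emeasure P (C \<inter> decreasing_tuples g f)"
proof -
  let ?S = "{\<pi>. \<pi> permutes {..<f}}"
  let ?h = "\<lambda>\<pi> x. \<lambda>i\<in>{..<f}. x (\<pi> i)"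
  let ?CD = "C \<inter> decreasing_tuples g f"
  have CD: "?CD \<in> sets P"
    using C unfolding P_def by (intro sets_decreasing_tuples g)
  have h: "?h \<pi> \<in> measurable P P" if "\<pi> permutes {..<f}" for \<pi>
    unfolding P_def using permutes_in_image[OF that] 
    by (intro measurable_restrict measurable_component_singleton) auto
  have dec: "?h \<pi> x \<in> decreasing_tuples g f \<longleftrightarrow> (\<forall>i j. i \<le> j \<and> j < f \<longrightarrow> g (x (\<pi> j)) \<le> g (x (\<pi> i)))" for \<pi> x
    by (auto simp: decreasing_tuples_def)
  have "AE x in P. (indicator C x :: ennreal) = (\<Sum>\<pi>\<in>?S. indicator ?CD (?h \<pi> x))"
    using AE_PiM_inj_on[OF g atomless, of f, folded P_def] AE_space
  proof eventually_elim
    fix x assume inj: "inj_on (\<lambda>i. g (x i)) {..<f}" and x: "x \<in> space P"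
    obtain \<pi> where \<pi>: "\<pi> permutes {..<f}" "?h \<pi> x \<in> decreasing_tuples g f"
      and uniq: "\<And>\<sigma>. \<sigma> permutes {..<f} \<Longrightarrow> ?h \<sigma> x \<in> decreasing_tuples g f \<Longrightarrow> \<sigma> = \<pi>"
      using ex1_decreasing_permutation[OF inj] unfolding dec by (elim ex1E) blast
    have "indicator ?CD (?h \<sigma> x) = (if \<sigma> = \<pi> then indicator C x else 0 :: ennreal)" if "\<sigma> \<in> ?S" for \<sigma>
    proof (cases "\<sigma> = \<pi>")
      case True
      have "?h \<pi> x \<in> ?CD \<longleftrightarrow> x \<in> C" using \<pi> sym[OF \<pi>(1) x] by blast
      then show ?thesis by (simp only: True indicator_def of_bool_def simp_thms if_True)
    next
      case False
      then have "?h \<sigma> x \<notin> ?CD" using uniq that by blast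
      then show ?thesis by (simp only: False indicator_def of_bool_def if_False)
    qed
    then have "(\<Sum>\<sigma>\<in>?S. indicator ?CD (?h \<sigma> x)) = (\<Sum>\<sigma>\<in>?S. if \<sigma> = \<pi> then indicator C x else 0 :: ennreal)"
      by (rule sum.cong[OF refl])
    also have "\<dots> = indicator C x"
      using \<pi>(1) by (subst sum.delta) (auto simp: finite_permutations)
    finally show "indicator C x = (\<Sum>\<pi>\<in>?S. indicator ?CD (?h \<pi> x) :: ennreal)" by simp
  qed
  then have "(\<integral>\<^sup>+x. indicator C x \<partial>P) = (\<integral>\<^sup>+x. (\<Sum>\<pi>\<in>?S. indicator ?CD (?h \<pi> x)) \<partial>P)"
    by (rule nn_integral_cong_AE)
  also have "\<dots> = (\<Sum>\<pi>\<in>?S. \<integral>\<^sup>+x. indicator ?CD (?h \<pi> x) \<partial>P)"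
    using h CD by (intro nn_integral_sum) (auto intro!: measurable_compose[OF h borel_measurable_indicator])
  also have "\<dots> = (\<Sum>\<pi>\<in>?S. emeasure P ?CD)"
  proof (rule sum.cong[OF refl])
    fix \<pi> assume "\<pi> \<in> ?S"
    then have \<pi>: "\<pi> permutes {..<f}" by simp
    have "(\<integral>\<^sup>+x. indicator ?CD (?h \<pi> x) \<partial>P) = (\<integral>\<^sup>+x. indicator ?CD x \<partial>distr P P (?h \<pi>))"
      using h[OF \<pi>] CD by (subst nn_integral_distr) auto
    also have "distr P P (?h \<pi>) = P"
      unfolding P_def by (rule distr_permute_PiM[OF \<pi>])
    finally show "(\<integral>\<^sup>+x. indicator ?CD (?h \<pi> x) \<partial>P) = emeasure P ?CD"
      unfolding nn_integral_indicator[OF CD] .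
  qed
  also have "\<dots> = fact f * emeasure P ?CD"
    by (simp add: card_permutations)
  finally show "emeasure P C = fact f * emeasure P ?CD"
    using C by simp
qed

end

section \<open>Numbers of visits of a tuple\<close>

definition hits :: "(nat \<Rightarrow> 'b) \<Rightarrow> nat \<Rightarrow> 'b set \<Rightarrow> nat" where
  "hits x f A = card {r. r < f \<and> x r \<in> A}"

lemma hits_conv_sum: "hits x f A = (\<Sum>r<f. of_bool (x r \<in> A))"
proof -
  have "{r. r < f \<and> x r \<in> A} = {..<f} \<inter> {r. x r \<in> A}" by auto
  then show ?thesis unfolding hits_def by (simp add: of_bool_def sum.If_cases)
qed

lemma hits_cong: "(\<And>r. r < f \<Longrightarrow> x r \<in> A \<longleftrightarrow> y r \<in> B) \<Longrightarrow> hits x f A = hits y f B"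
  unfolding hits_conv_sum by (intro sum.cong) auto

lemma hits_Suc_upd: "hits (x(f := y)) (Suc f) A = hits x f A + of_bool (y \<in> A)"
  unfolding hits_conv_sum by simp

lemma hits_permute:
  assumes "\<pi> permutes {..<f}"
  shows "hits (\<lambda>i\<in>{..<f}. x (\<pi> i)) f A = hits x f A"
proof -
  have "hits (\<lambda>i\<in>{..<f}. x (\<pi> i)) f A = (\<Sum>r<f. of_bool (x (\<pi> r) \<in> A))"
    unfolding hits_conv_sum by (intro sum.cong) auto
  also have "\<dots> = (\<Sum>r<f. of_bool (x r \<in> A))"
    using sum.permute[OF assms, of "\<lambda>r. of_bool (x r \<in> A) :: nat"] by (simp add: comp_def)
  finally show ?thesis unfolding hits_conv_sum .
qed

lemma sum_hits_partition:
  assumes "finite J" "disjoint_family_on A J" "\<And>r. r < f \<Longrightarrow> x r \<in> (\<Union>a\<in>J. A a)"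
  shows "(\<Sum>a\<in>J. hits x f (A a)) = f"
proof -
  have "(\<Sum>a\<in>J. hits x f (A a)) = card (\<Union>a\<in>J. {r. r < f \<and> x r \<in> A a})"
    unfolding hits_def using assms(1,2)
    by (intro card_UN_disjoint[symmetric]) (auto simp: disjoint_family_on_def)
  also have "(\<Union>a\<in>J. {r. r < f \<and> x r \<in> A a}) = {..<f}" using assms(3) by auto
  finally show ?thesis by simp
qed

lemma emeasure_distr_count_space_hits:
  assumes "\<And>i. i < f \<Longrightarrow> p i \<in> space N" "A \<in> sets N"
  shows "emeasure (distr (count_space {..<f}) N p) A = of_nat (hits p f A)"
proof -
  have "p \<in> measurable (count_space {..<f}) N" using assms by auto
  moreover have "p -` A \<inter> {..<f} = {r. r < f \<and> p r \<in> A}" by auto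
  ultimately show ?thesis
    using assms(2) by (subst emeasure_distr) (auto simp: hits_def intro!: emeasure_count_space_finite)
qed

lemma sets_hits_eq:
  assumes "A \<in> sets N"
  shows "{x \<in> space (Pi\<^sub>M {..<f::nat} (\<lambda>_. N)). hits x f A = k} \<in> sets (Pi\<^sub>M {..<f} (\<lambda>_. N))"
proof -
  let ?P = "Pi\<^sub>M {..<f} (\<lambda>_. N)"
  have m: "(\<lambda>x. \<Sum>r<f. indicator A (x r) :: real) \<in> borel_measurable ?P"
    using assms by (intro borel_measurable_sum measurable_compose[OF _ borel_measurable_indicator]
      measurable_component_singleton) auto
  have eq: "(\<Sum>r<f. indicator A (x r) :: real) = real (hits x f A)" for x
    unfolding hits_conv_sum of_nat_sum by (intro sum.cong) (auto simp: indicator_def)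
  have "{x \<in> space ?P. real (hits x f A) = real k} \<in> sets ?P"
    using m unfolding eq by measurable
  then show ?thesis by simp
qed

context finite_measure
begin

text \<open>
  The multinomial formula. The induction splits according to the class \<open>A a\<close> that contains the last
  coordinate. Splitting off this coordinate lowers \<open>k a\<close> by one and so yields the claimed product
  times \<open>k a\<close>; these weights add up to \<open>Suc f\<close>.
\<close>

lemma emeasure_hits:
  fixes A :: "'i \<Rightarrow> 'a set" and k :: "'i \<Rightarrow> nat"
  assumes J: "finite J" and A: "\<And>a. a \<in> J \<Longrightarrow> A a \<in> sets M"
    and disj: "disjoint_family_on A J" and cover: "(\<Union>a\<in>J. A a) = space M"
    and f: "f = sum k J"
  shows "emeasure (Pi\<^sub>M {..<f} (\<lambda>_. M)) {x \<in> space (Pi\<^sub>M {..<f} (\<lambda>_. M)). \<forall>a\<in>J. hits x f (A a) = k a}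
    = ennreal (fact f * (\<Prod>a\<in>J. measure M (A a) ^ k a / fact (k a)))"
  using f
proof (induction f arbitrary: k)
  case 0
  then have "\<forall>a\<in>J. k a = 0" using J by simp
  moreover from this have "{x \<in> space (Pi\<^sub>M {..<0} (\<lambda>_. M)). \<forall>a\<in>J. hits x 0 (A a) = k a} = {\<lambda>_. undefined}"
    by (auto simp: hits_def space_PiM)
  ultimately show ?case by simp
next
  case (Suc f)
  interpret product_sigma_finite "\<lambda>_::nat. M" by (rule product_sigma_finite_const)
  define E where "E f k = {x \<in> space (Pi\<^sub>M {..<f} (\<lambda>_. M)). \<forall>a\<in>J. hits x f (A a) = k a}"
    for f :: nat and k :: "'i \<Rightarrow> nat"
  have E: "E f k \<in> sets (Pi\<^sub>M {..<f} (\<lambda>_. M))" for f k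
    unfolding E_def using J A by (intro sets.sets_Collect_finite_All sets_hits_eq)
  define w where "w a j = measure M (A a) ^ j / fact j" for a j
  have w0: "0 \<le> w a j" for a j by (simp add: w_def)
  let ?k = "\<lambda>a. k(a := k a - 1)"
  let ?J = "{a \<in> J. 0 < k a}"
  have fJ: "finite ?J" using J by simp
  have split: "indicator (E (Suc f) k) (x(f := y)) = (\<Sum>a\<in>?J. indicator (E f (?k a)) x * indicator (A a) y :: ennreal)"
    if x: "x \<in> space (Pi\<^sub>M {..<f} (\<lambda>_. M))" and y: "y \<in> space M" for x y
  proof -
    obtain b where b: "b \<in> J" "y \<in> A b" using y cover by auto
    have yA: "y \<in> A a \<longleftrightarrow> a = b" if "a \<in> J" for a
      using disj b that by (auto simp: disjoint_family_on_def)
    have "x(f := y) \<in> space (Pi\<^sub>M {..<Suc f} (\<lambda>_. M))"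
      using x y by (auto simp: space_PiM PiE_iff extensional_def less_Suc_eq)
    then have iff: "x(f := y) \<in> E (Suc f) k \<longleftrightarrow> b \<in> ?J \<and> x \<in> E f (?k b)"
      using x b by (auto simp: E_def hits_Suc_upd yA of_bool_def split: if_splits)
    have "(\<Sum>a\<in>?J. indicator (E f (?k a)) x * indicator (A a) y)
        = (\<Sum>a\<in>?J. if a = b then indicator (E f (?k b)) x else 0 :: ennreal)"
      by (intro sum.cong) (auto simp: yA indicator_def)
    then show ?thesis
      using fJ iff by (simp add: indicator_def)
  qed
  have insert: "{..<Suc f} = insert f {..<f}" by auto
  have "emeasure (Pi\<^sub>M {..<Suc f} (\<lambda>_. M)) (E (Suc f) k) = (\<integral>\<^sup>+x. indicator (E (Suc f) k) x \<partial>Pi\<^sub>M {..<Suc f} (\<lambda>_. M))"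
    using E by simp
  also have "\<dots> = (\<integral>\<^sup>+x. (\<integral>\<^sup>+y. indicator (E (Suc f) k) (x(f := y)) \<partial>M) \<partial>Pi\<^sub>M {..<f} (\<lambda>_. M))"
    using E[of "Suc f" k] unfolding insert by (intro product_nn_integral_insert) auto
  also have "\<dots> = (\<integral>\<^sup>+x. (\<Sum>a\<in>?J. indicator (E f (?k a)) x * emeasure M (A a)) \<partial>Pi\<^sub>M {..<f} (\<lambda>_. M))"
  proof (rule nn_integral_cong)
    fix x assume x: "x \<in> space (Pi\<^sub>M {..<f} (\<lambda>_. M))"
    have "(\<integral>\<^sup>+y. indicator (E (Suc f) k) (x(f := y)) \<partial>M)
        = (\<integral>\<^sup>+y. (\<Sum>a\<in>?J. indicator (E f (?k a)) x * indicator (A a) y) \<partial>M)"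
      using split[OF x] by (intro nn_integral_cong)
    also have "\<dots> = (\<Sum>a\<in>?J. \<integral>\<^sup>+y. indicator (E f (?k a)) x * indicator (A a) y \<partial>M)"
      using A by (intro nn_integral_sum) auto
    also have "\<dots> = (\<Sum>a\<in>?J. indicator (E f (?k a)) x * emeasure M (A a))"
      using A by (intro sum.cong refl nn_integral_cmult_indicator) auto
    finally show "(\<integral>\<^sup>+y. indicator (E (Suc f) k) (x(f := y)) \<partial>M)
        = (\<Sum>a\<in>?J. indicator (E f (?k a)) x * emeasure M (A a))" .
  qed
  also have "\<dots> = (\<Sum>a\<in>?J. \<integral>\<^sup>+x. indicator (E f (?k a)) x * emeasure M (A a) \<partial>Pi\<^sub>M {..<f} (\<lambda>_. M))"
    using E by (intro nn_integral_sum) auto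
  also have "\<dots> = (\<Sum>a\<in>?J. emeasure (Pi\<^sub>M {..<f} (\<lambda>_. M)) (E f (?k a)) * emeasure M (A a))"
    using E by (intro sum.cong refl) (simp add: nn_integral_multc)
  also have "\<dots> = (\<Sum>a\<in>?J. ennreal (fact f * real (k a) * (\<Prod>b\<in>J. w b (k b))))"
  proof (intro sum.cong refl)
    fix a assume a: "a \<in> ?J"
    have ks: "sum k J = k a + sum k (J - {a})" "sum (?k a) J = (k a - 1) + sum k (J - {a})"
      using a J by (auto simp: sum.remove[of J a])
    then have "f = sum (?k a) J" using Suc.prems a by auto
    then have IH: "emeasure (Pi\<^sub>M {..<f} (\<lambda>_. M)) (E f (?k a)) = ennreal (fact f * (\<Prod>b\<in>J. w b (?k a b)))"
      unfolding E_def w_def by (rule Suc.IH)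
    have "w a (k a - 1) * measure M (A a) = real (k a) * w a (k a)"
      using a by (cases "k a") (auto simp: w_def divide_simps)
    moreover have "(\<Prod>b\<in>J. w b (?k a b)) = w a (k a - 1) * (\<Prod>b\<in>J - {a}. w b (k b))"
      "(\<Prod>b\<in>J. w b (k b)) = w a (k a) * (\<Prod>b\<in>J - {a}. w b (k b))"
      using a J by (auto simp: prod.remove[of J a] intro!: prod.cong)
    moreover have "w a (k a - 1) * q * measure M (A a) = w a (k a - 1) * measure M (A a) * q" for q
      by (simp only: mult_ac)
    ultimately have "(\<Prod>b\<in>J. w b (?k a b)) * measure M (A a) = real (k a) * (\<Prod>b\<in>J. w b (k b))"
      by (simp only: mult.assoc)
    then show "emeasure (Pi\<^sub>M {..<f} (\<lambda>_. M)) (E f (?k a)) * emeasure M (A a)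
        = ennreal (fact f * real (k a) * (\<Prod>b\<in>J. w b (k b)))"
      unfolding IH emeasure_eq_measure
      using w0 by (simp add: ennreal_mult'[symmetric] mult.assoc prod_nonneg)
  qed
  also have "\<dots> = ennreal (\<Sum>a\<in>?J. fact f * real (k a) * (\<Prod>b\<in>J. w b (k b)))"
    using w0 by (intro sum_ennreal) (auto intro!: mult_nonneg_nonneg prod_nonneg)
  also have "(\<Sum>a\<in>?J. fact f * real (k a) * (\<Prod>b\<in>J. w b (k b)))
      = fact f * real (\<Sum>a\<in>?J. k a) * (\<Prod>b\<in>J. w b (k b))"
    by (simp add: sum_distrib_left sum_distrib_right)
  also have "(\<Sum>a\<in>?J. k a) = Suc f"
    unfolding Suc.prems using J by (intro sum.mono_neutral_left) auto
  finally show ?case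
    unfolding E_def w_def by (simp add: mult.commute)
qed

end

section \<open>Poisson processes listed in decreasing order\<close>

text \<open>
  A random list of points, ordered by decreasing \<open>g\<close>, whose law on each length \<open>f\<close> is the one that
  the points of a Poisson process with finite intensity \<open>\<nu>\<close> have when they are sorted.
\<close>

locale decreasing_listing = prob_space M + \<nu>: finite_measure \<nu>
  for M :: "'a measure" and \<nu> :: "'b measure" +
  fixes g :: "'b \<Rightarrow> real" and F :: "'a \<Rightarrow> nat" and p :: "nat \<Rightarrow> 'a \<Rightarrow> 'b"
  assumes g [measurable]: "g \<in> borel_measurable \<nu>"
    and atomless: "\<And>c. emeasure \<nu> {y \<in> space \<nu>. g y = c} = 0"
    and p_space: "\<And>\<omega> i. \<omega> \<in> space M \<Longrightarrow> i < F \<omega> \<Longrightarrow> p i \<omega> \<in> space \<nu>"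
    and law_sets: "\<And>f C. C \<in> sets (Pi\<^sub>M {..<f} (\<lambda>_. \<nu>)) \<Longrightarrow>
        {\<omega> \<in> space M. F \<omega> = f \<and> (\<lambda>i\<in>{..<f}. p i \<omega>) \<in> C} \<in> sets M"
    and law: "\<And>f C. C \<in> sets (Pi\<^sub>M {..<f} (\<lambda>_. \<nu>)) \<Longrightarrow>
        emeasure M {\<omega> \<in> space M. F \<omega> = f \<and> (\<lambda>i\<in>{..<f}. p i \<omega>) \<in> C}
          = ennreal (exp (- measure \<nu> (space \<nu>))) * emeasure (Pi\<^sub>M {..<f} (\<lambda>_. \<nu>)) (C \<inter> decreasing_tuples g f)"
begin

definition number :: "'b set \<Rightarrow> 'a \<Rightarrow> nat" where
  "number A \<omega> = hits (\<lambda>i. p i \<omega>) (F \<omega>) A"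

lemma measurable_number: 
  assumes A: "A \<in> sets \<nu>" shows "number A \<in> measurable M (count_space UNIV)"
proof (rule measurable_count_space_eq2_countable[THEN iffD2, rotated], intro conjI ballI)
  fix k :: nat
  have "number A -` {k} \<inter> space M = (\<Union>f. {\<omega> \<in> space M. F \<omega> = f \<and>
      (\<lambda>i\<in>{..<f}. p i \<omega>) \<in> {x \<in> space (Pi\<^sub>M {..<f} (\<lambda>_. \<nu>)). hits x f A = k}})"
    using p_space by (auto simp: number_def space_PiM hits_def cong: conj_cong)
  also have "\<dots> \<in> sets M"
    using law_sets[OF sets_hits_eq[OF A]] by (intro sets.countable_UN) blast
  finally show "number A -` {k} \<inter> space M \<in> sets M" .
qed auto

definition poisson_weight :: "'b set \<Rightarrow> nat \<Rightarrow> real" where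
  "poisson_weight A k = measure \<nu> A ^ k / fact k * exp (- measure \<nu> A)"

lemma poisson_weight_sums: "poisson_weight A sums 1"
proof -
  have "(\<lambda>k. measure \<nu> A ^ k / fact k * exp (- measure \<nu> A)) sums (exp (measure \<nu> A) * exp (- measure \<nu> A))"
    using exp_converges[of "measure \<nu> A"] by (intro sums_mult2) (simp add: scaleR_conv_of_real divide_inverse mult.commute)
  then show ?thesis
    unfolding poisson_weight_def by (simp add: exp_minus)
qed

text \<open>
  For a partition, the numbers of points in the classes determine the length \<open>f\<close> of the list, so
  that a single \<open>f\<close> contributes. There the \<open>f!\<close> from sorting cancels the one from the multinomial
  formula, and the exponential factor splits over the classes.
\<close>

lemma prob_number_partition:
  fixes A :: "'i \<Rightarrow> 'b set"
  assumes J: "finite J" and A: "\<And>a. a \<in> J \<Longrightarrow> A a \<in> sets \<nu>"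
    and disj: "disjoint_family_on A J" and cover: "(\<Union>a\<in>J. A a) = space \<nu>"
  shows "prob {\<omega> \<in> space M. \<forall>a\<in>J. number (A a) \<omega> = k a} = (\<Prod>a\<in>J. poisson_weight (A a) (k a))"
proof -
  define f where "f = sum k J"
  let ?P = "Pi\<^sub>M {..<f} (\<lambda>_. \<nu>)"
  let ?C = "{x \<in> space ?P. \<forall>a\<in>J. hits x f (A a) = k a}"
  have C: "?C \<in> sets ?P"
    using J A by (intro sets.sets_Collect_finite_All sets_hits_eq)
  have hr: "hits (\<lambda>i\<in>{..<f}. p i \<omega>) f B = hits (\<lambda>i. p i \<omega>) f B" for \<omega> B
    by (rule hits_cong) simp
  have "F \<omega> = f" if \<omega>: "\<omega> \<in> space M" "\<forall>a\<in>J. number (A a) \<omega> = k a" for \<omega>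
    using sum_hits_partition[OF J disj, of "F \<omega>" "\<lambda>i. p i \<omega>"] p_space[OF \<omega>(1)] \<omega>(2)
    by (simp add: cover f_def number_def)
  then have eq: "{\<omega> \<in> space M. \<forall>a\<in>J. number (A a) \<omega> = k a} = {\<omega> \<in> space M. F \<omega> = f \<and> (\<lambda>i\<in>{..<f}. p i \<omega>) \<in> ?C}"
    using p_space by (auto simp: number_def hr space_PiM)
  have sym: "(\<lambda>i\<in>{..<f}. x (\<pi> i)) \<in> ?C \<longleftrightarrow> x \<in> ?C" if "\<pi> permutes {..<f}" "x \<in> space ?P" for \<pi> x
    using that permutes_in_image[OF that(1)] by (auto simp: hits_permute space_PiM PiE_iff)
  have "emeasure ?P ?C = ennreal (fact f) * emeasure ?P (?C \<inter> decreasing_tuples g f)"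
    using \<nu>.emeasure_decreasing_tuples[OF g atomless C sym] by (simp add: ennreal_fact)
  moreover have "emeasure ?P ?C = ennreal (fact f) * ennreal (\<Prod>a\<in>J. measure \<nu> (A a) ^ k a / fact (k a))"
    using \<nu>.emeasure_hits[OF J A disj cover f_def] by (simp add: ennreal_mult prod_nonneg)
  ultimately have "emeasure ?P (?C \<inter> decreasing_tuples g f) = ennreal (\<Prod>a\<in>J. measure \<nu> (A a) ^ k a / fact (k a))"
    by (simp add: ennreal_mult_cancel_left)
  then have "emeasure M {\<omega> \<in> space M. \<forall>a\<in>J. number (A a) \<omega> = k a}
      = ennreal (exp (- measure \<nu> (space \<nu>)) * (\<Prod>a\<in>J. measure \<nu> (A a) ^ k a / fact (k a)))"
    unfolding eq law[OF C] by (simp add: ennreal_mult prod_nonneg)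
  then have "prob {\<omega> \<in> space M. \<forall>a\<in>J. number (A a) \<omega> = k a}
      = exp (- measure \<nu> (space \<nu>)) * (\<Prod>a\<in>J. measure \<nu> (A a) ^ k a / fact (k a))"
    by (simp add: measure_def prod_nonneg)
  also have "measure \<nu> (space \<nu>) = (\<Sum>a\<in>J. measure \<nu> (A a))"
    unfolding cover[symmetric] using J A disj by (intro \<nu>.finite_measure_finite_Union) auto
  also have "exp (- \<dots>) = (\<Prod>a\<in>J. exp (- measure \<nu> (A a)))"
    using J by (simp add: exp_sum sum_negf[symmetric])
  finally show ?thesis
    by (simp add: poisson_weight_def prod.distrib[symmetric] mult.commute)
qed

text \<open>
  The complement of the given sets serves as an additional class, indexed by \<open>None\<close>; its number of
  points is then summed out.
\<close>

lemma prob_number_disjoint: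
  fixes A :: "'i \<Rightarrow> 'b set"
  assumes J: "finite J" and A: "\<And>a. a \<in> J \<Longrightarrow> A a \<in> sets \<nu>" and disj: "disjoint_family_on A J"
  shows "prob {\<omega> \<in> space M. \<forall>a\<in>J. number (A a) \<omega> = k a} = (\<Prod>a\<in>J. poisson_weight (A a) (k a))"
proof -
  define B where "B = case_option (space \<nu> - (\<Union>a\<in>J. A a)) A"
  let ?J = "insert None (Some ` J)"
  have AN: "A a \<subseteq> space \<nu>" if "a \<in> J" for a using A[OF that] by (rule sets.sets_into_space)
  have BJ: "finite ?J" "\<And>b. b \<in> ?J \<Longrightarrow> B b \<in> sets \<nu>"
    using J A by (auto simp: B_def intro!: sets.Diff sets.finite_UN)
  have disjB: "disjoint_family_on B ?J"
    using disj AN unfolding disjoint_family_on_def by (auto simp: B_def)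
  have coverB: "(\<Union>b\<in>?J. B b) = space \<nu>"
    using AN by (auto simp: B_def)
  let ?E = "\<lambda>r. {\<omega> \<in> space M. \<forall>b\<in>?J. number (B b) \<omega> = case_option r k b}"
  have [measurable]: "number (B b) \<in> measurable M (count_space UNIV)" if "b \<in> ?J" for b
    using BJ that by (intro measurable_number)
  have E: "?E r \<in> events" for r
    using BJ(1) by (intro sets.sets_Collect_finite_All) auto
  have pE: "prob (?E r) = poisson_weight (B None) r * (\<Prod>a\<in>J. poisson_weight (A a) (k a))" for r
    using J by (subst prob_number_partition[OF BJ disjB coverB]) (auto simp: prod.reindex B_def)
  have "(\<lambda>r. prob (?E r)) sums prob (\<Union>r. ?E r)"
    using E by (intro finite_measure_UNION) (auto simp: disjoint_family_on_def)
  moreover have "(\<lambda>r. prob (?E r)) sums (1 * (\<Prod>a\<in>J. poisson_weight (A a) (k a)))"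
    unfolding pE by (intro sums_mult2 poisson_weight_sums)
  ultimately have "prob (\<Union>r. ?E r) = (\<Prod>a\<in>J. poisson_weight (A a) (k a))"
    using sums_unique2 by fastforce
  also have "(\<Union>r. ?E r) = {\<omega> \<in> space M. \<forall>a\<in>J. number (A a) \<omega> = k a}"
    by (auto simp: B_def)
  finally show ?thesis .
qed

theorem poisson_point_process_listing:
  "poisson_point_process M (\<lambda>\<omega>. distr (count_space {..<F \<omega>}) \<nu> (\<lambda>i. p i \<omega>)) \<nu>"
proof -
  let ?\<N> = "\<lambda>\<omega>. distr (count_space {..<F \<omega>}) \<nu> (\<lambda>i. p i \<omega>)"
  have \<N>: "emeasure (?\<N> \<omega>) A = of_nat (number A \<omega>)" if "\<omega> \<in> space M" "A \<in> sets \<nu>" for \<omega> A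
    unfolding number_def using that p_space by (intro emeasure_distr_count_space_hits)
  have m: "(\<lambda>\<omega>. emeasure (?\<N> \<omega>) A) \<in> borel_measurable M" if "A \<in> sets \<nu>" for A
  proof -
    have "(\<lambda>\<omega>. of_nat (number A \<omega>) :: ennreal) \<in> borel_measurable M"
      using measurable_number[OF that] by (rule measurable_compose) simp
    then show ?thesis
      by (subst measurable_cong) (auto simp: \<N> that)
  qed
  have singletons: "prob {\<omega> \<in> space M. emeasure (?\<N> \<omega>) A = of_nat k} = poisson_weight A k"
    if "A \<in> sets \<nu>" for A k
  proof -
    have "{\<omega> \<in> space M. emeasure (?\<N> \<omega>) A = of_nat k} = {\<omega> \<in> space M. \<forall>a\<in>{()}. number A \<omega> = k}"
      using \<N> that by auto
    then show ?thesis
      using prob_number_disjoint[of "{()}" "\<lambda>_. A" "\<lambda>_. k"] that by (simp add: disjoint_family_on_def)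
  qed
  have indep: "indep_vars (\<lambda>_. borel) (\<lambda>i \<omega>. emeasure (?\<N> \<omega>) (A i)) {..<m}"
    if A: "\<And>i. i < m \<Longrightarrow> A i \<in> sets \<nu>" and disj: "disjoint_family_on A {..<m}" for A and m :: nat
  proof -
    \<comment> \<open>The events \<open>number (A i) = k\<close> generate, and together with the empty set they are closed under
      intersections.\<close>
    define G where "G i = insert {} ((\<lambda>k. {\<omega> \<in> space M. number (A i) \<omega> = k}) ` UNIV)" for i
    have G_sets: "{\<omega> \<in> space M. number (A i) \<omega> = k} \<in> events" if "i < m" for i k
      using measurable_number[OF A[OF that]] by measurable
    have "indep_sets G {..<m}"
    proof (rule indep_setsI)
      show "G i \<subseteq> events" if "i \<in> {..<m}" for i
        using that G_sets by (auto simp: G_def)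
      fix B J assume J: "J \<noteq> {}" "J \<subseteq> {..<m}" "finite J" and B: "\<forall>j\<in>J. B j \<in> G j"
      show "prob (\<Inter>j\<in>J. B j) = (\<Prod>j\<in>J. prob (B j))"
      proof (cases "\<exists>j\<in>J. B j = {}")
        case True
        then have "(\<Inter>j\<in>J. B j) = {}" by auto
        moreover have "\<exists>j\<in>J. prob (B j) = 0"
          using True measure_empty by metis
        then have "(\<Prod>j\<in>J. prob (B j)) = 0"
          by (rule prod_zero[OF J(3)])
        ultimately show ?thesis by simp
      next
        case False
        have "\<exists>k. B j = {\<omega> \<in> space M. number (A j) \<omega> = k}" if "j \<in> J" for j
        proof -
          have "B j \<in> G j" "B j \<noteq> {}" using B False that by auto
          then show ?thesis unfolding G_def by (simp only: insert_iff image_iff) blast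
        qed
        then obtain k where k: "\<And>j. j \<in> J \<Longrightarrow> B j = {\<omega> \<in> space M. number (A j) \<omega> = k j}"
          by metis
        have dJ: "disjoint_family_on A J"
          using disj J by (auto simp: disjoint_family_on_def)
        have pB: "prob (B j) = poisson_weight (A j) (k j)" if "j \<in> J" for j
          using prob_number_disjoint[of "{j}" A k] A J that by (simp add: k disjoint_family_on_def subset_iff)
        have "(\<Inter>j\<in>J. B j) = {\<omega> \<in> space M. \<forall>j\<in>J. number (A j) \<omega> = k j}"
          using J(1) k by auto
        then show ?thesis
          using prob_number_disjoint[OF J(3) _ dJ, of k] A J pB by (simp add: subset_iff)
      qed
    qed
    then have "indep_sets (\<lambda>i. sigma_sets (space M) (G i)) {..<m}"
    proof (rule indep_sets_sigma)
      fix i assume "i \<in> {..<m}"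
      show "Int_stable (G i)"
      proof (rule Int_stableI)
        fix a b assume "a \<in> G i" "b \<in> G i"
        then show "a \<inter> b \<in> G i"
          by (cases "a = b") (auto simp: G_def)
      qed
    qed
    moreover have "{(\<lambda>\<omega>. emeasure (?\<N> \<omega>) (A i)) -` S \<inter> space M | S. S \<in> sets borel} \<subseteq> sigma_sets (space M) (G i)"
      if i: "i < m" for i
    proof safe
      fix S :: "ennreal set"
      have "(\<lambda>\<omega>. emeasure (?\<N> \<omega>) (A i)) -` S \<inter> space M
          = (\<Union>k\<in>{k. of_nat k \<in> S}. {\<omega> \<in> space M. number (A i) \<omega> = k})"
        using \<N> A[OF i] by auto
      also have "\<dots> \<in> sigma_sets (space M) (G i)"
      proof -
        interpret S: sigma_algebra "space M" "sigma_sets (space M) (G i)"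
          by (rule sigma_algebra_sigma_sets) (auto simp: G_def)
        show ?thesis
          by (rule S.countable_UN'') (auto simp: G_def)
      qed
      finally show "(\<lambda>\<omega>. emeasure (?\<N> \<omega>) (A i)) -` S \<inter> space M \<in> sigma_sets (space M) (G i)" .
    qed
    ultimately have "indep_sets (\<lambda>i. {(\<lambda>\<omega>. emeasure (?\<N> \<omega>) (A i)) -` S \<inter> space M | S. S \<in> sets borel}) {..<m}"
      by (rule indep_sets_mono_sets) auto
    then show ?thesis
      unfolding indep_vars_def2 using m A by auto
  qed
  show ?thesis
    unfolding poisson_point_process_def
    using \<N> m singletons indep \<nu>.emeasure_finite
    by (auto simp: poisson_weight_def top.not_eq_extremum)
qed

end

section \<open>Independent identically distributed steps\<close>

lemma measurable_walk_of:
  assumes "\<And>i. 1 \<le> i \<Longrightarrow> i \<le> k \<Longrightarrow> (\<lambda>\<omega>. f \<omega> i) \<in> borel_measurable M"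
  shows "(\<lambda>\<omega>. walk_of (f \<omega>) k) \<in> borel_measurable M"
  unfolding walk_of_def using assms by (intro borel_measurable_sum) auto

lemma measurable_segment_walk_of:
  assumes "1 \<le> j" "\<And>i. t < i \<Longrightarrow> i \<le> t + j \<Longrightarrow> (\<lambda>\<omega>. f \<omega> i) \<in> borel_measurable M"
  shows "(\<lambda>\<omega>. segment (walk_of (f \<omega>)) t j) \<in> measurable M segment_space"
proof (rule measurable_segment_spaceI[OF assms(1)])
  fix i assume i: "i < j"
  have "segment (walk_of (f \<omega>)) t j ! i = walk_of (\<lambda>i. f \<omega> (t + i)) (Suc i)" for \<omega>
    using nth_segment[of "Suc i" j "walk_of (f \<omega>)" t] walk_of_add[of "f \<omega>" t "Suc i"] i by (simp del: walk_of_Suc)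
  moreover have "(\<lambda>\<omega>. walk_of (\<lambda>i. f \<omega> (t + i)) (Suc i)) \<in> borel_measurable M"
    using i assms(2) by (intro measurable_walk_of) auto
  ultimately show "(\<lambda>\<omega>. segment (walk_of (f \<omega>)) t j ! i) \<in> borel_measurable M" by simp
qed simp

locale iid_sequence = prob_space M for M :: "'a measure" +
  fixes X :: "nat \<Rightarrow> 'a \<Rightarrow> real"
  assumes indep: "indep_vars (\<lambda>_. borel) X {1..}"
    and ident: "\<And>i. 1 \<le> i \<Longrightarrow> distr M borel (X i) = distr M borel (X 1)"
    and atomless: "\<And>x. emeasure (distr M borel (X 1)) {x} = 0"
begin

lemma measurable_X: "1 \<le> i \<Longrightarrow> X i \<in> borel_measurable M"
  using indep by (auto simp: indep_vars_def)

abbreviation "step_law \<equiv> distr M borel (X 1)"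

lemma prob_space_step_law: "prob_space step_law"
  by (intro prob_space_distr measurable_X) simp

lemma distr_steps:
  assumes I: "I \<noteq> {}" "I \<subseteq> {1..}"
  shows "distr M (Pi\<^sub>M I (\<lambda>_. borel)) (\<lambda>\<omega>. \<lambda>i\<in>I. X i \<omega>) = Pi\<^sub>M I (\<lambda>_. step_law)"
proof -
  have "indep_vars (\<lambda>_. borel) X I" using indep I(2) by (rule indep_vars_subset)
  then have "distr M (Pi\<^sub>M I (\<lambda>_. borel)) (\<lambda>\<omega>. \<lambda>i\<in>I. X i \<omega>) = (\<Pi>\<^sub>M i\<in>I. distr M borel (X i))"
    using I measurable_X by (subst (asm) indep_vars_iff_distr_eq_PiM') auto
  also have "\<dots> = Pi\<^sub>M I (\<lambda>_. step_law)"
    using I by (intro PiM_cong refl ident) auto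
  finally show ?thesis .
qed

text \<open>
  This covers both the shifts that give the segments between later times and the rotations.
\<close>

lemma distr_reindexed_steps:
  fixes \<pi> :: "nat \<Rightarrow> nat"
  assumes \<pi>: "inj_on \<pi> {1..}" "\<And>i. 1 \<le> i \<Longrightarrow> 1 \<le> \<pi> i"
  shows "distr M (Pi\<^sub>M {1..} (\<lambda>_. borel)) (\<lambda>\<omega>. \<lambda>i\<in>{1..}. X (\<pi> i) \<omega>) = Pi\<^sub>M {1..} (\<lambda>_. step_law)"
proof -
  let ?Q = "Pi\<^sub>M {1..} (\<lambda>_. borel) :: (nat \<Rightarrow> real) measure"
  have 1[measurable]: "(\<lambda>\<omega>. \<lambda>i\<in>{1..}. X i \<omega>) \<in> measurable M ?Q"
    using measurable_X by (intro measurable_restrict) auto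
  have 2[measurable]: "(\<lambda>x. \<lambda>i\<in>{1..}. x (\<pi> i) :: real) \<in> measurable ?Q ?Q"
    using \<pi> by (intro measurable_restrict measurable_component_singleton) auto
  have "distr M ?Q (\<lambda>\<omega>. \<lambda>i\<in>{1..}. X (\<pi> i) \<omega>) = distr (distr M ?Q (\<lambda>\<omega>. \<lambda>i\<in>{1..}. X i \<omega>)) ?Q (\<lambda>x. \<lambda>i\<in>{1..}. x (\<pi> i))"
  proof -
    have "(\<lambda>x. \<lambda>i\<in>{1..}. x (\<pi> i)) \<circ> (\<lambda>\<omega>. \<lambda>i\<in>{1..}. X i \<omega>) = (\<lambda>\<omega>. \<lambda>i\<in>{1..}. X (\<pi> i) \<omega>)"
      using \<pi>(2) by (auto simp: fun_eq_iff)
    then show ?thesis by (simp only: distr_distr[OF 2 1])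
  qed
  also have "\<dots> = distr (Pi\<^sub>M {1..} (\<lambda>_. step_law)) ?Q (\<lambda>x. \<lambda>i\<in>{1..}. x (\<pi> i))"
    by (subst distr_steps) auto
  also have "\<dots> = distr (Pi\<^sub>M {1..} (\<lambda>_. step_law)) (Pi\<^sub>M {1..} (\<lambda>_. step_law)) (\<lambda>x. \<lambda>i\<in>{1..}. x (\<pi> i))"
    by (intro distr_cong sets_PiM_cong) auto
  also have "\<dots> = Pi\<^sub>M {1..} (\<lambda>_. step_law)"
    using \<pi> prob_space_step_law by (intro distr_PiM_reindex) auto
  finally show ?thesis .
qed

lemma distr_reindexed_segment:
  fixes \<pi> :: "nat \<Rightarrow> nat"
  assumes \<pi>: "inj_on \<pi> {1..}" "\<And>i. 1 \<le> i \<Longrightarrow> 1 \<le> \<pi> i" and j: "1 \<le> j"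
  shows "distr M segment_space (\<lambda>\<omega>. segment (walk_of (\<lambda>i. X (\<pi> i) \<omega>)) 0 j)
    = distr M segment_space (\<lambda>\<omega>. segment (walk X \<omega>) 0 j)"
proof -
  let ?Q = "Pi\<^sub>M {1..} (\<lambda>_. borel) :: (nat \<Rightarrow> real) measure"
  have h: "(\<lambda>x. segment (walk_of x) 0 j) \<in> measurable ?Q segment_space"
    using j by (intro measurable_segment_walk_of measurable_component_singleton) auto
  have *: "distr M segment_space (\<lambda>\<omega>. segment (walk_of (\<lambda>i. X (\<pi> i) \<omega>)) 0 j)
      = distr (Pi\<^sub>M {1..} (\<lambda>_. step_law)) segment_space (\<lambda>x. segment (walk_of x) 0 j)"
    if \<pi>: "inj_on \<pi> {1..}" "\<And>i. 1 \<le> i \<Longrightarrow> 1 \<le> \<pi> i" for \<pi> :: "nat \<Rightarrow> nat"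
  proof -
    have m: "(\<lambda>\<omega>. \<lambda>i\<in>{1..}. X (\<pi> i) \<omega>) \<in> measurable M ?Q"
      using measurable_X \<pi>(2) by (intro measurable_restrict) auto
    have "segment (walk_of (\<lambda>i\<in>{1..}. x i)) 0 j = segment (walk_of x) 0 j" for x
      unfolding segment_def by (auto intro!: walk_of_cong)
    then have "(\<lambda>x. segment (walk_of x) 0 j) \<circ> (\<lambda>\<omega>. \<lambda>i\<in>{1..}. X (\<pi> i) \<omega>)
        = (\<lambda>\<omega>. segment (walk_of (\<lambda>i. X (\<pi> i) \<omega>)) 0 j)"
      by (simp add: comp_def)
    moreover have "distr (distr M ?Q (\<lambda>\<omega>. \<lambda>i\<in>{1..}. X (\<pi> i) \<omega>)) segment_space (\<lambda>x. segment (walk_of x) 0 j)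
        = distr M segment_space ((\<lambda>x. segment (walk_of x) 0 j) \<circ> (\<lambda>\<omega>. \<lambda>i\<in>{1..}. X (\<pi> i) \<omega>))"
      by (rule distr_distr[OF h m])
    ultimately show ?thesis
      by (simp only: distr_reindexed_steps[OF \<pi>])
  qed
  show ?thesis
    unfolding walk_eq_walk_of using *[OF \<pi>] *[of "\<lambda>i. i"] by simp
qed

definition segment_law :: "nat \<Rightarrow> real list measure" where
  "segment_law j = distr M segment_space (\<lambda>\<omega>. segment (walk X \<omega>) 0 j)"

lemma measurable_segment_walk: "1 \<le> j \<Longrightarrow> (\<lambda>\<omega>. segment (walk X \<omega>) t j) \<in> measurable M segment_space"
  unfolding walk_eq_walk_of using measurable_X by (intro measurable_segment_walk_of) auto

lemma sets_segment_law [simp, measurable_cong]: "sets (segment_law j) = sets segment_space"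
  by (simp add: segment_law_def)

lemma prob_space_segment_law: "1 \<le> j \<Longrightarrow> prob_space (segment_law j)"
  unfolding segment_law_def by (intro prob_space_distr measurable_segment_walk)

lemma distr_segment_walk:
  assumes "1 \<le> j"
  shows "distr M segment_space (\<lambda>\<omega>. segment (walk X \<omega>) t j) = segment_law j"
proof -
  have "segment (walk X \<omega>) t j = segment (walk_of (\<lambda>i. X (t + i) \<omega>)) 0 j" for \<omega>
    unfolding walk_eq_walk_of by (rule segment_walk_of_shift)
  then show ?thesis
    using assms unfolding segment_law_def by (simp add: distr_reindexed_segment)
qed

lemma indep_vars_segments:
  assumes l: "\<And>i. i < f \<Longrightarrow> 1 \<le> l i"
  shows "indep_vars (\<lambda>_. segment_space) (\<lambda>i \<omega>. segment (walk X \<omega>) (partial_sum l i) (l i)) {..<f}"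
proof -
  define K where "K i = {partial_sum l i<..partial_sum l (Suc i)}" for i
  have disj: "disjoint_family_on K {..<f}"
    unfolding disjoint_family_on_def
  proof safe
    fix i j k assume "i \<noteq> j" "k \<in> K i" "k \<in> K j"
    then show "k \<in> {}"
      using partial_sum_mono[of "Suc i" j l] partial_sum_mono[of "Suc j" i l]
      by (cases i j rule: linorder_cases) (auto simp: K_def simp del: partial_sum_Suc)
  qed
  have "indep_vars (\<lambda>i. Pi\<^sub>M (K i) (\<lambda>_. borel)) (\<lambda>i \<omega>. restrict (\<lambda>i. X i \<omega>) (K i)) {..<f}"
    by (intro indep_vars_restrict[OF indep _ disj]) (auto simp: K_def)
  then have "indep_vars (\<lambda>_. segment_space)
      (\<lambda>i \<omega>. (\<lambda>x. segment (walk_of x) (partial_sum l i) (l i)) (restrict (\<lambda>i. X i \<omega>) (K i))) {..<f}"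
    by (rule indep_vars_compose2[where Y="\<lambda>i x. segment (walk_of x) (partial_sum l i) (l i)"])
      (use l in \<open>auto simp: K_def intro!: measurable_segment_walk_of measurable_component_singleton\<close>)
  moreover have "segment (walk_of (restrict x (K i))) (partial_sum l i) (l i) = segment (walk_of x) (partial_sum l i) (l i)" for x i
    unfolding segment_def walk_of_add by (auto intro!: walk_of_cong simp: K_def)
  ultimately show ?thesis
    by (simp add: walk_eq_walk_of)
qed

lemma distr_segments:
  assumes l: "\<And>i. i < f \<Longrightarrow> 1 \<le> l i"
  shows "distr M (Pi\<^sub>M {..<f} (\<lambda>_. segment_space)) (\<lambda>\<omega>. \<lambda>i\<in>{..<f}. segment (walk X \<omega>) (partial_sum l i) (l i))
    = Pi\<^sub>M {..<f} (\<lambda>i. segment_law (l i))"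
proof (cases "f = 0")
  case True
  \<comment> \<open>Both sides are the unit mass at the empty tuple.\<close>
  show ?thesis
  proof (rule measure_eqI)
    fix A assume "A \<in> sets (distr M (Pi\<^sub>M {..<f} (\<lambda>_. segment_space)) (\<lambda>\<omega>. \<lambda>i\<in>{..<f}. segment (walk X \<omega>) (partial_sum l i) (l i)))"
    then have "A = {} \<or> A = {\<lambda>_. undefined}" "A \<in> sets (Pi\<^sub>M {} (\<lambda>_. segment_space))"
      using True by (auto simp: sets_PiM_empty)
    then show "emeasure (distr M (Pi\<^sub>M {..<f} (\<lambda>_. segment_space)) (\<lambda>\<omega>. \<lambda>i\<in>{..<f}. segment (walk X \<omega>) (partial_sum l i) (l i))) A
        = emeasure (Pi\<^sub>M {..<f} (\<lambda>i. segment_law (l i))) A"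
      using True by (auto simp: emeasure_distr restrict_def emeasure_space_1)
  qed (simp add: True sets_PiM_empty)
next
  case False
  have "distr M (Pi\<^sub>M {..<f} (\<lambda>_. segment_space)) (\<lambda>\<omega>. \<lambda>i\<in>{..<f}. segment (walk X \<omega>) (partial_sum l i) (l i))
      = (\<Pi>\<^sub>M i\<in>{..<f}. distr M segment_space (\<lambda>\<omega>. segment (walk X \<omega>) (partial_sum l i) (l i)))"
  proof (rule indep_vars_iff_distr_eq_PiM'[THEN iffD1])
    show "indep_vars (\<lambda>_. segment_space) (\<lambda>i \<omega>. segment (walk X \<omega>) (partial_sum l i) (l i)) {..<f}"
      using l by (rule indep_vars_segments)
    show "(\<lambda>\<omega>. segment (walk X \<omega>) (partial_sum l i) (l i)) \<in> measurable M segment_space" if "i \<in> {..<f}" for i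
      using l that by (intro measurable_segment_walk) auto
  qed (use False in auto)
  also have "\<dots> = Pi\<^sub>M {..<f} (\<lambda>i. segment_law (l i))"
    using l by (intro PiM_cong refl distr_segment_walk) auto
  finally show ?thesis .
qed

text \<open>
  Given all steps but one that occurs with nonzero coefficient, the equation prescribes the value
  of that step, and the step law has no atoms.
\<close>

lemma linear_combination_atomless:
  assumes I: "finite I" "I \<subseteq> {1..}" "i \<in> I" "a i \<noteq> 0"
  shows "emeasure M {\<omega> \<in> space M. (\<Sum>k\<in>I. a k * X k \<omega>) = c} = 0"
proof -
  interpret step: prob_space step_law by (rule prob_space_step_law)
  interpret product_sigma_finite "\<lambda>_::nat. step_law"
    unfolding product_sigma_finite_def using step.sigma_finite_measure_axioms by blast
  let ?I = "I - {i}"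
  let ?P = "Pi\<^sub>M I (\<lambda>_. step_law)"
  let ?B = "{x \<in> space ?P. (\<Sum>k\<in>I. a k * x k) = c}"
  have II: "insert i ?I = I" using I by auto
  have m: "(\<lambda>\<omega>. \<lambda>k\<in>I. X k \<omega>) \<in> measurable M (Pi\<^sub>M I (\<lambda>_. borel))"
    using I measurable_X by (intro measurable_restrict) auto
  have sets_P: "sets ?P = sets (Pi\<^sub>M I (\<lambda>_. borel))"
    by (intro sets_PiM_cong) simp_all
  have "(\<lambda>x. \<Sum>k\<in>I. a k * x k) \<in> borel_measurable (Pi\<^sub>M I (\<lambda>_. borel))"
    by (intro borel_measurable_sum borel_measurable_times measurable_component_singleton) simp_all
  then have "(\<lambda>x. \<Sum>k\<in>I. a k * x k) \<in> borel_measurable ?P"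
    by (simp only: measurable_cong_sets[OF sets_P refl])
  then have B: "?B \<in> sets ?P"
    by (rule borel_measurable_eq) simp
  have "emeasure ?P ?B = (\<integral>\<^sup>+x. indicator ?B x \<partial>?P)"
    using B by (rule nn_integral_indicator[symmetric])
  also have "\<dots> = (\<integral>\<^sup>+x. (\<integral>\<^sup>+y. indicator ?B (x(i := y)) \<partial>step_law) \<partial>Pi\<^sub>M ?I (\<lambda>_. step_law))"
  proof (rule product_nn_integral_insert[of ?I i, unfolded II])
    show "indicator ?B \<in> borel_measurable ?P" using B by (rule borel_measurable_indicator)
  qed (use I in auto)
  also have "\<dots> = (\<integral>\<^sup>+x. 0 \<partial>Pi\<^sub>M ?I (\<lambda>_. step_law))"
  proof (rule nn_integral_cong)
    fix x
    have "(\<integral>\<^sup>+y. indicator ?B (x(i := y)) \<partial>step_law)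
        \<le> (\<integral>\<^sup>+y. indicator {(c - (\<Sum>k\<in>?I. a k * x k)) / a i} y \<partial>step_law)"
    proof (rule nn_integral_mono)
      fix y
      have "(\<Sum>k\<in>I. a k * (x(i := y)) k) = a i * y + (\<Sum>k\<in>?I. a k * x k)"
        using I by (subst sum.remove[of I i]) auto
      then show "indicator ?B (x(i := y)) \<le> (indicator {(c - (\<Sum>k\<in>?I. a k * x k)) / a i} y :: ennreal)"
        using I(4) by (auto simp: indicator_def field_simps)
    qed
    also have "\<dots> = 0" using atomless by simp
    finally show "(\<integral>\<^sup>+y. indicator ?B (x(i := y)) \<partial>step_law) = 0" by simp
  qed
  finally have "emeasure ?P ?B = 0" by simp
  moreover have "?P = distr M (Pi\<^sub>M I (\<lambda>_. borel)) (\<lambda>\<omega>. \<lambda>k\<in>I. X k \<omega>)"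
    using I by (intro distr_steps[symmetric]) auto
  then have "emeasure ?P ?B = emeasure M ((\<lambda>\<omega>. \<lambda>k\<in>I. X k \<omega>) -` ?B \<inter> space M)"
    using emeasure_distr[OF m, of ?B] B unfolding sets_P by (simp only:)
  moreover have "(\<lambda>\<omega>. \<lambda>k\<in>I. X k \<omega>) -` ?B \<inter> space M = {\<omega> \<in> space M. (\<Sum>k\<in>I. a k * X k \<omega>) = c}"
    by (auto simp: space_PiM)
  ultimately show ?thesis by simp
qed

end

lemma density_PiM:
  assumes I: "finite I" and M: "\<And>i. sigma_finite_measure (M i)"
    and d: "\<And>i. d i \<in> borel_measurable (M i)" and dM: "\<And>i. sigma_finite_measure (density (M i) (d i))"
  shows "Pi\<^sub>M I (\<lambda>i. density (M i) (d i)) = density (Pi\<^sub>M I M) (\<lambda>x. \<Prod>i\<in>I. d i (x i))"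
proof -
  interpret M: product_sigma_finite M using M by (simp add: product_sigma_finite_def)
  interpret D: product_sigma_finite "\<lambda>i. density (M i) (d i)" using dM by (simp add: product_sigma_finite_def)
  have m: "(\<lambda>x. \<Prod>i\<in>I. d i (x i)) \<in> borel_measurable (Pi\<^sub>M I M)"
    using d by (intro borel_measurable_prod_ennreal measurable_compose[OF _ d] measurable_component_singleton)
  show ?thesis
  proof (rule D.PiM_eqI[OF I, symmetric])
    show "sets (density (Pi\<^sub>M I M) (\<lambda>x. \<Prod>i\<in>I. d i (x i))) = sets (Pi\<^sub>M I (\<lambda>i. density (M i) (d i)))"
      by (simp cong: sets_PiM_cong)
    fix A assume A: "\<And>i. i \<in> I \<Longrightarrow> A i \<in> sets (density (M i) (d i))"
    then have A': "\<And>i. i \<in> I \<Longrightarrow> A i \<in> sets (M i)" by simp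
    then have box: "Pi\<^sub>E I A \<in> sets (Pi\<^sub>M I M)" using I by (intro sets_PiM_I_finite) auto
    have ind: "indicator (Pi\<^sub>E I A) x = (\<Prod>i\<in>I. indicator (A i) (x i) :: ennreal)" if x: "x \<in> space (Pi\<^sub>M I M)" for x
    proof (cases "x \<in> Pi\<^sub>E I A")
      case False
      then obtain i where "i \<in> I" "x i \<notin> A i" using x unfolding space_PiM PiE_iff by blast
      then have "(\<Prod>i\<in>I. indicator (A i) (x i) :: ennreal) = 0" using I by (intro prod_zero bexI[of _ i]) auto
      then show ?thesis using False by simp
    qed (simp add: PiE_iff)
    have "emeasure (density (Pi\<^sub>M I M) (\<lambda>x. \<Prod>i\<in>I. d i (x i))) (Pi\<^sub>E I A)
        = (\<integral>\<^sup>+x. (\<Prod>i\<in>I. d i (x i)) * indicator (Pi\<^sub>E I A) x \<partial>Pi\<^sub>M I M)"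
      using m box by (rule emeasure_density)
    also have "\<dots> = (\<integral>\<^sup>+x. (\<Prod>i\<in>I. d i (x i) * indicator (A i) (x i)) \<partial>Pi\<^sub>M I M)"
      by (intro nn_integral_cong) (simp add: ind prod.distrib)
    also have "\<dots> = (\<Prod>i\<in>I. \<integral>\<^sup>+y. d i y * indicator (A i) y \<partial>M i)"
      using d A' by (intro M.product_nn_integral_prod I borel_measurable_times_ennreal borel_measurable_indicator)
    also have "\<dots> = (\<Prod>i\<in>I. emeasure (density (M i) (d i)) (A i))"
      using d A' by (intro prod.cong refl emeasure_density[symmetric])
    finally show "emeasure (density (Pi\<^sub>M I M) (\<lambda>x. \<Prod>i\<in>I. d i (x i))) (Pi\<^sub>E I A)
        = (\<Prod>i\<in>I. emeasure (density (M i) (d i)) (A i))" .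
  qed
qed

lemma map_walk_eq_segment: "map (walk X \<omega>) [1..<Suc j] = segment (walk X \<omega>) 0 j"
  by (simp add: segment_def walk_def)

context iid_sequence
begin

lemma measurable_walk: "(\<lambda>\<omega>. walk X \<omega> j) \<in> borel_measurable M"
  unfolding walk_eq_walk_of using measurable_X by (intro measurable_walk_of)

lemma walk_atomless:
  assumes "1 \<le> j"
  shows "emeasure M {\<omega> \<in> space M. walk X \<omega> j = c} = 0"
proof -
  have "emeasure M {\<omega> \<in> space M. (\<Sum>k\<in>{1..j}. 1 * X k \<omega>) = c} = 0"
    using assms by (intro linear_combination_atomless[of _ 1]) auto
  then show ?thesis by (simp add: walk_def)
qed

text \<open>
  A tie between two times is a linear equation for the steps in which the coefficient of the step
  at the later time is positive.
\<close>

lemma AE_inj_on_excess: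
  assumes "1 \<le> j"
  shows "AE \<omega> in M. inj_on (excess (\<lambda>i. X i \<omega>) j) {..<j}"
proof -
  have ae: "AE \<omega> in M. m < m' \<longrightarrow> excess (\<lambda>i. X i \<omega>) j m \<noteq> excess (\<lambda>i. X i \<omega>) j m'"
    if m': "m' < j" for m m'
  proof (cases "m < m'")
    case True
    \<comment> \<open>the coefficient of step \<open>i\<close> in the difference of the excesses at \<open>m'\<close> and \<open>m\<close>\<close>
    define a where "a i = of_bool (m < i \<and> i \<le> m') - (real m' - real m) / real j" for i
    have eq: "(\<Sum>i\<in>{1..j}. a i * x i) = excess x j m' - excess x j m" for x
    proof -
      have "walk_of x m' - walk_of x m = (\<Sum>i\<in>{m<..m'}. x i)"
        using True sum.ub_add_nat[of 1 m x "m' - m"] unfolding walk_of_def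
        by (simp add: atLeastSucAtMost_greaterThanAtMost)
      also have "\<dots> = (\<Sum>i\<in>{1..j}. of_bool (m < i \<and> i \<le> m') * x i)"
        using m' by (intro sum.mono_neutral_cong_left) auto
      finally have w: "(\<Sum>i\<in>{1..j}. of_bool (m < i \<and> i \<le> m') * x i) = walk_of x m' - walk_of x m" by simp
      have "(\<Sum>i\<in>{1..j}. a i * x i) = (\<Sum>i\<in>{1..j}. of_bool (m < i \<and> i \<le> m') * x i)
          - (real m' - real m) / real j * walk_of x j"
        unfolding a_def walk_of_def by (simp only: left_diff_distrib sum_subtractf sum_distrib_left)
      then show ?thesis
        unfolding w by (simp add: excess_def algebra_simps diff_divide_distrib)
    qed
    have "a m' \<noteq> 0"
      using True m' by (simp add: a_def field_simps)
    then have "emeasure M {\<omega> \<in> space M. (\<Sum>i\<in>{1..j}. a i * X i \<omega>) = 0} = 0"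
      using True m' by (intro linear_combination_atomless[of _ m']) auto
    moreover have "(\<lambda>\<omega>. \<Sum>i\<in>{1..j}. a i * X i \<omega>) \<in> borel_measurable M"
      using measurable_X by (intro borel_measurable_sum borel_measurable_times) auto
    then have "{\<omega> \<in> space M. (\<Sum>i\<in>{1..j}. a i * X i \<omega>) = 0} \<in> events"
      by (rule borel_measurable_eq) simp
    ultimately have "AE \<omega> in M. (\<Sum>i\<in>{1..j}. a i * X i \<omega>) \<noteq> 0"
      by (intro AE_I'[of "{\<omega> \<in> space M. (\<Sum>i\<in>{1..j}. a i * X i \<omega>) = 0}"]) (auto simp: null_sets_def)
    then have "AE \<omega> in M. excess (\<lambda>i. X i \<omega>) j m' - excess (\<lambda>i. X i \<omega>) j m \<noteq> 0"
      unfolding eq .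
    then show ?thesis
      by eventually_elim simp
  qed simp
  have "AE \<omega> in M. \<forall>m'\<in>{..<j}. \<forall>m\<in>{..<j}. m < m' \<longrightarrow> excess (\<lambda>i. X i \<omega>) j m \<noteq> excess (\<lambda>i. X i \<omega>) j m'"
    using ae by (intro AE_finite_allI) auto
  then show ?thesis
  proof eventually_elim
    case (elim \<omega>)
    then show ?case
      by (intro linorder_inj_onI) auto
  qed
qed

text \<open>
  The \<open>j\<close> events that the path rotated by \<open>r\<close> is below its chord, for \<open>r < j\<close>, are disjoint; they
  have the same probability since rotations preserve the law of the steps and the value at time
  \<open>j\<close>; and one of them happens as soon as the excess over the chord has a unique maximum.
\<close>

lemma cyclic_lemma:
  assumes j: "1 \<le> j" and A: "A \<in> sets borel"
  shows "real j * prob {\<omega> \<in> space M. strictly_below_chord (segment (walk X \<omega>) 0 j) \<and> walk X \<omega> j \<in> A}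
    = prob {\<omega> \<in> space M. walk X \<omega> j \<in> A}"
proof -
  define B where "B = {xs \<in> space segment_space. strictly_below_chord xs \<and> last xs \<in> A}"
  have B: "B \<in> sets segment_space"
    unfolding B_def using A by measurable
  let ?Y = "\<lambda>r \<omega>. walk_of (\<lambda>i. X (rotate_index j r i) \<omega>)"
  define E where "E r = {\<omega> \<in> space M. segment (?Y r \<omega>) 0 j \<in> B}" for r
  have inB: "segment (walk_of x) 0 j \<in> B \<longleftrightarrow> strictly_below_chord (segment (walk_of x) 0 j) \<and> walk_of x j \<in> A" for x
    using j segment_in_space[of j "walk_of x" 0] by (simp add: B_def last_segment)
  have E_eq: "E r = {\<omega> \<in> space M. (\<forall>m<j. m \<noteq> r \<longrightarrow> excess (\<lambda>i. X i \<omega>) j m < excess (\<lambda>i. X i \<omega>) j r) \<and> walk X \<omega> j \<in> A}"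
    if "r < j" for r
    unfolding E_def inB walk_eq_walk_of
    using strictly_below_chord_rotate[OF j that, of "\<lambda>i. X i \<omega>" for \<omega>]
      walk_of_rotate[OF j that, of "\<lambda>i. X i \<omega>" for \<omega>]
    by simp
  have mY: "(\<lambda>\<omega>. segment (?Y r \<omega>) 0 j) \<in> measurable M segment_space" for r
    using j measurable_X rotate_index_pos by (intro measurable_segment_walk_of) auto
  have E_sets: "E r \<in> events" for r
    unfolding E_def using mY B by measurable
  have "prob (E r) = prob {\<omega> \<in> space M. segment (walk X \<omega>) 0 j \<in> B}" for r
  proof -
    have "prob (E r) = measure (distr M segment_space (\<lambda>\<omega>. segment (?Y r \<omega>) 0 j)) B"
      using measure_distr[OF mY B] by (simp add: E_def vimage_def Int_def conj_commute)
    also have "distr M segment_space (\<lambda>\<omega>. segment (?Y r \<omega>) 0 j) = distr M segment_space (\<lambda>\<omega>. segment (walk X \<omega>) 0 j)"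
      using j by (intro distr_reindexed_segment inj_on_rotate_index rotate_index_pos)
    also have "measure \<dots> B = prob {\<omega> \<in> space M. segment (walk X \<omega>) 0 j \<in> B}"
      using measure_distr[OF measurable_segment_walk[OF j] B] by (simp add: vimage_def Int_def conj_commute)
    finally show ?thesis .
  qed
  then have "(\<Sum>r<j. prob (E r)) = real j * prob {\<omega> \<in> space M. segment (walk X \<omega>) 0 j \<in> B}"
    by simp
  moreover have "(\<Sum>r<j. prob (E r)) = prob (\<Union>r\<in>{..<j}. E r)"
  proof (rule finite_measure_finite_Union[symmetric])
    show "disjoint_family_on E {..<j}"
      unfolding disjoint_family_on_def
    proof (intro ballI impI)
      fix r r' assume "r \<in> {..<j}" "r' \<in> {..<j}" "r \<noteq> r'"
      then show "E r \<inter> E r' = {}"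
        using E_eq[of r] E_eq[of r'] by (auto dest: less_asym)
    qed
  qed (use E_sets in auto)
  moreover have "prob (\<Union>r\<in>{..<j}. E r) = prob {\<omega> \<in> space M. walk X \<omega> j \<in> A}"
  proof (rule measure_eq_AE)
    show "AE \<omega> in M. \<omega> \<in> (\<Union>r\<in>{..<j}. E r) \<longleftrightarrow> \<omega> \<in> {\<omega> \<in> space M. walk X \<omega> j \<in> A}"
      using AE_inj_on_excess[OF j]
    proof eventually_elim
      fix \<omega> assume inj: "inj_on (excess (\<lambda>i. X i \<omega>) j) {..<j}"
      let ?D = "excess (\<lambda>i. X i \<omega>) j"
      have "?D ` {..<j} \<noteq> {}" using j by (auto simp: lessThan_empty_iff)
      then have "Max (?D ` {..<j}) \<in> ?D ` {..<j}" by (intro Max_in) auto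
      then obtain r where r: "r < j" "?D r = Max (?D ` {..<j})" by auto
      have "?D m < ?D r" if "m < j" "m \<noteq> r" for m
      proof -
        have "?D m \<le> ?D r" unfolding r(2) using that by (intro Max_ge) auto
        moreover have "?D m \<noteq> ?D r" using inj_onD[OF inj, of m r] that r(1) by auto
        ultimately show ?thesis by simp
      qed
      then have "\<omega> \<in> E r \<longleftrightarrow> \<omega> \<in> {\<omega> \<in> space M. walk X \<omega> j \<in> A}"
        using r(1) by (auto simp: E_eq)
      then show "\<omega> \<in> (\<Union>r\<in>{..<j}. E r) \<longleftrightarrow> \<omega> \<in> {\<omega> \<in> space M. walk X \<omega> j \<in> A}"
        using r(1) by (auto simp: E_eq)
    qed
    show "{\<omega> \<in> space M. walk X \<omega> j \<in> A} \<in> events"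
      using measurable_walk A by measurable
  qed (use E_sets in auto)
  ultimately show ?thesis
    by (simp add: inB walk_eq_walk_of)
qed

lemma below_chord_eq:
  "1 \<le> j \<Longrightarrow> below_chord M X j = {\<omega> \<in> space M. strictly_below_chord (segment (walk X \<omega>) 0 j)}"
  unfolding below_chord_def walk_eq_walk_of by (auto simp: strictly_below_chord_walk_of)

lemma prob_below_chord:
  assumes "1 \<le> j"
  shows "prob (below_chord M X j) = 1 / real j"
  using cyclic_lemma[OF assms, of UNIV] assms by (simp add: below_chord_eq prob_space field_simps)

lemma below_chord_in_events: "1 \<le> j \<Longrightarrow> below_chord M X j \<in> events"
  unfolding below_chord_eq using measurable_segment_walk[of j 0] by measurable

end

section \<open>The intensity measure on segments\<close>

context iid_sequence
begin

lemma emeasure_segment_law: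
  assumes "1 \<le> j" "A \<in> sets segment_space"
  shows "emeasure (segment_law j) A = emeasure M {\<omega> \<in> space M. segment (walk X \<omega>) 0 j \<in> A}"
  unfolding segment_law_def using emeasure_distr[OF measurable_segment_walk[OF assms(1)] assms(2), of 0]
  by (simp add: vimage_def Int_def conj_commute)

lemma below_set_in_sets: "{xs \<in> space segment_space. strictly_below_chord xs} \<in> sets segment_space"
  by measurable

definition conditioned_law :: "nat \<Rightarrow> real list measure" where
  "conditioned_law j = distr (uniform_measure M (below_chord M X j)) segment_space
     (\<lambda>\<omega>. map (walk X \<omega>) [1..<Suc j])"

text \<open>
  Conditioning divides by the probability \<open>1/j\<close> of staying below the chord.
\<close>

lemma emeasure_conditioned_law:
  assumes j: "1 \<le> j" and A: "A \<in> sets segment_space"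
  shows "emeasure (conditioned_law j) A
    = ennreal (real j) * emeasure (segment_law j) (A \<inter> {xs \<in> space segment_space. strictly_below_chord xs})"
proof -
  have m: "(\<lambda>\<omega>. segment (walk X \<omega>) 0 j) \<in> measurable (uniform_measure M (below_chord M X j)) segment_space"
    using measurable_segment_walk[OF j] by (simp cong: measurable_cong_sets)
  have "emeasure (conditioned_law j) A
      = emeasure (uniform_measure M (below_chord M X j)) {\<omega> \<in> space M. segment (walk X \<omega>) 0 j \<in> A}"
    unfolding conditioned_law_def map_walk_eq_segment emeasure_distr[OF m A]
    by (simp add: vimage_def Int_def conj_commute)
  also have "\<dots> = emeasure M (below_chord M X j \<inter> {\<omega> \<in> space M. segment (walk X \<omega>) 0 j \<in> A})
      / emeasure M (below_chord M X j)"
    using measurable_sets[OF measurable_segment_walk[OF j, of 0] A] below_chord_in_events[OF j]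
    by (intro emeasure_uniform_measure) (simp_all add: vimage_def Int_def conj_commute)
  also have "emeasure M (below_chord M X j) = ennreal (1 / real j)"
    using j by (simp add: emeasure_eq_measure prob_below_chord del: One_nat_def)
  also have "below_chord M X j \<inter> {\<omega> \<in> space M. segment (walk X \<omega>) 0 j \<in> A}
      = {\<omega> \<in> space M. segment (walk X \<omega>) 0 j \<in> A \<inter> {xs \<in> space segment_space. strictly_below_chord xs}}"
    using j segment_in_space[of j] by (auto simp: below_chord_eq)
  also have "emeasure M \<dots> = emeasure (segment_law j) (A \<inter> {xs \<in> space segment_space. strictly_below_chord xs})"
    using A below_set_in_sets by (intro emeasure_segment_law[OF j, symmetric]) auto
  finally show ?thesis
    using j by (simp add: divide_ennreal_def inverse_ennreal mult.commute)
qed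

lemma prob_space_conditioned_law:
  assumes j: "1 \<le> j"
  shows "prob_space (conditioned_law j)"
proof -
  have "emeasure M (below_chord M X j) \<noteq> 0"
    using j by (simp add: emeasure_eq_measure prob_below_chord del: One_nat_def)
  then have "prob_space (uniform_measure M (below_chord M X j))"
    by (intro prob_space_uniform_measure) auto
  moreover have "(\<lambda>\<omega>. segment (walk X \<omega>) 0 j) \<in> measurable (uniform_measure M (below_chord M X j)) segment_space"
    using measurable_segment_walk[OF j] by (simp cong: measurable_cong_sets)
  ultimately show ?thesis
    unfolding conditioned_law_def map_walk_eq_segment by (rule prob_space.prob_space_distr)
qed

end

locale weighted_iid_sequence = iid_sequence +
  fixes q :: real
  assumes q: "0 < q" "q < 1"
begin

abbreviation "\<nu> \<equiv> segment_intensity M X q"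
abbreviation "below \<equiv> {xs \<in> space segment_space. strictly_below_chord xs}"

lemma space_length_intensity: "space (length_intensity q) = {1..}"
  by (simp add: length_intensity_def)

lemma measurable_length_intensity:
  assumes "\<And>j. 1 \<le> j \<Longrightarrow> prob_space (K j)" "\<And>j. sets (K j) = sets S"
  shows "K \<in> measurable (length_intensity q) (subprob_algebra S)"
proof -
  have "K j \<in> space (subprob_algebra S)" if "1 \<le> j" for j
    using assms that by (auto simp: space_subprob_algebra intro: prob_space_imp_subprob_space)
  then show ?thesis
    by (auto simp: measurable_def length_intensity_def)
qed

lemma emeasure_bind_length_intensity:
  assumes "\<And>j. 1 \<le> j \<Longrightarrow> prob_space (K j)" "\<And>j. sets (K j) = sets S" "A \<in> sets S"
  shows "emeasure (bind (length_intensity q) K) A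
    = (\<integral>\<^sup>+j. ennreal (q ^ j / real j) * emeasure (K j) A \<partial>count_space {1..})"
  using emeasure_bind[OF _ measurable_length_intensity[OF assms(1,2)] assms(3)]
  by (simp add: space_length_intensity length_intensity_def nn_integral_density)

lemma segment_intensity_eq: "\<nu> = bind (length_intensity q) conditioned_law"
  unfolding segment_intensity_def conditioned_law_def by (rule refl)

lemma sets_conditioned_law [simp]: "sets (conditioned_law j) = sets segment_space"
  by (simp add: conditioned_law_def)

lemma sets_segment_intensity [simp, measurable_cong]: "sets \<nu> = sets segment_space"
  unfolding segment_intensity_eq by (rule sets_bind) (auto simp: space_length_intensity)

lemma space_segment_intensity [simp]: "space \<nu> = space segment_space"
  by (rule sets_eq_imp_space_eq) simp

lemma emeasure_segment_intensity:
  assumes A: "A \<in> sets segment_space"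
  shows "emeasure \<nu> A = (\<integral>\<^sup>+j. ennreal (q ^ j) * emeasure (segment_law j) (A \<inter> below) \<partial>count_space {1..})"
proof -
  have "emeasure \<nu> A = (\<integral>\<^sup>+j. ennreal (q ^ j / real j) * emeasure (conditioned_law j) A \<partial>count_space {1..})"
    unfolding segment_intensity_eq using A
    by (intro emeasure_bind_length_intensity prob_space_conditioned_law) auto
  also have "\<dots> = (\<integral>\<^sup>+j. ennreal (q ^ j) * emeasure (segment_law j) (A \<inter> below) \<partial>count_space {1..})"
  proof (rule nn_integral_cong)
    fix j assume "j \<in> space (count_space {1::nat..})"
    then have j: "1 \<le> j" by simp
    have "ennreal (q ^ j / real j) * (ennreal (real j) * x) = ennreal (q ^ j) * x" for x
      using j q by (simp add: mult.assoc[symmetric] ennreal_mult[symmetric])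
    then show "ennreal (q ^ j / real j) * emeasure (conditioned_law j) A
        = ennreal (q ^ j) * emeasure (segment_law j) (A \<inter> below)"
      by (simp only: emeasure_conditioned_law[OF j A])
  qed
  finally show ?thesis .
qed

lemma emeasure_segment_intensity_space: "emeasure \<nu> (space segment_space) = ennreal (- ln (1 - q))"
proof -
  have "emeasure \<nu> (space segment_space) = (\<integral>\<^sup>+j. ennreal (q ^ j / real j) * emeasure (conditioned_law j) (space segment_space) \<partial>count_space {1..})"
    unfolding segment_intensity_eq
    by (intro emeasure_bind_length_intensity prob_space_conditioned_law) auto
  also have "\<dots> = (\<integral>\<^sup>+j. ennreal (q ^ j / real j) \<partial>count_space {1..})"
  proof (rule nn_integral_cong)
    fix j assume "j \<in> space (count_space {1::nat..})"
    then interpret K: prob_space "conditioned_law j" by (intro prob_space_conditioned_law) simp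
    have "space (conditioned_law j) = space segment_space" by (simp add: conditioned_law_def)
    then show "ennreal (q ^ j / real j) * emeasure (conditioned_law j) (space segment_space) = ennreal (q ^ j / real j)"
      using K.emeasure_space_1 by simp
  qed
  also have "\<dots> = (\<integral>\<^sup>+j. ennreal (q ^ j / real j) * indicator {1..} j \<partial>count_space UNIV)"
    by (subst nn_integral_count_space_indicator) auto
  also have "\<dots> = (\<integral>\<^sup>+j. ennreal (q ^ j / real j) \<partial>count_space UNIV)"
    by (intro nn_integral_cong) (auto simp: indicator_def not_le)
  also have "\<dots> = (\<Sum>j. ennreal (q ^ j / real j))"
    by (rule nn_integral_count_space_nat)
  also have "\<dots> = ennreal (- ln (1 - q))"
  proof -
    have "(\<lambda>j. - ((- (- q)) ^ j) / of_nat j) sums ln (1 + - q)"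
      using q by (intro ln_series') auto
    then have "(\<lambda>j. q ^ j / real j) sums (- ln (1 - q))"
      using sums_minus by fastforce
    then show ?thesis
      using q by (intro sums_unique[symmetric] sums_ennreal[THEN iffD2]) (auto simp: ln_le_zero_iff)
  qed
  finally show ?thesis .
qed

lemma finite_measure_segment_intensity: "finite_measure \<nu>"
  by (rule finite_measureI) (simp add: emeasure_segment_intensity_space)

lemma exp_segment_intensity: "exp (- measure \<nu> (space \<nu>)) = 1 - q"
proof -
  have "measure \<nu> (space \<nu>) = - ln (1 - q)"
    using q by (simp add: measure_def emeasure_segment_intensity_space ln_le_zero_iff)
  then show ?thesis using q by simp
qed

text \<open>
  The factor \<open>1/j\<close> on the right comes from the cyclic lemma, which removes the restriction to
  paths below the chord.
\<close>

lemma emeasure_segment_law_face: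
  assumes "1 \<le> j" and A: "A \<in> sets face_space"
  shows "ennreal (q ^ j) * emeasure (segment_law j) ((face_of_segment -` A \<inter> space segment_space) \<inter> below)
    = ennreal (q ^ j / real j) * emeasure (distr M face_space (\<lambda>\<omega>. (j, walk X \<omega> j))) A"
proof -
  have mp: "(\<lambda>x. (j, x)) \<in> measurable borel face_space"
    unfolding face_space_def using assms(1) by (intro measurable_Pair) auto
  define B where "B = (\<lambda>x. (j, x)) -` A"
  have B: "B \<in> sets borel" using measurable_sets[OF mp A] by (simp add: B_def)
  have mw: "(\<lambda>\<omega>. (j, walk X \<omega> j)) \<in> measurable M face_space"
    using measurable_compose[OF measurable_walk mp] .
  have C: "(face_of_segment -` A \<inter> space segment_space) \<inter> below \<in> sets segment_space"
    using measurable_sets[OF measurable_face_of_segment A] below_set_in_sets by auto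
  have "walk X \<omega> 0 = 0" for \<omega> by (simp add: walk_def)
  then have "emeasure (segment_law j) ((face_of_segment -` A \<inter> space segment_space) \<inter> below)
      = emeasure M {\<omega> \<in> space M. strictly_below_chord (segment (walk X \<omega>) 0 j) \<and> walk X \<omega> j \<in> B}"
    unfolding emeasure_segment_law[OF assms(1) C] using assms(1) segment_in_space[of j]
    by (intro arg_cong[of _ _ "emeasure M"]) (auto simp: face_of_segment_segment B_def)
  also have "\<dots> = ennreal (prob {\<omega> \<in> space M. strictly_below_chord (segment (walk X \<omega>) 0 j) \<and> walk X \<omega> j \<in> B})"
    by (rule emeasure_eq_measure)
  also have "prob {\<omega> \<in> space M. strictly_below_chord (segment (walk X \<omega>) 0 j) \<and> walk X \<omega> j \<in> B}
      = prob {\<omega> \<in> space M. walk X \<omega> j \<in> B} / real j"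
    using cyclic_lemma[OF assms(1) B] assms(1) by (simp add: field_simps)
  finally have 1: "emeasure (segment_law j) ((face_of_segment -` A \<inter> space segment_space) \<inter> below)
      = ennreal (prob {\<omega> \<in> space M. walk X \<omega> j \<in> B} / real j)" .
  have "emeasure (distr M face_space (\<lambda>\<omega>. (j, walk X \<omega> j))) A = emeasure M {\<omega> \<in> space M. walk X \<omega> j \<in> B}"
    unfolding emeasure_distr[OF mw A] by (intro arg_cong[of _ _ "emeasure M"]) (auto simp: B_def)
  then have 2: "emeasure (distr M face_space (\<lambda>\<omega>. (j, walk X \<omega> j))) A = ennreal (prob {\<omega> \<in> space M. walk X \<omega> j \<in> B})"
    by (simp add: emeasure_eq_measure)
  show ?thesis
    unfolding 1 2 using q by (simp add: ennreal_mult[symmetric])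
qed

lemma face_intensity_eq_distr: "face_intensity M X q = distr \<nu> face_space face_of_segment"
proof (rule measure_eqI)
  let ?K = "\<lambda>j. distr M face_space (\<lambda>\<omega>. (j, walk X \<omega> j))"
  have K: "prob_space (?K j)" if "1 \<le> j" for j
  proof (rule prob_space_distr)
    show "(\<lambda>\<omega>. (j, walk X \<omega> j)) \<in> measurable M face_space"
      unfolding face_space_def using that measurable_walk by (intro measurable_Pair) auto
  qed
  show s: "sets (face_intensity M X q) = sets (distr \<nu> face_space face_of_segment)"
    unfolding face_intensity_def by (subst sets_bind[where N=face_space]) (auto simp: space_length_intensity)
  fix A assume "A \<in> sets (face_intensity M X q)"
  then have A: "A \<in> sets face_space" using s by simp
  have m: "face_of_segment \<in> measurable \<nu> face_space" by measurable
  have "emeasure (distr \<nu> face_space face_of_segment) A = emeasure \<nu> (face_of_segment -` A \<inter> space segment_space)"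
    using emeasure_distr[OF m A] by simp
  also have "\<dots> = (\<integral>\<^sup>+j. ennreal (q ^ j / real j) * emeasure (?K j) A \<partial>count_space {1..})"
    using A measurable_sets[OF measurable_face_of_segment A]
    by (auto simp: emeasure_segment_intensity intro!: nn_integral_cong emeasure_segment_law_face)
  also have "\<dots> = emeasure (face_intensity M X q) A"
    unfolding face_intensity_def using K A by (intro emeasure_bind_length_intensity[symmetric]) auto
  finally show "emeasure (face_intensity M X q) A = emeasure (distr \<nu> face_space face_of_segment) A" by simp
qed

lemma slope_atomless: "emeasure \<nu> {xs \<in> space \<nu>. slope xs = c} = 0"
proof -
  let ?A = "{xs \<in> space segment_space. slope xs = c}"
  have A: "?A \<in> sets segment_space" by measurable
  have "emeasure (segment_law j) (?A \<inter> below) = 0" if j: "1 \<le> j" for j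
  proof -
    have w0: "walk X \<omega> 0 = 0" for \<omega> by (simp add: walk_def)
    have "emeasure (segment_law j) (?A \<inter> below) \<le> emeasure (segment_law j) ?A"
      using A by (intro emeasure_mono) auto
    also have "\<dots> = emeasure M {\<omega> \<in> space M. segment (walk X \<omega>) 0 j \<in> ?A}"
      by (rule emeasure_segment_law[OF j A])
    also have "\<dots> \<le> emeasure M {\<omega> \<in> space M. walk X \<omega> j = c * real j}"
    proof (rule emeasure_mono)
      show "{\<omega> \<in> space M. walk X \<omega> j = c * real j} \<in> events"
        using measurable_walk by measurable
    qed (use j slope_segment[of j _ 0] w0 in fastforce)
    also have "\<dots> = 0" by (rule walk_atomless[OF j])
    finally show ?thesis by simp
  qed
  then have "emeasure \<nu> ?A = (\<integral>\<^sup>+j. 0 \<partial>count_space {1::nat..})"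
    unfolding emeasure_segment_intensity[OF A] by (intro nn_integral_cong) auto
  then show ?thesis by simp
qed

text \<open>
  Kernels that belong to other lengths put no mass on the segments of length \<open>l\<close>.
\<close>

lemma density_segment_intensity:
  assumes l: "1 \<le> l"
  shows "density \<nu> (indicator {xs \<in> space segment_space. length xs = l})
    = density (segment_law l) (\<lambda>xs. ennreal (q ^ l) * indicator below xs)"
proof (rule measure_eqI)
  let ?L = "{xs \<in> space segment_space. length xs = l}"
  have L: "?L \<in> sets segment_space" by measurable
  fix A assume "A \<in> sets (density \<nu> (indicator ?L))"
  then have A: "A \<in> sets segment_space" by simp
  have AL: "A \<inter> ?L \<in> sets segment_space" using A L by auto
  have ALb: "A \<inter> ?L \<inter> below \<in> sets segment_space" using AL below_set_in_sets by (rule sets.Int)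
  have Ab: "A \<inter> below \<in> sets segment_space" using A below_set_in_sets by (rule sets.Int)
  have "emeasure (density \<nu> (indicator ?L)) A = (\<integral>\<^sup>+x. indicator ?L x * indicator A x \<partial>\<nu>)"
    using A L by (intro emeasure_density) auto
  also have "\<dots> = (\<integral>\<^sup>+x. indicator (A \<inter> ?L) x \<partial>\<nu>)"
    by (intro nn_integral_cong) (auto simp: indicator_def)
  also have "\<dots> = emeasure \<nu> (A \<inter> ?L)"
    using AL by simp
  also have "\<dots> = (\<integral>\<^sup>+j. ennreal (q ^ j) * emeasure (segment_law j) (A \<inter> ?L \<inter> below) \<partial>count_space {1..})"
    by (rule emeasure_segment_intensity[OF AL])
  also have "\<dots> = (\<integral>\<^sup>+j. ennreal (q ^ l) * emeasure (segment_law l) (A \<inter> below) * indicator {l} j \<partial>count_space {1..})"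
  proof (rule nn_integral_cong)
    fix j assume "j \<in> space (count_space {1::nat..})"
    then have j: "1 \<le> j" by simp
    have "{\<omega> \<in> space M. segment (walk X \<omega>) 0 j \<in> A \<inter> ?L \<inter> below}
        = (if j = l then {\<omega> \<in> space M. segment (walk X \<omega>) 0 l \<in> A \<inter> below} else {})"
      using j segment_in_space[of j] by auto
    then show "ennreal (q ^ j) * emeasure (segment_law j) (A \<inter> ?L \<inter> below)
        = ennreal (q ^ l) * emeasure (segment_law l) (A \<inter> below) * indicator {l} j"
      unfolding emeasure_segment_law[OF j ALb] emeasure_segment_law[OF l Ab] by simp
  qed
  also have "\<dots> = ennreal (q ^ l) * emeasure (segment_law l) (A \<inter> below)"
    using l by (simp add: nn_integral_cmult_indicator)
  also have "\<dots> = (\<integral>\<^sup>+x. ennreal (q ^ l) * indicator (A \<inter> below) x \<partial>segment_law l)"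
    using Ab by (simp add: nn_integral_cmult_indicator)
  also have "\<dots> = (\<integral>\<^sup>+x. (ennreal (q ^ l) * indicator below x) * indicator A x \<partial>segment_law l)"
    by (intro nn_integral_cong) (auto simp: indicator_def)
  also have "\<dots> = emeasure (density (segment_law l) (\<lambda>xs. ennreal (q ^ l) * indicator below xs)) A"
    using A below_set_in_sets by (intro emeasure_density[symmetric]) auto
  finally show "emeasure (density \<nu> (indicator ?L)) A
      = emeasure (density (segment_law l) (\<lambda>xs. ennreal (q ^ l) * indicator below xs)) A" .
qed simp

text \<open>
  Once all lengths are prescribed, the power of the intensity is a product of restricted segment
  laws, and the factors \<open>q ^ l i\<close> combine to \<open>q\<close> to the power of the total length.
\<close>

lemma emeasure_PiM_segment_intensity:
  fixes l :: "nat \<Rightarrow> nat" and f :: nat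
  assumes l: "\<And>i. 1 \<le> l i" and C: "C \<in> sets (Pi\<^sub>M {..<f} (\<lambda>_. segment_space))"
  shows "emeasure (Pi\<^sub>M {..<f} (\<lambda>_. \<nu>)) (C \<inter> {x. \<forall>i<f. length (x i) = l i})
    = ennreal (q ^ partial_sum l f) * emeasure (Pi\<^sub>M {..<f} (\<lambda>i. segment_law (l i))) (C \<inter> {x. \<forall>i<f. strictly_below_chord (x i)})"
proof -
  interpret \<nu>: finite_measure \<nu> by (rule finite_measure_segment_intensity)
  have law: "prob_space (segment_law (l i))" for i by (rule prob_space_segment_law[OF l])
  let ?L = "\<lambda>i. {xs \<in> space segment_space. length xs = l i}"
  have L: "?L i \<in> sets segment_space" for i by measurable
  have fin: "finite_measure (density \<nu> (indicator (?L i)))" for i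
  proof (rule finite_measureI)
    have "emeasure (density \<nu> (indicator (?L i))) (space segment_space) = (\<integral>\<^sup>+x. indicator (?L i) x * indicator (space segment_space) x \<partial>\<nu>)"
      using L by (intro emeasure_density) auto
    also have "\<dots> = (\<integral>\<^sup>+x. indicator (?L i) x \<partial>\<nu>)"
      by (intro nn_integral_cong) (auto simp: indicator_def)
    also have "\<dots> = emeasure \<nu> (?L i)" using L[of i] by simp
    finally show "emeasure (density \<nu> (indicator (?L i))) (space (density \<nu> (indicator (?L i)))) \<noteq> \<infinity>"
      by simp
  qed
  have sets1: "sets (Pi\<^sub>M {..<f} (\<lambda>_. \<nu>)) = sets (Pi\<^sub>M {..<f} (\<lambda>_. segment_space))"
    and sets2: "sets (Pi\<^sub>M {..<f} (\<lambda>i. segment_law (l i))) = sets (Pi\<^sub>M {..<f} (\<lambda>_. segment_space))"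
    by (intro sets_PiM_cong refl; simp)+
  have Cx: "x i \<in> space segment_space" if "x \<in> C" "i < f" for x i
    using sets.sets_into_space[OF C] that by (auto simp: space_PiM)
  have m1: "(\<lambda>x. \<Prod>i<f. indicator (?L i) (x i) :: ennreal) \<in> borel_measurable (Pi\<^sub>M {..<f} (\<lambda>_. segment_space))"
    by (intro borel_measurable_prod_ennreal measurable_compose[OF measurable_component_singleton borel_measurable_indicator] L) auto
  have m2: "(\<lambda>x. \<Prod>i<f. ennreal (q ^ l i) * indicator below (x i)) \<in> borel_measurable (Pi\<^sub>M {..<f} (\<lambda>_. segment_space))"
    by (intro borel_measurable_prod_ennreal borel_measurable_times_ennreal borel_measurable_const
      measurable_compose[OF measurable_component_singleton borel_measurable_indicator] below_set_in_sets) auto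
  have pi: "(\<Prod>i<f. indicator (D i) (x i)) * indicator C x = (indicator (C \<inter> {x. \<forall>i<f. x i \<in> D i}) x :: ennreal)"
    for D :: "nat \<Rightarrow> real list set" and x
  proof (cases "\<forall>i<f. x i \<in> D i")
    case False
    then obtain i where "i < f" "x i \<notin> D i" by auto
    then have "(\<Prod>i<f. indicator (D i) (x i) :: ennreal) = 0" by (intro prod_zero bexI[of _ i]) auto
    then show ?thesis using False by simp
  qed (simp add: indicator_def)
  have CL: "C \<inter> {x. \<forall>i<f. x i \<in> ?L i} = C \<inter> {x. \<forall>i<f. length (x i) = l i}"
    and CB: "C \<inter> {x. \<forall>i<f. x i \<in> below} = C \<inter> {x. \<forall>i<f. strictly_below_chord (x i)}"
    using Cx by auto
  have comp: "{x \<in> space (Pi\<^sub>M {..<f} (\<lambda>_. segment_space)). \<forall>i\<in>{..<f}. x i \<in> D i} \<in> sets (Pi\<^sub>M {..<f} (\<lambda>_. segment_space))"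
    if "\<And>i. D i \<in> sets segment_space" for D
    using that by (intro sets.sets_Collect_finite_All sets_Collect_single) auto
  have sCD: "C \<inter> {x. \<forall>i<f. x i \<in> D i} \<in> sets (Pi\<^sub>M {..<f} (\<lambda>_. segment_space))"
    if "\<And>i. D i \<in> sets segment_space" for D
  proof -
    have "C \<inter> {x. \<forall>i<f. x i \<in> D i} = C \<inter> {x \<in> space (Pi\<^sub>M {..<f} (\<lambda>_. segment_space)). \<forall>i\<in>{..<f}. x i \<in> D i}"
      using sets.sets_into_space[OF C] by auto
    then show ?thesis using C comp[OF that] by simp
  qed
  have "emeasure (Pi\<^sub>M {..<f} (\<lambda>i. density \<nu> (indicator (?L i)))) C
      = emeasure (density (Pi\<^sub>M {..<f} (\<lambda>_. \<nu>)) (\<lambda>x. \<Prod>i<f. indicator (?L i) (x i))) C"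
    using L fin by (subst density_PiM) (auto simp: \<nu>.sigma_finite_measure_axioms intro: finite_measure.axioms)
  also have "\<dots> = (\<integral>\<^sup>+x. (\<Prod>i<f. indicator (?L i) (x i)) * indicator C x \<partial>Pi\<^sub>M {..<f} (\<lambda>_. \<nu>))"
    using C m1 by (intro emeasure_density) (simp_all add: sets1 cong: measurable_cong_sets)
  also have "\<dots> = emeasure (Pi\<^sub>M {..<f} (\<lambda>_. \<nu>)) (C \<inter> {x. \<forall>i<f. x i \<in> ?L i})"
    unfolding pi using sCD[OF L] by (intro nn_integral_indicator) (simp add: sets1)
  finally have 1: "emeasure (Pi\<^sub>M {..<f} (\<lambda>i. density \<nu> (indicator (?L i)))) C
      = emeasure (Pi\<^sub>M {..<f} (\<lambda>_. \<nu>)) (C \<inter> {x. \<forall>i<f. length (x i) = l i})"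
    unfolding CL .
  have "emeasure (Pi\<^sub>M {..<f} (\<lambda>i. density \<nu> (indicator (?L i)))) C
      = emeasure (Pi\<^sub>M {..<f} (\<lambda>i. density (segment_law (l i)) (\<lambda>xs. ennreal (q ^ l i) * indicator below xs))) C"
    by (simp only: density_segment_intensity[OF l])
  also have "\<dots> = emeasure (density (Pi\<^sub>M {..<f} (\<lambda>i. segment_law (l i))) (\<lambda>x. \<Prod>i<f. ennreal (q ^ l i) * indicator below (x i))) C"
  proof (subst density_PiM)
    show "sigma_finite_measure (density (segment_law (l i)) (\<lambda>xs. ennreal (q ^ l i) * indicator below xs))" for i
      unfolding density_segment_intensity[OF l, symmetric] using fin by (rule finite_measure.axioms)
    show "sigma_finite_measure (segment_law (l i))" for i
      using law by (rule prob_space_imp_sigma_finite)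
    show "(\<lambda>xs. ennreal (q ^ l i) * indicator below xs) \<in> borel_measurable (segment_law (l i))" for i
      using below_set_in_sets by auto
  qed simp_all
  also have "\<dots> = (\<integral>\<^sup>+x. (\<Prod>i<f. ennreal (q ^ l i) * indicator below (x i)) * indicator C x \<partial>Pi\<^sub>M {..<f} (\<lambda>i. segment_law (l i)))"
    using C m2 by (intro emeasure_density) (simp_all add: sets2 cong: measurable_cong_sets)
  also have "\<dots> = (\<integral>\<^sup>+x. ennreal (q ^ partial_sum l f) * indicator (C \<inter> {x. \<forall>i<f. x i \<in> below}) x \<partial>Pi\<^sub>M {..<f} (\<lambda>i. segment_law (l i)))"
  proof (rule nn_integral_cong)
    fix x
    have "(\<Prod>i<f. ennreal (q ^ l i)) = ennreal (q ^ partial_sum l f)"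
      using q by (simp add: prod_ennreal power_sum partial_sum_def)
    then show "(\<Prod>i<f. ennreal (q ^ l i) * indicator below (x i)) * indicator C x
        = ennreal (q ^ partial_sum l f) * indicator (C \<inter> {x. \<forall>i<f. x i \<in> below}) x"
      unfolding pi[symmetric] by (simp only: prod.distrib mult.assoc)
  qed
  also have "\<dots> = ennreal (q ^ partial_sum l f) * emeasure (Pi\<^sub>M {..<f} (\<lambda>i. segment_law (l i))) (C \<inter> {x. \<forall>i<f. x i \<in> below})"
    using sCD[of "\<lambda>_. below"] below_set_in_sets by (intro nn_integral_cmult_indicator) (simp add: sets2)
  finally show ?thesis
    unfolding 1 CB .
qed

end

section \<open>The law of the faces\<close>

text \<open>
  The mapping theorem: numbers of image points are numbers of points in preimages, and preimages
  of disjoint sets are disjoint.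
\<close>

lemma poisson_point_process_distr:
  assumes N: "poisson_point_process M N \<mu>" and h: "h \<in> measurable \<mu> S"
    and N': "\<And>\<omega>. \<omega> \<in> space M \<Longrightarrow> N' \<omega> = distr (N \<omega>) S h"
    and M: "prob_space M"
  shows "poisson_point_process M N' (distr \<mu> S h)"
proof -
  interpret prob_space M by (rule M)
  have sN: "sets (N \<omega>) = sets \<mu>" if "\<omega> \<in> space M" for \<omega>
    using N that by (auto simp: poisson_point_process_def)
  define P where "P A = h -` A \<inter> space \<mu>" for A
  have P: "P A \<in> sets \<mu>" if "A \<in> sets S" for A
    unfolding P_def by (rule measurable_sets[OF h that])
  have eN: "emeasure (N' \<omega>) A = emeasure (N \<omega>) (P A)" if "\<omega> \<in> space M" "A \<in> sets S" for \<omega> A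
  proof -
    have "h \<in> measurable (N \<omega>) S" using h sN[OF that(1)] by (simp cong: measurable_cong_sets)
    then show ?thesis
      using that sets_eq_imp_space_eq[OF sN[OF that(1)]] by (simp add: N' emeasure_distr P_def)
  qed
  have e\<mu>: "emeasure (distr \<mu> S h) A = emeasure \<mu> (P A)" "measure (distr \<mu> S h) A = measure \<mu> (P A)"
    if "A \<in> sets S" for A
    using emeasure_distr[OF h that] by (simp_all add: P_def measure_def)
  have disj: "disjoint_family_on (\<lambda>i. P (A i)) I" if "disjoint_family_on A I" for A :: "nat \<Rightarrow> _" and I
    using that by (auto simp: disjoint_family_on_def P_def)
  show ?thesis
    unfolding poisson_point_process_def
  proof (intro conjI ballI allI impI)
    fix \<omega> assume "\<omega> \<in> space M"
    then show "sets (N' \<omega>) = sets (distr \<mu> S h)" by (simp add: N')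
  next
    fix \<omega> A assume \<omega>: "\<omega> \<in> space M" "A \<in> sets (distr \<mu> S h)"
    have "emeasure (N \<omega>) (P A) \<in> insert \<infinity> (range of_nat)"
      using N \<omega> P[of A] unfolding poisson_point_process_def by simp
    then show "emeasure (N' \<omega>) A \<in> insert \<infinity> (range of_nat)"
      using \<omega> by (simp only: eN sets_distr)
  next
    fix A assume "A \<in> sets (distr \<mu> S h)"
    then have A: "A \<in> sets S" by simp
    have "(\<lambda>\<omega>. emeasure (N \<omega>) (P A)) \<in> borel_measurable M"
      using N P[OF A] unfolding poisson_point_process_def by blast
    then show "(\<lambda>\<omega>. emeasure (N' \<omega>) A) \<in> borel_measurable M"
      by (rule measurable_cong[THEN iffD1, rotated]) (simp add: eN A)
  next
    fix A and k :: nat assume "A \<in> sets (distr \<mu> S h)" and fin: "emeasure (distr \<mu> S h) A < \<infinity>"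
    then have A: "A \<in> sets S" by simp
    have "measure M {\<omega> \<in> space M. emeasure (N \<omega>) (P A) = of_nat k} = measure \<mu> (P A) ^ k / fact k * exp (- measure \<mu> (P A))"
      using N P[OF A] fin unfolding e\<mu>[OF A] poisson_point_process_def by blast
    moreover have "{\<omega> \<in> space M. emeasure (N' \<omega>) A = of_nat k} = {\<omega> \<in> space M. emeasure (N \<omega>) (P A) = of_nat k}"
      using eN A by auto
    ultimately show "measure M {\<omega> \<in> space M. emeasure (N' \<omega>) A = of_nat k}
        = measure (distr \<mu> S h) A ^ k / fact k * exp (- measure (distr \<mu> S h) A)"
      by (simp only: e\<mu>[OF A])
  next
    fix A assume "A \<in> sets (distr \<mu> S h)" and inf: "emeasure (distr \<mu> S h) A = \<infinity>"
    then have A: "A \<in> sets S" by simp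
    have "AE \<omega> in M. emeasure (N \<omega>) (P A) = \<infinity>"
      using N P[OF A] inf unfolding e\<mu>[OF A] poisson_point_process_def by blast
    then show "AE \<omega> in M. emeasure (N' \<omega>) A = \<infinity>"
      using AE_space by eventually_elim (simp only: eN A)
  next
    fix m :: nat and A assume A: "(\<forall>i<m. A i \<in> sets (distr \<mu> S h)) \<and> disjoint_family_on A {..<m}"
    have "indep_vars (\<lambda>_. borel) (\<lambda>i \<omega>. emeasure (N \<omega>) (P (A i))) {..<m}"
      using N A P disj[of A "{..<m}"] unfolding poisson_point_process_def by auto
    then have mN: "\<forall>i\<in>{..<m}. (\<lambda>\<omega>. emeasure (N \<omega>) (P (A i))) \<in> borel_measurable M"
      and iN: "indep_sets (\<lambda>i. {(\<lambda>\<omega>. emeasure (N \<omega>) (P (A i))) -` S \<inter> space M | S. S \<in> sets borel}) {..<m}"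
      unfolding indep_vars_def2 by simp_all
    have eq: "emeasure (N' \<omega>) (A i) = emeasure (N \<omega>) (P (A i))" if "i < m" "\<omega> \<in> space M" for i \<omega>
      using eN A that by simp
    show "indep_vars (\<lambda>_. borel) (\<lambda>i \<omega>. emeasure (N' \<omega>) (A i)) {..<m}"
      unfolding indep_vars_def2
    proof
      show "\<forall>i\<in>{..<m}. (\<lambda>\<omega>. emeasure (N' \<omega>) (A i)) \<in> borel_measurable M"
      proof
        fix i assume i: "i \<in> {..<m}"
        with mN have "(\<lambda>\<omega>. emeasure (N \<omega>) (P (A i))) \<in> borel_measurable M" by blast
        then show "(\<lambda>\<omega>. emeasure (N' \<omega>) (A i)) \<in> borel_measurable M"
          by (rule measurable_cong[THEN iffD1, rotated]) (use i eq in simp)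
      qed
      show "indep_sets (\<lambda>i. {(\<lambda>\<omega>. emeasure (N' \<omega>) (A i)) -` S \<inter> space M | S. S \<in> sets borel}) {..<m}"
        using iN
      proof (rule indep_sets_cong[THEN iffD1, OF refl, rotated])
        fix i assume "i \<in> {..<m}"
        then have "(\<lambda>\<omega>. emeasure (N \<omega>) (P (A i))) -` S \<inter> space M = (\<lambda>\<omega>. emeasure (N' \<omega>) (A i)) -` S \<inter> space M" for S
          using eq by auto
        then show "{(\<lambda>\<omega>. emeasure (N \<omega>) (P (A i))) -` S \<inter> space M | S. S \<in> sets borel}
            = {(\<lambda>\<omega>. emeasure (N' \<omega>) (A i)) -` S \<inter> space M | S. S \<in> sets borel}"
          by simp
      qed
    qed
  qed
qed

lemma partial_sum_cong: "(\<And>i. i < f \<Longrightarrow> l i = l' i) \<Longrightarrow> j \<le> f \<Longrightarrow> partial_sum l j = partial_sum l' j"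
  unfolding partial_sum_def by (intro sum.cong) auto

lemma face_process_eq_distr:
  "face_process s m = distr (segment_process s m) face_space face_of_segment"
proof -
  let ?F = "num_faces s m"
  have len: "0 < face_length s m (Suc i)" if "i < ?F" for i
    using that by (rule face_length_pos)
  have seg: "face_segment s m i = segment s (face_time s m i) (face_length s m (Suc i))" for i
    by (simp add: face_segment_def segment_def)
  have time: "face_time s m (Suc i) = face_time s m i + face_length s m (Suc i)" for i
    by (simp add: face_time_def)
  have face: "face_of_segment (face_segment s m i) = (face_length s m (Suc i), face_increment s m (Suc i))"
    if "i < ?F" for i
    unfolding seg using len[OF that] by (simp add: face_of_segment_segment face_increment_def time)
  have m1: "face_segment s m \<in> measurable (count_space {..<?F}) segment_space"
    using len by (auto simp: seg intro!: segment_in_space)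
  have m2: "(\<lambda>i. (face_length s m i, face_increment s m i)) \<in> measurable (count_space {1..?F}) face_space"
  proof -
    have "0 < face_length s m i" if "i \<in> {1..?F}" for i using len[of "i - 1"] that by auto
    then show ?thesis by (auto simp: face_space_def space_pair_measure Suc_le_eq)
  qed
  have Suc: "Suc \<in> measurable (count_space {..<?F}) (count_space {1..?F})" by auto
  have "count_space {1..?F} = distr (count_space {..<?F}) (count_space {1..?F}) Suc"
    by (intro distr_bij_count_space[symmetric] bij_betw_byWitness[where f'="\<lambda>i. i - 1"]) auto
  then have "face_process s m = distr (distr (count_space {..<?F}) (count_space {1..?F}) Suc) face_space
      (\<lambda>i. (face_length s m i, face_increment s m i))"
    unfolding face_process_def by (rule arg_cong)
  also have "\<dots> = distr (count_space {..<?F}) face_space ((\<lambda>i. (face_length s m i, face_increment s m i)) \<circ> Suc)"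
    by (rule distr_distr[OF m2 Suc])
  also have "\<dots> = distr (count_space {..<?F}) face_space (face_of_segment \<circ> face_segment s m)"
    by (rule distr_cong) (auto simp: face)
  also have "\<dots> = distr (segment_process s m) face_space face_of_segment"
    unfolding segment_process_def by (rule distr_distr[OF measurable_face_of_segment m1, symmetric])
  finally show ?thesis .
qed

lemma face_times_enumerate_contact_times:
  fixes s :: "nat \<Rightarrow> real" and m :: nat
  defines "T \<equiv> face_time s m" and "F \<equiv> num_faces s m"
  shows "T 0 = 0" "T F = m" "strict_mono_on {0..F} T" "T ` {0..F} = contact_times s m"
proof -
  define l where "l = (\<lambda>i. face_length s m (Suc i))"
  have l: "0 < l i" if "i < F" for i
    using face_length_pos[of i s m] that by (simp add: l_def F_def)
  have c: "contact_times s m = partial_sum l ` {..F}"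
    unfolding l_def F_def by (rule contact_times_eq_partial_sums)
  have T: "T i = partial_sum l i" if "i \<le> F" for i
    unfolding T_def using face_time_eq[OF l c that] .
  show "T 0 = 0" using T[of 0] by simp
  show "T F = m" using T[of F] partial_sum_face_length[of s m] by (simp add: l_def F_def)
  show "strict_mono_on {0..F} T"
    using strict_mono_onD[OF partial_sum_strict_mono[of F l, OF l]] T by (intro strict_mono_onI) auto
  show "T ` {0..F} = contact_times s m"
    unfolding c atLeast0AtMost using T by (intro image_cong) auto
qed

locale killed_walk = weighted_iid_sequence +
  fixes n :: "'a \<Rightarrow> nat"
  assumes measurable_n: "n \<in> measurable M (count_space UNIV)"
    and indep_n: "indep_set
           (sets (vimage_algebra (space M) n (count_space UNIV)))
           (sets (vimage_algebra (space M) (\<lambda>\<omega>. \<lambda>i\<in>{1..}. X i \<omega>) (Pi\<^sub>M {1..} (\<lambda>_. borel))))"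
    and tail_n: "\<And>k. prob {\<omega> \<in> space M. k \<le> n \<omega>} = q ^ k"
begin

lemma prob_n: "prob {\<omega> \<in> space M. n \<omega> = k} = (1 - q) * q ^ k"
proof -
  have ev: "{\<omega> \<in> space M. k \<le> n \<omega>} \<in> events" for k
    using measurable_n by measurable
  have "{\<omega> \<in> space M. n \<omega> = k} = {\<omega> \<in> space M. k \<le> n \<omega>} - {\<omega> \<in> space M. Suc k \<le> n \<omega>}"
    by auto
  also have "prob \<dots> = prob {\<omega> \<in> space M. k \<le> n \<omega>} - prob {\<omega> \<in> space M. Suc k \<le> n \<omega>}"
    using ev by (intro finite_measure_Diff) auto
  finally show ?thesis by (simp add: tail_n algebra_simps)
qed

definition segments :: "(nat \<Rightarrow> nat) \<Rightarrow> nat \<Rightarrow> 'a \<Rightarrow> nat \<Rightarrow> real list" where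
  "segments l f \<omega> = (\<lambda>i\<in>{..<f}. segment (walk X \<omega>) (partial_sum l i) (l i))"

lemma law_of_segments:
  assumes l: "\<And>i. 1 \<le> l i" and D: "D \<in> sets (Pi\<^sub>M {..<f} (\<lambda>_. segment_space))"
  shows "{\<omega> \<in> space M. n \<omega> = k \<and> segments l f \<omega> \<in> D} \<in> events"
    and "emeasure M {\<omega> \<in> space M. n \<omega> = k \<and> segments l f \<omega> \<in> D}
      = ennreal ((1 - q) * q ^ k) * emeasure (Pi\<^sub>M {..<f} (\<lambda>i. segment_law (l i))) D"
proof -
  let ?Q = "Pi\<^sub>M {1..} (\<lambda>_. borel) :: (nat \<Rightarrow> real) measure"
  let ?A = "{\<omega> \<in> space M. n \<omega> = k}" and ?B = "{\<omega> \<in> space M. segments l f \<omega> \<in> D}"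
  have "?A = n -` {k} \<inter> space M" by auto
  then have A: "?A \<in> sets (vimage_algebra (space M) n (count_space UNIV))"
    by (simp add: in_vimage_algebra)
  let ?h = "\<lambda>x. \<lambda>i\<in>{..<f}. segment (walk_of x) (partial_sum l i) (l i)"
  have h: "?h \<in> measurable ?Q (Pi\<^sub>M {..<f} (\<lambda>_. segment_space))"
    using l by (intro measurable_restrict measurable_segment_walk_of measurable_component_singleton) auto
  have "segment (walk_of (\<lambda>i\<in>{1..}. x i)) t j = segment (walk_of x) t j" for x t j
    unfolding segment_def walk_of_add by (auto intro!: walk_of_cong)
  then have hX: "?h (\<lambda>i\<in>{1..}. X i \<omega>) = segments l f \<omega>" for \<omega>
    unfolding segments_def walk_eq_walk_of by simp
  have "?B = (\<lambda>\<omega>. \<lambda>i\<in>{1..}. X i \<omega>) -` (?h -` D \<inter> space ?Q) \<inter> space M"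
    using hX by (auto simp: space_PiM)
  then have B: "?B \<in> sets (vimage_algebra (space M) (\<lambda>\<omega>. \<lambda>i\<in>{1..}. X i \<omega>) ?Q)"
    using measurable_sets[OF h D] by (simp only: in_vimage_algebra)
  have AB: "{\<omega> \<in> space M. n \<omega> = k \<and> segments l f \<omega> \<in> D} = ?A \<inter> ?B" by auto
  have ev: "?A \<in> events" "?B \<in> events"
    using A B indep_setD_ev1[OF indep_n] indep_setD_ev2[OF indep_n] by auto
  then show "{\<omega> \<in> space M. n \<omega> = k \<and> segments l f \<omega> \<in> D} \<in> events"
    unfolding AB by (rule sets.Int)
  have m: "segments l f \<in> measurable M (Pi\<^sub>M {..<f} (\<lambda>_. segment_space))"
    unfolding segments_def using l by (intro measurable_restrict measurable_segment_walk) auto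
  have "emeasure M ?B = emeasure (distr M (Pi\<^sub>M {..<f} (\<lambda>_. segment_space)) (segments l f)) D"
    using emeasure_distr[OF m D] by (simp add: vimage_def Int_def conj_commute)
  also have "distr M (Pi\<^sub>M {..<f} (\<lambda>_. segment_space)) (segments l f) = Pi\<^sub>M {..<f} (\<lambda>i. segment_law (l i))"
    unfolding segments_def using l by (intro distr_segments)
  finally have pB: "emeasure M ?B = emeasure (Pi\<^sub>M {..<f} (\<lambda>i. segment_law (l i))) D" .
  have "emeasure M (?A \<inter> ?B) = ennreal (prob ?A) * emeasure M ?B"
    using indep_setD[OF indep_n A B] by (simp add: emeasure_eq_measure ennreal_mult)
  then show "emeasure M {\<omega> \<in> space M. n \<omega> = k \<and> segments l f \<omega> \<in> D}
      = ennreal ((1 - q) * q ^ k) * emeasure (Pi\<^sub>M {..<f} (\<lambda>i. segment_law (l i))) D"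
    unfolding AB pB prob_n .
qed

lemma face_segments_eq_segments:
  assumes l: "\<And>i. i < f \<Longrightarrow> 0 < l i"
    and c: "contact_times (walk X \<omega>) (n \<omega>) = partial_sum l ` {..f}"
  shows "(\<lambda>i\<in>{..<f}. face_segment (walk X \<omega>) (n \<omega>) i) = segments l f \<omega>"
  unfolding segments_def using face_segment_eq[OF l c] by (intro restrict_ext) auto

lemma segments_concave_iff:
  assumes l: "\<And>i. i < f \<Longrightarrow> 0 < l i"
  shows "n \<omega> = partial_sum l f \<and> segments l f \<omega> \<in> decreasing_tuples slope f \<inter> {x. \<forall>i<f. strictly_below_chord (x i)}
    \<longleftrightarrow> n \<omega> = partial_sum l f \<and> contact_times (walk X \<omega>) (n \<omega>) = partial_sum l ` {..f}"
proof (rule conj_cong[OF refl])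
  assume m: "n \<omega> = partial_sum l f"
  let ?e = "\<lambda>i. segment (walk X \<omega>) (partial_sum l i) (l i)"
  have e: "segments l f \<omega> i = ?e i" if "i < f" for i
    using that by (simp add: segments_def)
  show "segments l f \<omega> \<in> decreasing_tuples slope f \<inter> {x. \<forall>i<f. strictly_below_chord (x i)}
    \<longleftrightarrow> contact_times (walk X \<omega>) (n \<omega>) = partial_sum l ` {..f}" (is "?cone \<longleftrightarrow> ?contact")
  proof
    assume ?cone
    then have below: "\<And>i. i < f \<Longrightarrow> strictly_below_chord (?e i)"
      and dec: "\<And>i j. j < f \<Longrightarrow> i \<le> j \<Longrightarrow> slope (?e j) \<le> slope (?e i)"
      using e by (simp_all add: decreasing_tuples_def)
    show ?contact
      by (rule concave_imp_contact_times) (simp_all add: l m below dec)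
  next
    assume c: ?contact
    have "strictly_below_chord (?e i)" if "i < f" for i
      using contact_times_imp_concave(1)[OF l m c that] by simp
    moreover have "slope (?e j) \<le> slope (?e i)" if "i \<le> j" "j < f" for i j
      using contact_times_imp_concave(2)[OF l m c, of i j] that by simp
    ultimately show ?cone
      using e by (simp add: decreasing_tuples_def)
  qed
qed

text \<open>
  For prescribed face lengths, the event that the contact times are the corresponding partial sums
  only involves \<open>n\<close> and independent segments between fixed times. The probabilities are then added
  over the countably many possible sequences of lengths.
\<close>

lemma law_of_faces:
  assumes C: "C \<in> sets (Pi\<^sub>M {..<f} (\<lambda>_. segment_space))"
  defines "Ev \<equiv> {\<omega> \<in> space M. num_faces (walk X \<omega>) (n \<omega>) = f \<and>
      (\<lambda>i\<in>{..<f}. face_segment (walk X \<omega>) (n \<omega>) i) \<in> C}"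
  shows "Ev \<in> events"
    and "emeasure M Ev = ennreal (1 - q) * emeasure (Pi\<^sub>M {..<f} (\<lambda>_. \<nu>)) (C \<inter> decreasing_tuples slope f)"
proof -
  interpret \<nu>: finite_measure \<nu> by (rule finite_measure_segment_intensity)
  \<comment> \<open>The lengths are \<open>Suc (m i)\<close> with \<open>m\<close> in \<open>I\<close>: this makes them positive for all \<open>i\<close>, also for
    those beyond \<open>f\<close>, where \<open>m i\<close> is an unspecified number.\<close>
  define I where "I = (Pi\<^sub>E {..<f} (\<lambda>_. UNIV) :: (nat \<Rightarrow> nat) set)"
  have cI: "countable I" unfolding I_def by (intro countable_PiE) auto
  let ?P = "Pi\<^sub>M {..<f} (\<lambda>_. segment_space)"
  have sP: "sets (Pi\<^sub>M {..<f} (\<lambda>_. \<nu>)) = sets ?P" by (intro sets_PiM_cong) auto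
  let ?CD = "C \<inter> decreasing_tuples slope f"
  have CD: "?CD \<in> sets ?P"
    using \<nu>.sets_decreasing_tuples[of slope C f] C by (simp add: sP)
  have in_len: "C' \<inter> {x. \<forall>i<f. P i (x i)} \<in> sets ?P"
    if C': "C' \<in> sets ?P" and P: "\<And>i. Measurable.pred segment_space (P i)" for C' P
  proof -
    have "{x \<in> space ?P. \<forall>i\<in>{..<f}. x i \<in> {xs \<in> space segment_space. P i xs}} \<in> sets ?P"
      using P by (intro sets.sets_Collect_finite_All sets_Collect_single) auto
    moreover have "C' \<inter> {x. \<forall>i<f. P i (x i)} = C' \<inter> {x \<in> space ?P. \<forall>i\<in>{..<f}. x i \<in> {xs \<in> space segment_space. P i xs}}"
      using sets.sets_into_space[OF C'] by (auto simp: space_PiM PiE_iff)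
    ultimately show ?thesis using C' by simp
  qed
  define D where "D = ?CD \<inter> {x. \<forall>i<f. strictly_below_chord (x i)}"
  have D: "D \<in> sets ?P" unfolding D_def by (intro in_len CD) measurable
  define E where "E m = {\<omega> \<in> space M. n \<omega> = partial_sum (Suc \<circ> m) f \<and> segments (Suc \<circ> m) f \<omega> \<in> D}" for m
  have E_iff: "\<omega> \<in> E m \<longleftrightarrow> \<omega> \<in> space M \<and> n \<omega> = partial_sum (Suc \<circ> m) f
      \<and> contact_times (walk X \<omega>) (n \<omega>) = partial_sum (Suc \<circ> m) ` {..f}
      \<and> (\<lambda>i\<in>{..<f}. face_segment (walk X \<omega>) (n \<omega>) i) \<in> C" for m \<omega>
    using segments_concave_iff[of f "Suc \<circ> m" \<omega>] face_segments_eq_segments[of f "Suc \<circ> m" \<omega>]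
    by (auto simp: E_def D_def)
  have E_sets: "E m \<in> events" for m
    unfolding E_def by (intro law_of_segments D) auto
  have Ev: "Ev = (\<Union>m\<in>I. E m)"
  proof (intro equalityI subsetI)
    fix \<omega> assume \<omega>: "\<omega> \<in> Ev"
    define l where "l = (\<lambda>i. face_length (walk X \<omega>) (n \<omega>) (Suc i))"
    define m where "m = (\<lambda>i\<in>{..<f}. l i - 1)"
    have f: "num_faces (walk X \<omega>) (n \<omega>) = f" using \<omega> by (simp add: Ev_def)
    have "(Suc \<circ> m) i = l i" if "i < f" for i
      using that face_length_pos[of i "walk X \<omega>" "n \<omega>"] by (simp add: m_def f l_def)
    then have ps: "partial_sum (Suc \<circ> m) j = partial_sum l j" if "j \<le> f" for j
      using that by (intro partial_sum_cong) auto
    then have "partial_sum (Suc \<circ> m) ` {..f} = partial_sum l ` {..f}"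
      by (intro image_cong) auto
    then have "contact_times (walk X \<omega>) (n \<omega>) = partial_sum (Suc \<circ> m) ` {..f}" "n \<omega> = partial_sum (Suc \<circ> m) f"
      using contact_times_eq_partial_sums[of "walk X \<omega>" "n \<omega>"] partial_sum_face_length[of "walk X \<omega>" "n \<omega>"]
        ps[of f] by (simp_all add: f l_def)
    then have "\<omega> \<in> E m" using \<omega> by (simp add: E_iff Ev_def)
    moreover have "m \<in> I" by (simp add: I_def m_def)
    ultimately show "\<omega> \<in> (\<Union>m\<in>I. E m)" by blast
  next
    fix \<omega> assume "\<omega> \<in> (\<Union>m\<in>I. E m)"
    then obtain m where "\<omega> \<in> E m" by auto
    then show "\<omega> \<in> Ev"
      using num_faces_eq[of f "Suc \<circ> m" "walk X \<omega>" "n \<omega>"] by (auto simp: E_iff Ev_def)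
  qed
  have disj: "disjoint_family_on E I"
    unfolding disjoint_family_on_def
  proof (intro ballI impI, rule ccontr)
    fix m m' assume m: "m \<in> I" "m' \<in> I" "m \<noteq> m'" "E m \<inter> E m' \<noteq> {}"
    then obtain \<omega> where \<omega>: "\<omega> \<in> E m" "\<omega> \<in> E m'" by auto
    have "m i = m' i" if "i < f" for i
      using \<omega> face_length_eq[of f "Suc \<circ> m" "walk X \<omega>" "n \<omega>" i] 
        face_length_eq[of f "Suc \<circ> m'" "walk X \<omega>" "n \<omega>" i] that by (auto simp: E_iff)
    then have "m = m'"
      by (rule PiE_ext[OF m(1,2)[unfolded I_def]]) simp
    then show False using m(3) by contradiction
  qed
  show "Ev \<in> events"
    unfolding Ev using cI E_sets by (intro sets.countable_UN') auto
  have len_sets: "?CD \<inter> {x. \<forall>i<f. length (x i) = (Suc \<circ> m) i} \<in> sets ?P" for m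
    by (intro in_len CD) measurable
  have E_emeasure: "emeasure M (E m) = ennreal (1 - q) * emeasure (Pi\<^sub>M {..<f} (\<lambda>_. \<nu>)) (?CD \<inter> {x. \<forall>i<f. length (x i) = (Suc \<circ> m) i})" for m
  proof -
    let ?k = "partial_sum (Suc \<circ> m) f"
    have "emeasure M (E m) = ennreal ((1 - q) * q ^ ?k) * emeasure (Pi\<^sub>M {..<f} (\<lambda>i. segment_law ((Suc \<circ> m) i))) D"
      unfolding E_def by (intro law_of_segments(2) D) simp
    also have "\<dots> = ennreal (1 - q) * (ennreal (q ^ ?k) * emeasure (Pi\<^sub>M {..<f} (\<lambda>i. segment_law ((Suc \<circ> m) i))) D)"
      using q by (simp add: ennreal_mult mult.assoc)
    also have "ennreal (q ^ ?k) * emeasure (Pi\<^sub>M {..<f} (\<lambda>i. segment_law ((Suc \<circ> m) i))) D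
        = emeasure (Pi\<^sub>M {..<f} (\<lambda>_. \<nu>)) (?CD \<inter> {x. \<forall>i<f. length (x i) = (Suc \<circ> m) i})"
      unfolding D_def by (intro emeasure_PiM_segment_intensity[symmetric] CD) simp
    finally show ?thesis .
  qed
  have "emeasure M Ev = (\<integral>\<^sup>+m. emeasure M (E m) \<partial>count_space I)"
    unfolding Ev using E_sets cI disj by (intro emeasure_UN_countable) auto
  also have "\<dots> = ennreal (1 - q) * (\<integral>\<^sup>+m. emeasure (Pi\<^sub>M {..<f} (\<lambda>_. \<nu>)) (?CD \<inter> {x. \<forall>i<f. length (x i) = (Suc \<circ> m) i}) \<partial>count_space I)"
    unfolding E_emeasure by (rule nn_integral_cmult) simp
  also have "(\<integral>\<^sup>+m. emeasure (Pi\<^sub>M {..<f} (\<lambda>_. \<nu>)) (?CD \<inter> {x. \<forall>i<f. length (x i) = (Suc \<circ> m) i}) \<partial>count_space I)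
      = emeasure (Pi\<^sub>M {..<f} (\<lambda>_. \<nu>)) (\<Union>m\<in>I. ?CD \<inter> {x. \<forall>i<f. length (x i) = (Suc \<circ> m) i})"
  proof (rule emeasure_UN_countable[symmetric])
    show "disjoint_family_on (\<lambda>m. ?CD \<inter> {x. \<forall>i<f. length (x i) = (Suc \<circ> m) i}) I"
      unfolding disjoint_family_on_def
    proof (intro ballI impI, rule ccontr)
      fix m m'
      assume m: "m \<in> I" "m' \<in> I" "m \<noteq> m'" and "(?CD \<inter> {x. \<forall>i<f. length (x i) = (Suc \<circ> m) i}) \<inter>
        (?CD \<inter> {x. \<forall>i<f. length (x i) = (Suc \<circ> m') i}) \<noteq> {}"
      then obtain x where x: "x \<in> ?CD \<inter> {x. \<forall>i<f. length (x i) = (Suc \<circ> m) i}"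
          "x \<in> ?CD \<inter> {x. \<forall>i<f. length (x i) = (Suc \<circ> m') i}"
        by (meson disjoint_iff)
      have "m i = m' i" if "i \<in> {..<f}" for i
      proof -
        have "length (x i) = Suc (m i)" using x(1) that by simp
        moreover have "length (x i) = Suc (m' i)" using x(2) that by simp
        ultimately show ?thesis by simp
      qed
      then have "m = m'"
        by (rule PiE_ext[OF m(1,2)[unfolded I_def]])
      then show False using m(3) by contradiction
    qed
  qed (use len_sets sP cI in auto)
  also have "(\<Union>m\<in>I. ?CD \<inter> {x. \<forall>i<f. length (x i) = (Suc \<circ> m) i}) = ?CD"
  proof (intro equalityI subsetI)
    fix x assume x: "x \<in> ?CD"
    let ?m = "\<lambda>i\<in>{..<f}. length (x i) - 1"
    have "length (x i) \<noteq> 0" if "i < f" for i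
      using sets.sets_into_space[OF CD] x that by (auto simp: space_PiM space_segment_space)
    then have "x \<in> ?CD \<inter> {x. \<forall>i<f. length (x i) = (Suc \<circ> ?m) i}" using x by simp
    moreover have "?m \<in> I" by (simp add: I_def)
    ultimately show "x \<in> (\<Union>m\<in>I. ?CD \<inter> {x. \<forall>i<f. length (x i) = (Suc \<circ> m) i})" by blast
  qed auto
  finally show "emeasure M Ev = ennreal (1 - q) * emeasure (Pi\<^sub>M {..<f} (\<lambda>_. \<nu>)) ?CD" .
qed

lemma poisson_segment_process:
  "poisson_point_process M (\<lambda>\<omega>. segment_process (walk X \<omega>) (n \<omega>)) \<nu>"
proof -
  interpret \<nu>: finite_measure \<nu> by (rule finite_measure_segment_intensity)
  have sP: "sets (Pi\<^sub>M {..<f} (\<lambda>_. \<nu>)) = sets (Pi\<^sub>M {..<f} (\<lambda>_. segment_space))" for f :: nat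
    by (intro sets_PiM_cong) auto
  interpret decreasing_listing M \<nu> slope "\<lambda>\<omega>. num_faces (walk X \<omega>) (n \<omega>)"
    "\<lambda>i \<omega>. face_segment (walk X \<omega>) (n \<omega>) i"
  proof
    show "slope \<in> borel_measurable \<nu>" by measurable
    show "emeasure \<nu> {xs \<in> space \<nu>. slope xs = c} = 0" for c by (rule slope_atomless)
    show "face_segment (walk X \<omega>) (n \<omega>) i \<in> space \<nu>" if "i < num_faces (walk X \<omega>) (n \<omega>)" for \<omega> i
    proof -
      have "0 < length (face_segment (walk X \<omega>) (n \<omega>) i)"
        using face_length_pos[OF that] by (simp add: face_segment_def)
      then show ?thesis by (simp add: space_segment_space)
    qed
    fix f C assume "C \<in> sets (Pi\<^sub>M {..<f::nat} (\<lambda>_. \<nu>))"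
    then have C: "C \<in> sets (Pi\<^sub>M {..<f} (\<lambda>_. segment_space))" by (simp only: sP)
    show "{\<omega> \<in> space M. num_faces (walk X \<omega>) (n \<omega>) = f \<and> (\<lambda>i\<in>{..<f}. face_segment (walk X \<omega>) (n \<omega>) i) \<in> C} \<in> events"
      by (rule law_of_faces(1)[OF C])
    show "emeasure M {\<omega> \<in> space M. num_faces (walk X \<omega>) (n \<omega>) = f \<and> (\<lambda>i\<in>{..<f}. face_segment (walk X \<omega>) (n \<omega>) i) \<in> C}
        = ennreal (exp (- measure \<nu> (space \<nu>))) * emeasure (Pi\<^sub>M {..<f} (\<lambda>_. \<nu>)) (C \<inter> decreasing_tuples slope f)"
      unfolding exp_segment_intensity by (rule law_of_faces(2)[OF C])
  qed
  have "segment_process s m = distr (count_space {..<num_faces s m}) \<nu> (face_segment s m)" for s m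
    unfolding segment_process_def by (rule distr_cong) auto
  then show ?thesis
    using poisson_point_process_listing by simp
qed

end

theorem theorem7:
  fixes M :: "'a measure" and X :: "nat \<Rightarrow> 'a \<Rightarrow> real" and n :: "'a \<Rightarrow> nat" and q :: real
  assumes "prob_space M"
    and "prob_space.indep_vars M (\<lambda>_. borel) X {1..}"
    and "\<And>i. 1 \<le> i \<Longrightarrow> distr M borel (X i) = distr M borel (X 1)"
    and "\<And>x. emeasure (distr M borel (X 1)) {x} = 0"
    and "0 < q" and "q < 1"
    and "n \<in> measurable M (count_space UNIV)"
    and "prob_space.indep_set M
           (sets (vimage_algebra (space M) n (count_space UNIV)))
           (sets (vimage_algebra (space M) (\<lambda>\<omega>. \<lambda>i\<in>{1..}. X i \<omega>) (Pi\<^sub>M {1..} (\<lambda>_. borel))))"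
    and "\<And>k. measure M {\<omega>\<in>space M. k \<le> n \<omega>} = q ^ k"
  shows "poisson_point_process M (\<lambda>\<omega>. face_process (walk X \<omega>) (n \<omega>)) (face_intensity M X q)
    \<and> (\<forall>\<omega>\<in>space M.
          let T = face_time (walk X \<omega>) (n \<omega>); F = num_faces (walk X \<omega>) (n \<omega>)
          in T 0 = 0 \<and> T F = n \<omega> \<and> strict_mono_on {0..F} T
             \<and> T ` {0..F} = contact_times (walk X \<omega>) (n \<omega>))
    \<and> poisson_point_process M (\<lambda>\<omega>. segment_process (walk X \<omega>) (n \<omega>)) (segment_intensity M X q)"
proof -
  interpret prob_space M by fact
  have "iid_sequence M X"
  proof (intro iid_sequence.intro iid_sequence_axioms.intro)
    show "distr M borel (X i) = distr M borel (X 1)" if "1 \<le> i" for i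
      using that by (rule assms(3))
    show "emeasure (distr M borel (X 1)) {x} = 0" for x
      by (rule assms(4))
  qed (rule assms(1), rule assms(2))
  then have "weighted_iid_sequence M X q"
    using assms(5,6) by (intro weighted_iid_sequence.intro weighted_iid_sequence_axioms.intro)
  moreover have "killed_walk_axioms M X q n"
  proof (rule killed_walk_axioms.intro)
    show "prob {\<omega> \<in> space M. k \<le> n \<omega>} = q ^ k" for k
      by (rule assms(9))
  qed (rule assms(7), rule assms(8))
  ultimately interpret killed_walk M X q n
    by (rule killed_walk.intro)
  have "poisson_point_process M (\<lambda>\<omega>. face_process (walk X \<omega>) (n \<omega>)) (face_intensity M X q)"
    unfolding face_intensity_eq_distr
    by (rule poisson_point_process_distr[OF poisson_segment_process])
      (auto simp: face_process_eq_distr prob_space_axioms)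
  then show ?thesis
    unfolding Let_def
    by (intro conjI ballI face_times_enumerate_contact_times poisson_segment_process)
qed

end
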